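(* There is a polynomial-time algorithm that, given any instance $(D,w,\mathcal{T})$ of the Asymmetric Steiner Multicycle problem where $D$ has $n$ vertices, outputs a directed 2-factor of $D$ that respects $\mathcal{T}$ and has weight at most $\mathrm{O}(\lg n)\cdot\mathrm{opt}(D,w,\mathcal{T})$. That is, there is an $\mathrm{O}(\lg n)$-approximation algorithm for the Asymmetric Steiner Multicycle problem.
   Context: Asymmetric Steiner Multicycle problem: the input is a complete digraph $D$ on $n$ vertices (both arcs $(u,v)$ and $(v,u)$ present for all distinct $u,v$), a weight function $w\colon A(D)\to\mathbb{Q}_{\ge 0}$ (not necessarily with $w(u,v)=w(v,u)$) satisfying the triangle inequality $w(a,c)\le w(a,b)+w(b,c)$ for all distinct $a,b,c\in V(D)$, and a collection $\mathcal{T}$ of terminal sets (each of size at least 2) that partitions $V(D)$. A directed 2-factor of $D$ is a set of vertex-disjoint directed cycles of $D$ covering all vertices. A directed cycle $C$ respects $\mathcal{T}$ if for every $T\in\mathcal{T}$ either $T\subseteq V(C)$ or $T\cap V(C)=\emptyset$; a 2-factor respects $\mathcal{T}$ if all its cycles do. The weight of a 2-factor is the sum of the weights of its arcs, and $\mathrm{opt}(D,w,\mathcal{T})$ is the minimum weight of a directed 2-factor of $D$ that respects $\mathcal{T}$. *)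

theory Defs
  imports
    "Graph_Theory.Graph_Theory"
    "HOL-Computational_Algebra.Polynomial"
    "HOL-Library.Disjoint_Sets"
    "HOL-Library.Landau_Symbols"
    "HOL-Library.Log_Nat"
begin

section \<open>The Asymmetric Steiner Multicycle problem\<close>

locale asymmetric_steiner_multicycle =
  fixes D :: "'a pair_pre_digraph"
    and w :: "'a \<times> 'a \<Rightarrow> rat"
    and \<T> :: "'a set set"
  assumes complete: "complete_digraph (card (pverts D)) (with_proj D)"
    and weight_nonneg: "e \<in> parcs D \<Longrightarrow> 0 \<le> w e"
    and triangle: "\<lbrakk>a \<in> pverts D; b \<in> pverts D; c \<in> pverts D; a \<noteq> b; b \<noteq> c; a \<noteq> c\<rbrakk>
                    \<Longrightarrow> w (a, c) \<le> w (a, b) + w (b, c)"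
    and terminals_partition: "partition_on (pverts D) \<T>"
    and terminals_card: "T \<in> \<T> \<Longrightarrow> 2 \<le> card T"

text \<open>Cycles are arc lists, as in \<^const>\<open>pre_digraph.cycle\<close>. Two rotations of the same cycle
  are different lists, but they share vertices and hence never belong to the same 2-factor.\<close>

definition cycle_verts :: "('a \<times> 'a) awalk \<Rightarrow> 'a set" where
  "cycle_verts C = fst ` set C"

definition directed_two_factor :: "'a pair_pre_digraph \<Rightarrow> ('a \<times> 'a) awalk set \<Rightarrow> bool" where
  "directed_two_factor D F \<longleftrightarrow>
     (\<forall>C\<in>F. pre_digraph.cycle (with_proj D) C) \<and>
     disjoint_family_on cycle_verts F \<and>
     (\<Union>C\<in>F. cycle_verts C) = pverts D"

definition cycle_respects :: "'a set set \<Rightarrow> ('a \<times> 'a) awalk \<Rightarrow> bool" where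
  "cycle_respects \<T> C \<longleftrightarrow> (\<forall>T\<in>\<T>. T \<subseteq> cycle_verts C \<or> T \<inter> cycle_verts C = {})"

definition two_factor_respects :: "'a set set \<Rightarrow> ('a \<times> 'a) awalk set \<Rightarrow> bool" where
  "two_factor_respects \<T> F \<longleftrightarrow> (\<forall>C\<in>F. cycle_respects \<T> C)"

definition two_factor_arcs :: "('a \<times> 'a) awalk set \<Rightarrow> ('a \<times> 'a) set" where
  "two_factor_arcs F = (\<Union>C\<in>F. set C)"

definition two_factor_weight :: "('a \<times> 'a \<Rightarrow> rat) \<Rightarrow> ('a \<times> 'a) awalk set \<Rightarrow> rat" where
  "two_factor_weight w F = (\<Sum>e\<in>two_factor_arcs F. w e)"

definition opt :: "'a pair_pre_digraph \<Rightarrow> ('a \<times> 'a \<Rightarrow> rat) \<Rightarrow> 'a set set \<Rightarrow> rat" where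
  "opt D w \<T> =
     Min {two_factor_weight w F |F. directed_two_factor D F \<and> two_factor_respects \<T> F}"

text \<open>The minimum in \<^const>\<open>opt\<close> ranges over a finite set.\<close>

lemma (in asymmetric_steiner_multicycle) finite_two_factor_weights:
  "finite {two_factor_weight w F |F. directed_two_factor D F \<and> two_factor_respects \<T> F}"
proof -
  have fin: "finite (parcs D)"
  proof (rule finite_subset)
    show "parcs D \<subseteq> pverts D \<times> pverts D" "finite (pverts D \<times> pverts D)"
      using complete by (auto simp: complete_digraph_pair_def)
  qed
  have sub: "two_factor_arcs F \<subseteq> parcs D" if "directed_two_factor D F" for F
  proof -
    have "set C \<subseteq> parcs D" if "C \<in> F" for C
      using \<open>directed_two_factor D F\<close> that
      by (auto simp: directed_two_factor_def pre_digraph.cycle_def pre_digraph.awalk_def)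
    then show ?thesis
      unfolding two_factor_arcs_def by (rule UN_least)
  qed
  have "{two_factor_weight w F |F. directed_two_factor D F \<and> two_factor_respects \<T> F}
          \<subseteq> sum w ` Pow (parcs D)"
    using sub unfolding two_factor_weight_def by blast
  then show ?thesis
    using fin by (meson finite_Pow_iff finite_imageI finite_subset)
qed

section \<open>Model of computation\<close>

text \<open>
  A random access machine with the logarithmic cost criterion, presented as a while language over
  finitely many integer arrays. Every evaluation of a (sub)expression is charged the bit length of
  its value; in particular array accesses are charged for the address and for the contents. Under
  this measure the model and Turing machines simulate each other with polynomial overhead.
\<close>

type_synonym store = "string \<Rightarrow> int \<Rightarrow> int"

datatype aexp =
    Const int
  | Cell string aexp
  | Plus aexp aexp
  | Minus aexp aexp
  | Times aexp aexp
  | Div aexp aexp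

datatype bexp =
    Less aexp aexp
  | Neg bexp
  | And bexp bexp

datatype com =
    SKIP
  | Assign string aexp aexp
  | Seq com com
  | Cond bexp com com
  | While bexp com

fun aval :: "aexp \<Rightarrow> store \<Rightarrow> int" where
  "aval (Const k) s = k"
| "aval (Cell x a) s = s x (aval a s)"
| "aval (Plus a b) s = aval a s + aval b s"
| "aval (Minus a b) s = aval a s - aval b s"
| "aval (Times a b) s = aval a s * aval b s"
| "aval (Div a b) s = aval a s div aval b s"

fun bval :: "bexp \<Rightarrow> store \<Rightarrow> bool" where
  "bval (Less a b) s \<longleftrightarrow> aval a s < aval b s"
| "bval (Neg b) s \<longleftrightarrow> \<not> bval b s"
| "bval (And b c) s \<longleftrightarrow> bval b s \<and> bval c s"

text \<open>The number of bits of an integer in sign-magnitude representation.\<close>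

definition int_size :: "int \<Rightarrow> nat" where
  "int_size k = 1 + nat (bitlen \<bar>k\<bar>)"

fun acost :: "aexp \<Rightarrow> store \<Rightarrow> nat" where
  "acost (Const k) s = int_size k"
| "acost (Cell x a) s = acost a s + int_size (aval (Cell x a) s)"
| "acost (Plus a b) s = acost a s + acost b s + int_size (aval (Plus a b) s)"
| "acost (Minus a b) s = acost a s + acost b s + int_size (aval (Minus a b) s)"
| "acost (Times a b) s = acost a s + acost b s + int_size (aval (Times a b) s)"
| "acost (Div a b) s = acost a s + acost b s + int_size (aval (Div a b) s)"

fun bcost :: "bexp \<Rightarrow> store \<Rightarrow> nat" where
  "bcost (Less a b) s = acost a s + acost b s + 1"
| "bcost (Neg b) s = bcost b s + 1"
| "bcost (And b c) s = bcost b s + bcost c s + 1"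

text \<open>\<open>exec c s t s'\<close>: started in store \<open>s\<close>, program \<open>c\<close> halts in store \<open>s'\<close> after time \<open>t\<close>.\<close>

inductive exec :: "com \<Rightarrow> store \<Rightarrow> nat \<Rightarrow> store \<Rightarrow> bool" where
  exec_SKIP: "exec SKIP s 1 s"
| exec_Assign: "exec (Assign x i a) s (acost i s + acost a s + 1)
                  (s(x := (s x)(aval i s := aval a s)))"
| exec_Seq: "\<lbrakk>exec c s t s'; exec d s' u s''\<rbrakk> \<Longrightarrow> exec (Seq c d) s (t + u) s''"
| exec_CondTrue: "\<lbrakk>bval b s; exec c s t s'\<rbrakk> \<Longrightarrow> exec (Cond b c d) s (bcost b s + t + 1) s'"
| exec_CondFalse: "\<lbrakk>\<not> bval b s; exec d s t s'\<rbrakk> \<Longrightarrow> exec (Cond b c d) s (bcost b s + t + 1) s'"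
| exec_WhileFalse: "\<not> bval b s \<Longrightarrow> exec (While b c) s (bcost b s + 1) s"
| exec_WhileTrue: "\<lbrakk>bval b s; exec c s t s'; exec (While b c) s' u s''\<rbrakk>
                     \<Longrightarrow> exec (While b c) s (bcost b s + t + u + 1) s''"

inductive_cases exec_SKIP_E: "exec SKIP s t s'"
inductive_cases exec_Assign_E: "exec (Assign x i a) s t s'"
inductive_cases exec_Seq_E: "exec (Seq c d) s t s'"
inductive_cases exec_Cond_E: "exec (Cond b c d) s t s'"
inductive_cases exec_While_E: "exec (While b c) s t s'"

lemma exec_deterministic: "exec c s t s' \<Longrightarrow> exec c s u s'' \<Longrightarrow> t = u \<and> s' = s''"
proof (induction arbitrary: u s'' rule: exec.induct)
  case (exec_SKIP s)
  then show ?case by (rule exec_SKIP_E) simp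
next
  case (exec_Assign x i a s)
  then show ?case by (rule exec_Assign_E) simp
next
  case (exec_Seq c s t s' d v r)
  from exec_Seq.prems show ?case
  proof (rule exec_Seq_E)
    fix t1 s1 t2
    assume "u = t1 + t2" and c: "exec c s t1 s1" and d: "exec d s1 t2 s''"
    from exec_Seq.IH(1)[OF c] have "t = t1" and [symmetric]: "s' = s1" by simp_all
    with exec_Seq.IH(2) d have "v = t2 \<and> r = s''" by blast
    with \<open>u = t1 + t2\<close> \<open>t = t1\<close> show ?thesis by simp
  qed
next
  case (exec_CondTrue b s c t s' d)
  from exec_CondTrue.prems show ?case
  proof (rule exec_Cond_E)
    fix t1
    assume "u = Suc (bcost b s + t1)" and "exec c s t1 s''"
    with exec_CondTrue.IH[of t1 s''] show ?thesis by simp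
  qed (use exec_CondTrue.hyps in blast)
next
  case (exec_CondFalse b s d t s' c)
  from exec_CondFalse.prems show ?case
  proof (rule exec_Cond_E)
    fix t1
    assume "u = Suc (bcost b s + t1)" and "exec d s t1 s''"
    with exec_CondFalse.IH[of t1 s''] show ?thesis by simp
  qed (use exec_CondFalse.hyps in blast)
next
  case (exec_WhileFalse b s c)
  from exec_WhileFalse.prems show ?case
  proof (rule exec_While_E)
    assume "u = Suc (bcost b s)" "s'' = s"
    then show ?thesis by simp
  qed (use exec_WhileFalse.hyps in blast)
next
  case (exec_WhileTrue b s c t s' v r)
  from exec_WhileTrue.prems show ?case
  proof (rule exec_While_E)
    assume "\<not> bval b s"
    with exec_WhileTrue.hyps show ?thesis by simp
  next
    fix t1 s1 t2
    assume "u = Suc (bcost b s + t1 + t2)" and c: "exec c s t1 s1" and l: "exec (While b c) s1 t2 s''"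
    from exec_WhileTrue.IH(1)[OF c] have "t = t1" and [symmetric]: "s' = s1" by simp_all
    with exec_WhileTrue.IH(2) l have "v = t2 \<and> r = s''" by blast
    with \<open>u = Suc (bcost b s + t1 + t2)\<close> \<open>t = t1\<close> show ?thesis by simp
  qed
qed

section \<open>Input and output\<close>

text \<open>
  For an instance with vertex set \<open>{..<n}\<close>, the initial store holds
  \<^item> \<open>n\<close> in cell \<open>0\<close> of array \<open>size\<close>;
  \<^item> the numerator and the denominator of the weight of the arc \<open>(u, v)\<close> in cell \<open>u * n + v\<close> of the
    arrays \<open>num\<close> and \<open>den\<close>;
  \<^item> in cell \<open>v\<close> of array \<open>term\<close>, the least element of the terminal set containing \<open>v\<close> (so that two
    vertices lie in the same terminal set iff they have the same entry).

  All other cells are \<open>0\<close>.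
\<close>

definition terminal_label :: "nat set set \<Rightarrow> nat \<Rightarrow> nat" where
  "terminal_label \<T> v = Min (THE T. T \<in> \<T> \<and> v \<in> T)"

definition input_store ::
    "nat pair_pre_digraph \<Rightarrow> (nat \<times> nat \<Rightarrow> rat) \<Rightarrow> nat set set \<Rightarrow> store" where
  "input_store D w \<T> = (\<lambda>x i.
     let n = card (pverts D); e = (nat i div n, nat i mod n) in
     if x = ''size'' \<and> i = 0 then int n
     else if x = ''num'' \<and> 0 \<le> i \<and> e \<in> parcs D then fst (quotient_of (w e))
     else if x = ''den'' \<and> 0 \<le> i \<and> e \<in> parcs D then snd (quotient_of (w e))
     else if x = ''term'' \<and> 0 \<le> i \<and> nat i \<in> pverts D then int (terminal_label \<T> (nat i))
     else 0)"

text \<open>The number of bits of the input.\<close>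

definition input_size ::
    "nat pair_pre_digraph \<Rightarrow> (nat \<times> nat \<Rightarrow> rat) \<Rightarrow> nat set set \<Rightarrow> nat" where
  "input_size D w \<T> =
     int_size (int (card (pverts D))) +
     (\<Sum>e\<in>parcs D. int_size (fst (quotient_of (w e))) + int_size (snd (quotient_of (w e)))) +
     (\<Sum>v\<in>pverts D. int_size (int (terminal_label \<T> v)))"

text \<open>A 2-factor is output as the array \<open>succ\<close> of the successors of the vertices.\<close>

definition outputs_two_factor ::
    "store \<Rightarrow> nat pair_pre_digraph \<Rightarrow> (nat \<times> nat) awalk set \<Rightarrow> bool" where
  "outputs_two_factor s D F \<longleftrightarrow>
     (\<forall>v\<in>pverts D. 0 \<le> s ''succ'' (int v)) \<and>
     two_factor_arcs F = {(v, nat (s ''succ'' (int v))) |v. v \<in> pverts D}"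

end

theory Submission
  imports Defs "HOL-Combinatorics.Orbits" "HOL-Combinatorics.Cycles" "HOL-Analysis.Harmonic_Numbers"
begin

text \<open>
  A 2-factor is a permutation without fixed points. The algorithm starts with the identity and
  merges orbits until every terminal set lies inside one orbit: composing \<open>\<sigma>\<close> with a cyclic
  permutation \<open>\<rho>\<close> of vertices from distinct orbits merges these orbits, and by the triangle
  inequality \<open>\<rho> \<circ> \<sigma>\<close> weighs at most as much as \<open>\<sigma>\<close> and \<open>\<rho>\<close> together.

  In every round each of the \<open>m\<close> orbits that split a terminal set \<open>T\<close> gets a representative in \<open>T\<close>
  and a mate, a vertex of \<open>T\<close> in another orbit. Consider the complete digraph on the
  representatives, with a loop at each of them that stands for the 2-cycle through its mate.
  Shortcutting an optimal solution to the representatives covers this digraph by disjoint cycles, a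
  cycle with a single representative becoming a loop, as it contains the mate as well. Hence a cycle
  of minimum mean with \<open>k\<close> arcs weighs at most \<open>k / m\<close> times the optimum, while merging along it
  decreases \<open>m\<close> by at least \<open>k / 2\<close>. Summing up gives the factor \<open>2 H(n)\<close> with the harmonic number
  \<open>H(n)\<close>.

  Minimum mean cycles are found among the least weights of walks with \<open>1, \<dots>, n\<close> arcs, after clearing
  the denominators; taking the smallest number of arcs that attains the minimum makes the cycle
  simple.
\<close>

section \<open>Orbits of permutations\<close>

text \<open>The factor 2 comes from the cycles of the label graph: \<open>k\<close> arcs with
  \<open>k >= 2\<close> remove only \<open>k - 1\<close> labels, a loop removes one, and
  \<open>k <= 2 * (k - 1)\<close>. A round that removes at least \<open>p\<close> of
  \<open>m\<close> labels thus costs at most \<open>2 * p / m\<close> times the optimum, and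
  \<open>p / m <= H(m) - H(m - p)\<close> telescopes over the rounds. A minimum weight cover of the
  label graph by cycles would do as well, but a minimum mean cycle needs no matching algorithm: a
  table of walk weights suffices.

  The other obstacle is the logarithmic cost measure. A polynomial number of steps is not enough
  there, because repeated products of computed values grow exponentially in length. Therefore every
  stored product has an input cell as a factor, so that an assignment lengthens values only
  additively, and means are compared by cross multiplication inside tests, whose values are not
  stored. The number of rounds is fixed at \<open>n\<close>; once no terminal set is split, a round
  leaves the permutation as it is.\<close>

lemma orbit_eq_iff_mem:
  assumes "permutation f"
  shows "orbit f x = orbit f y \<longleftrightarrow> y \<in> orbit f x"
  using assms by (metis cyclic_on_orbit' orbit_cyclic_eq3 permutation_self_in_orbit)

lemma mem_orbit_sym:
  assumes "permutation f" "y \<in> orbit f x"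
  shows "x \<in> orbit f y"
  using assms by (metis orbit_eq_iff_mem)

text \<open>The iterates of \<open>f\<close> from \<open>u\<close> arrive at \<open>a\<close> and
  never meet \<open>b\<close>, which lies in another orbit. Until then the composed map agrees with
  \<open>f\<close>, and the step that would enter \<open>a\<close> enters \<open>b\<close>
  instead.\<close>

lemma orbit_transpose_comp_reaches:
  assumes "permutation f" "b \<notin> orbit f a" "a \<in> orbit f u"
  shows "b \<in> orbit (Transposition.transpose a b \<circ> f) u"
proof -
  let ?g = "Transposition.transpose a b \<circ> f"
  have "b \<in> orbit ?g u" if "(f ^^ Suc k) u = a" for k u
    using that
  proof (induction k arbitrary: u)
    case 0
    then have "?g u = b" by simp
    then show ?case by (metis orbit.base)
  next
    case (Suc k)
    show ?case
    proof (cases "f u = a")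
      case True
      then have "?g u = b" by simp
      then show ?thesis by (metis orbit.base)
    next
      case False
      have *: "(f ^^ Suc k) (f u) = a"
        using Suc.prems by (simp only: funpow_Suc_right o_apply)
      then have "a \<in> orbit f (f u)" unfolding orbit_altdef by blast
      then have "f u \<in> orbit f a" using assms(1) by (rule mem_orbit_sym[rotated])
      then have "f u \<noteq> b" using assms(2) by auto
      with False have "?g u = f u" by simp
      moreover have "b \<in> orbit ?g (f u)" using Suc.IH[OF *] .
      ultimately show ?thesis by (metis orbit_subset)
    qed
  qed
  moreover obtain k where "(f ^^ Suc k) u = a"
    using assms(3) by (auto simp: orbit_altdef gr0_conv_Suc)
  ultimately show ?thesis by blast
qed

lemma permutation_transpose_comp:
  "permutation f \<Longrightarrow> permutation (Transposition.transpose a b \<circ> f)"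
  by (intro permutation_compose permutation_swap_id)

text \<open>By the previous lemma and its mirror image, the orbit of \<open>a\<close> now reaches
  \<open>b\<close> and that of \<open>b\<close> reaches \<open>a\<close>, so both become one cycle.
  Their union is closed under both maps, and outside of it the maps agree.\<close>

lemma orbit_transpose_comp:
  assumes f: "permutation f" and ab: "b \<notin> orbit f a"
  shows "orbit (Transposition.transpose a b \<circ> f) x =
    (if x \<in> orbit f a \<union> orbit f b then orbit f a \<union> orbit f b else orbit f x)"
proof -
  let ?g = "Transposition.transpose a b \<circ> f"
  let ?AB = "orbit f a \<union> orbit f b"
  have g: "permutation ?g" using f by (rule permutation_transpose_comp)
  have self: "z \<in> orbit f z" for z using f by (rule permutation_self_in_orbit)
  have ba: "a \<notin> orbit f b" using ab f mem_orbit_sym by metis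
  have closed: "f z \<in> ?AB \<longleftrightarrow> z \<in> ?AB" for z
    by (metis Un_iff f orbit_eq_iff_mem permutation_orbit_step)
  have closed_g: "?g z \<in> ?AB \<longleftrightarrow> z \<in> ?AB" for z
    using closed[of z] self[of a] self[of b] by (auto simp: Transposition.transpose_def)
  have a_to_b: "b \<in> orbit ?g u" if "u \<in> orbit f a" for u
    using orbit_transpose_comp_reaches[OF f ab] mem_orbit_sym[OF f that] by blast
  have b_to_a: "a \<in> orbit ?g u" if "u \<in> orbit f b" for u
    using orbit_transpose_comp_reaches[OF f ba] mem_orbit_sym[OF f that]
    by (metis transpose_commute)
  have sup: "y \<in> orbit ?g a" if "y \<in> ?AB" for y
  proof -
    have "a \<in> orbit ?g y"
      using that a_to_b[of y] b_to_a[of y] b_to_a[OF self] orbit_trans[of a ?g b y] by auto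
    then show ?thesis by (rule mem_orbit_sym[OF g])
  qed
  have sub: "orbit ?g z \<subseteq> ?AB" if "z \<in> ?AB" for z
  proof
    fix y assume "y \<in> orbit ?g z"
    then show "y \<in> ?AB" using that by induction (use closed_g in auto)
  qed
  show ?thesis
  proof (cases "x \<in> ?AB")
    case True
    then have "orbit ?g x = orbit ?g a" using sup[OF True] g orbit_eq_iff_mem by metis
    moreover have "orbit ?g a = ?AB" using sup sub[of a] self by auto
    ultimately show ?thesis using True by simp
  next
    case False
    have "orbit ?g x = orbit f x"
    proof (rule orbit_cong)
      show "x \<in> orbit f x" by (rule self)
      fix s assume "s \<in> orbit f x"
      then have "s \<notin> ?AB" using False f by (metis Un_iff orbit_eq_iff_mem)
      then have "f s \<notin> ?AB" using closed by blast
      then show "?g s = f s" using self[of a] self[of b] by (auto simp: Transposition.transpose_def)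
    qed
    with False show ?thesis by simp
  qed
qed

text \<open>The composition fixes \<open>v\<close> and sends its predecessor straight to
  \<open>f v\<close>, so a path from \<open>x\<close> is the old one with \<open>v\<close> skipped.
  One new step may replace two steps of \<open>f\<close>, hence the strong induction on the number
  of steps of \<open>f\<close>.\<close>

lemma orbit_remove:
  assumes "f permutes S" "finite S" "x \<noteq> v"
  shows "orbit (Transposition.transpose v (f v) \<circ> f) x = orbit f x - {v}"
proof -
  let ?g = "Transposition.transpose v (f v) \<circ> f"
  have f: "permutation f" using assms permutation_permutes by blast
  have inj: "f y = f z \<longleftrightarrow> y = z" for y z using assms(1) by (metis permutes_inj injD)
  have g1: "?g z = f z" if "z \<noteq> v" "f z \<noteq> v" for z
    using that inj by (simp add: Transposition.transpose_def)
  have g2: "?g z = f v" if "f z = v" for z using that by simp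
  have "y \<in> orbit f x - {v}" if "y \<in> orbit ?g x" for y
    using that
  proof induction
    case base
    show ?case
      by (cases "f x = v") (use assms(3) inj g1[of x] g2[of x] in \<open>auto intro: orbit.intros\<close>)
  next
    case (step y)
    then show ?case
      by (cases "f y = v") (use inj g1[of y] g2[of y] in \<open>auto intro: orbit.intros\<close>)
  qed
  moreover have "y \<in> orbit ?g x" if "(f ^^ Suc k) x = y" "y \<noteq> v" "x \<noteq> v" for k x y
    using that
  proof (induction k arbitrary: x rule: less_induct)
    case (less k)
    show ?case
    proof (cases "f x = v")
      case False
      then have gx: "?g x = f x" using g1 less.prems by simp
      show ?thesis
      proof (cases k)
        case 0
        then show ?thesis using less.prems gx by (metis One_nat_def funpow_simps_right(1,2) id_apply o_apply orbit.base)
      next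
        case (Suc j)
        have "(f ^^ Suc j) (f x) = y"
          using less.prems(1) Suc by (simp only: funpow_Suc_right o_apply)
        then have "y \<in> orbit ?g (f x)" by (intro less.IH[of j "f x"]) (use Suc less.prems False in auto)
        then show ?thesis using gx by (metis orbit_subset)
      qed
    next
      case True
      then have gx: "?g x = f (f x)" by simp
      have "k \<noteq> 0" using True less.prems by (metis One_nat_def funpow_simps_right(1,2) id_apply o_apply)
      then obtain j where j: "k = Suc j" by (cases k) auto
      have y: "(f ^^ j) (f (f x)) = y"
        using less.prems(1) j by (simp only: funpow_Suc_right o_apply)
      show ?thesis
      proof (cases j)
        case 0
        then show ?thesis using y gx by (metis funpow_0 orbit.base)
      next
        case (Suc i)
        have "f (f x) \<noteq> v" using True inj less.prems by metis
        then have "y \<in> orbit ?g (f (f x))"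
          by (intro less.IH[of i "f (f x)"]) (use y j Suc less.prems in auto)
        then show ?thesis using gx by (metis orbit_subset)
      qed
    qed
  qed
  then have "y \<in> orbit ?g x" if "y \<in> orbit f x - {v}" for y
    using that assms(3) by (auto simp: orbit_altdef gr0_conv_Suc)
  ultimately show ?thesis by blast
qed

lemma permutes_remove:
  assumes "f permutes S" "v \<in> S"
  shows "(Transposition.transpose v (f v) \<circ> f) permutes (S - {v})"
proof (rule permutes_superset)
  have "f v \<in> S" using assms by (simp add: permutes_in_image)
  then show "(Transposition.transpose v (f v) \<circ> f) permutes S"
    using assms by (intro permutes_compose permutes_swap_id) auto
  fix x assume "x \<in> S - (S - {v})"
  then show "(Transposition.transpose v (f v) \<circ> f) x = x" by simp
qed

section \<open>Weights of permutations in asymmetric metric spaces\<close>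

text \<open>With zeros on the diagonal the triangle inequality also covers coinciding points, and
  fixed points of a permutation are free: the identity weighs 0, and a cyclic permutation weighs as
  much as its cycle.\<close>

locale asym_metric =
  fixes V :: "'a set" and c :: "'a \<Rightarrow> 'a \<Rightarrow> real"
  assumes finite_V: "finite V"
    and nonneg: "x \<in> V \<Longrightarrow> y \<in> V \<Longrightarrow> 0 \<le> c x y"
    and self_zero: "x \<in> V \<Longrightarrow> c x x = 0"
    and tri: "x \<in> V \<Longrightarrow> y \<in> V \<Longrightarrow> z \<in> V \<Longrightarrow> c x z \<le> c x y + c y z"
begin

text \<open>Each arc of \<open>g \<circ> f\<close> is at most the detour through \<open>f v\<close>.
  As \<open>f\<close> permutes \<open>V\<close>, the second legs of the detours run over the arcs of
  \<open>g\<close>, each once.\<close>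

lemma weight_comp_le:
  assumes "f permutes V" "g permutes V"
  shows "(\<Sum>v\<in>V. c v ((g \<circ> f) v)) \<le> (\<Sum>v\<in>V. c v (f v)) + (\<Sum>v\<in>V. c v (g v))"
proof -
  have "(\<Sum>v\<in>V. c v ((g \<circ> f) v)) \<le> (\<Sum>v\<in>V. c v (f v) + c (f v) (g (f v)))"
    using assms by (intro sum_mono) (auto simp: permutes_in_image intro!: tri)
  also have "\<dots> = (\<Sum>v\<in>V. c v (f v)) + (\<Sum>v\<in>V. c (f v) (g (f v)))"
    by (simp add: sum.distrib)
  also have "(\<Sum>v\<in>V. c (f v) (g (f v))) = (\<Sum>v\<in>V. c v (g v))"
    using sum.permute[OF assms(1), of "\<lambda>v. c v (g v)"] by (simp add: o_def)
  finally show ?thesis .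
qed

text \<open>Only the predecessor of \<open>v\<close> gets a new arc, and by the triangle inequality
  it is longer by at most \<open>c v (f v)\<close>, the weight of the arc that disappears. A fixed
  point \<open>v\<close> is its own predecessor, and then no other arc changes.\<close>

lemma weight_remove_le:
  assumes f: "f permutes S" and S: "S \<subseteq> V" and v: "v \<in> S"
  shows "(\<Sum>x\<in>S - {v}. c x ((Transposition.transpose v (f v) \<circ> f) x)) \<le> (\<Sum>x\<in>S. c x (f x))"
proof -
  let ?g = "Transposition.transpose v (f v) \<circ> f"
  have fin: "finite S" using S finite_V finite_subset by blast
  have inj: "f y = f z \<longleftrightarrow> y = z" for y z using f by (metis permutes_inj injD)
  have in_S: "f x \<in> S" if "x \<in> S" for x using f that by (simp add: permutes_in_image)
  have K: "0 \<le> c v (f v)" using S v in_S by (auto intro!: nonneg)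
  have "(\<Sum>x\<in>S - {v}. c x (?g x))
      \<le> (\<Sum>x\<in>S - {v}. c x (f x) + (if x = inv f v then c v (f v) else 0))"
  proof (rule sum_mono)
    fix x assume x: "x \<in> S - {v}"
    show "c x (?g x) \<le> c x (f x) + (if x = inv f v then c v (f v) else 0)"
    proof (cases "f x = v")
      case True
      then have "x = inv f v" using f by (metis permutes_inverses(2))
      moreover have "c x (f v) \<le> c x v + c v (f v)"
        using x v S in_S by (intro tri) auto
      ultimately show ?thesis using True by simp
    next
      case False
      then have "x \<noteq> inv f v" using f by (metis permutes_inverses(1))
      moreover have "?g x = f x" using False inj x by (simp add: Transposition.transpose_def)
      ultimately show ?thesis by simp
    qed
  qed
  also have "\<dots> \<le> (\<Sum>x\<in>S - {v}. c x (f x)) + c v (f v)"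
    using fin K by (simp add: sum.distrib sum.delta)
  also have "\<dots> = (\<Sum>x\<in>S. c x (f x))"
    using fin v by (simp add: sum.remove)
  finally show ?thesis .
qed

text \<open>The vertices outside \<open>K\<close> are bypassed one at a time. The orbits are tracked
  along with the weight, because it matters later which representatives share a cycle of the
  optimum.\<close>

lemma shortcut_permutation:
  assumes f: "f permutes V" and K: "K \<subseteq> V"
  obtains g where "g permutes K" "\<And>x. x \<in> K \<Longrightarrow> orbit g x = orbit f x \<inter> K"
    "(\<Sum>x\<in>K. c x (g x)) \<le> (\<Sum>x\<in>V. c x (f x))"
proof -
  have "\<exists>g. g permutes (V - X) \<and> (\<forall>x\<in>V - X. orbit g x = orbit f x - X) \<and>
      (\<Sum>x\<in>V - X. c x (g x)) \<le> (\<Sum>x\<in>V. c x (f x))" if "finite X" "X \<subseteq> V" for X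
    using that
  proof (induction X)
    case empty
    show ?case using f by auto
  next
    case (insert v X)
    then obtain g where g: "g permutes (V - X)" "\<And>x. x \<in> V - X \<Longrightarrow> orbit g x = orbit f x - X"
      "(\<Sum>x\<in>V - X. c x (g x)) \<le> (\<Sum>x\<in>V. c x (f x))" by auto
    let ?g = "Transposition.transpose v (g v) \<circ> g"
    have eq: "V - insert v X = V - X - {v}" by auto
    have v: "v \<in> V - X" using insert by auto
    have "orbit ?g x = orbit f x - insert v X" if "x \<in> V - insert v X" for x
      using orbit_remove[OF g(1), of x v] that g(2) finite_V by auto
    moreover have "?g permutes (V - insert v X)"
      unfolding eq using g(1) v by (rule permutes_remove)
    moreover have "(\<Sum>x\<in>V - insert v X. c x (?g x)) \<le> (\<Sum>x\<in>V. c x (f x))"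
      unfolding eq using weight_remove_le[OF g(1) _ v] g(3) by auto
    ultimately show ?case by blast
  qed
  from this[of "V - K"] finite_V K obtain g where
    g: "g permutes K" "\<forall>x\<in>K. orbit g x = orbit f x - (V - K)"
    "(\<Sum>x\<in>K. c x (g x)) \<le> (\<Sum>x\<in>V. c x (f x))"
    by (auto simp: double_diff)
  moreover have "orbit f x - (V - K) = orbit f x \<inter> K" if "x \<in> K" for x
    using permutes_orbit_subset[OF f, of x] that K by auto
  ultimately show ?thesis using that by auto
qed

lemma weight_cycle_of_list:
  assumes "distinct xs" "set xs \<subseteq> V"
  shows "(\<Sum>v\<in>V. c v (cycle_of_list xs v)) =
    (\<Sum>i<length xs. c (xs ! i) (xs ! (Suc i mod length xs)))"
proof -
  have "(\<Sum>v\<in>V. c v (cycle_of_list xs v)) = (\<Sum>v\<in>set xs. c v (cycle_of_list xs v))"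
    using finite_V assms(2) self_zero
    by (intro sum.mono_neutral_right) (auto simp: id_outside_supp)
  also have "\<dots> = (\<Sum>i<length xs. c (xs ! i) (cycle_of_list xs (xs ! i)))"
    using assms(1) by (intro sum.reindex_bij_betw[symmetric] bij_betw_nth) auto
  also have "\<dots> = (\<Sum>i<length xs. c (xs ! i) (xs ! (Suc i mod length xs)))"
  proof (rule sum.cong)
    fix i assume i: "i \<in> {..<length xs}"
    have "map (cycle_of_list xs) xs = rotate1 xs"
      using cyclic_rotation[OF assms(1), of 1] by simp
    then have "cycle_of_list xs (xs ! i) = rotate1 xs ! i" using i by (metis lessThan_iff nth_map)
    also have "\<dots> = xs ! (Suc i mod length xs)" using i by (simp add: nth_rotate1)
    finally show "c (xs ! i) (cycle_of_list xs (xs ! i)) = c (xs ! i) (xs ! (Suc i mod length xs))"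
      by simp
  qed simp
  finally show ?thesis .
qed

text \<open>A cycle of \<open>f\<close> with a single representative keeps its mate as well and becomes a fixed point
  of \<open>r\<close>.\<close>

lemma label_permutation_le:
  fixes A :: "'l set"
  assumes f: "f permutes V"
    and rp: "\<And>l. l \<in> A \<Longrightarrow> rp l \<in> V \<and> lab (rp l) = l"
    and mate: "\<And>l. l \<in> A \<Longrightarrow> mate l \<in> orbit f (rp l) \<and> lab (mate l) \<noteq> l"
  obtains r where "r permutes A"
    "(\<Sum>l\<in>A. if r l = l then c (rp l) (mate l) + c (mate l) (rp l) else c (rp l) (rp (r l)))
       \<le> (\<Sum>v\<in>V. c v (f v))"
proof -
  have pf: "permutation f" using f finite_V permutation_permutes by blast
  have inj_rp: "inj_on rp A" by (metis inj_onI rp)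
  have finA: "finite A"
    using inj_rp finite_V rp by (metis finite_imageD finite_subset image_subsetI)
  define U where "U = rp ` A"
  define L where "L = {l\<in>A. orbit f (rp l) \<inter> U = {rp l}}"
  \<comment> \<open>The labels in \<open>L\<close> are those whose representative is alone on its
    cycle, and mates are kept only for them. On all other cycles the shortcut permutation has to
    move representatives to representatives, so that it induces a map on labels.\<close>
  define K where "K = U \<union> mate ` L"
  have UV: "U \<subseteq> V" using rp U_def by auto
  have mateV: "mate l \<in> V" if "l \<in> A" for l
    using permutes_orbit_subset[OF f, of "rp l"] rp mate that by auto
  have KV: "K \<subseteq> V" using UV mateV K_def L_def by auto
  have mateU: "mate l \<notin> U" if "l \<in> L" for l
  proof
    assume "mate l \<in> U"
    then have "mate l = rp l" using that mate by (auto simp: L_def)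
    then show False using that mate[of l] rp[of l] by (simp add: L_def)
  qed
  have mate_orbit: "rp l \<in> orbit f (mate l)" if "l \<in> A" for l
    using mem_orbit_sym[OF pf] mate that by blast
  have orb_L: "l = l'" if "l \<in> L" "l' \<in> A" "rp l' \<in> orbit f (rp l)" for l l'
    using that inj_rp by (auto simp: L_def U_def inj_on_def)
  \<comment> \<open>A mate lies on the cycle of its own representative, and for a label in
    \<open>L\<close> no other representative lies there.\<close>
  have mate_L: "l = l'" if "l \<in> A" "l' \<in> L" "mate l' \<in> orbit f (rp l)" for l l'
  proof -
    have "rp l' \<in> orbit f (rp l)"
      using mate_orbit[of l'] that orbit_trans[of "rp l'" f "mate l'" "rp l"] L_def by auto
    then have "rp l \<in> orbit f (rp l')" by (rule mem_orbit_sym[OF pf])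
    then show ?thesis using orb_L that by metis
  qed
  obtain g where g: "g permutes K" "\<And>x. x \<in> K \<Longrightarrow> orbit g x = orbit f x \<inter> K"
    "(\<Sum>x\<in>K. c x (g x)) \<le> (\<Sum>x\<in>V. c x (f x))"
    using shortcut_permutation[OF f KV] by metis
  have gK: "g x \<in> orbit f x \<inter> K" if "x \<in> K" for x
    using g(2)[OF that] orbit.base by metis
  have g_fix: "orbit f x \<inter> K = {x}" if "x \<in> K" "g x = x" for x
    using g(2)[OF that(1)] that(2) by (metis orbit_eq_singleton_iff)
  have U_K: "rp l \<in> K" if "l \<in> A" for l using that by (simp add: K_def U_def)
  have lone: "g (rp l) = mate l \<and> g (mate l) = rp l" if l: "l \<in> L" for l
  proof -
    have lA: "l \<in> A" using l L_def by simp
    have mK: "mate l \<in> K" using l K_def by simp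
    have ne: "mate l \<noteq> rp l" using mate rp lA by metis
    have orb: "orbit f (rp l) \<inter> K = {rp l, mate l}"
      using l mate mate_L[of l] lA by (auto simp: L_def K_def)
    have orb': "orbit f (mate l) = orbit f (rp l)"
      using orbit_eq_iff_mem[OF pf] mate_orbit[OF lA] by metis
    have "g (rp l) \<noteq> rp l" using g_fix[OF U_K[OF lA]] orb ne by auto
    moreover have "g (mate l) \<noteq> mate l" using g_fix[OF mK] orb orb' ne by auto
    ultimately show ?thesis using gK[OF U_K[OF lA]] gK[OF mK] orb orb' by auto
  qed
  have nonlone: "g (rp l) \<in> U \<and> g (rp l) \<noteq> rp l" if l: "l \<in> A" "l \<notin> L" for l
  proof -
    have self: "rp l \<in> orbit f (rp l)" using pf by (rule permutation_self_in_orbit)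
    have "orbit f (rp l) \<inter> U \<noteq> {rp l}" using l L_def by simp
    then have "orbit f (rp l) \<inter> K \<noteq> {rp l}" using self l by (auto simp: K_def U_def)
    then have "g (rp l) \<noteq> rp l" using g_fix[OF U_K] l by blast
    moreover have "g (rp l) \<notin> mate ` L"
    proof
      assume "g (rp l) \<in> mate ` L"
      then obtain l' where l': "l' \<in> L" "g (rp l) = mate l'" by auto
      then have "l = l'" using gK[OF U_K[OF l(1)]] mate_L[OF l(1), of l'] by auto
      then show False using l l' by simp
    qed
    ultimately show ?thesis using gK[OF U_K[OF l(1)]] K_def by auto
  qed
  \<comment> \<open>The labels in \<open>L\<close> become fixed points, and by \<open>r_ne\<close>
    below no other label of \<open>A\<close> is fixed. So \<open>r l = l\<close> tells exactly when
    the 2-cycle through the mate is to be paid.\<close>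
  define r where "r l = (if l \<in> A - L then lab (g (rp l)) else l)" for l
  have r_rp: "rp (r l) = g (rp l) \<and> r l \<in> A" if "l \<in> A" "l \<notin> L" for l
    using nonlone[OF that] that rp by (auto simp: r_def U_def)
  have r_ne: "r l \<noteq> l" if "l \<in> A" "l \<notin> L" for l
    using r_rp[OF that] nonlone[OF that] by metis
  have r_L: "r l \<notin> L" if l: "l \<in> A" "l \<notin> L" for l
  proof
    assume *: "r l \<in> L"
    have "rp (r l) \<in> orbit f (rp l)" using r_rp[OF l] gK[OF U_K[OF l(1)]] by auto
    then have "rp l \<in> orbit f (rp (r l))" by (rule mem_orbit_sym[OF pf])
    from orb_L[OF * l(1) this] show False using r_ne[OF l] by metis
  qed
  have inj_g: "g x = g y \<longleftrightarrow> x = y" for x y using g(1) by (metis permutes_inj injD)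
  have inj_r: "inj_on r A"
  proof (rule inj_onI)
    fix l l' assume l: "l \<in> A" "l' \<in> A" "r l = r l'"
    show "l = l'"
    proof (cases "l \<in> L")
      case True
      then have "r l' \<in> L" using l by (simp add: r_def)
      then have "l' \<in> L" using r_L l by blast
      then show ?thesis using True l by (simp add: r_def)
    next
      case False
      then have "l' \<notin> L" using r_L[OF l(1) False] l by (auto simp: r_def)
      then have "g (rp l) = g (rp l')" using r_rp l False by metis
      then show ?thesis using inj_g inj_rp l by (metis inj_onD)
    qed
  qed
  have rA: "r ` A \<subseteq> A" using r_rp r_def by fastforce
  have "r permutes A"
  proof (rule bij_imp_permutes)
    show "bij_betw r A A"
      using inj_r rA finA by (simp add: bij_betw_def endo_inj_surj)
    show "r x = x" if "x \<notin> A" for x using that by (simp add: r_def)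
  qed
  moreover have "(\<Sum>l\<in>A. if r l = l then c (rp l) (mate l) + c (mate l) (rp l)
      else c (rp l) (rp (r l))) \<le> (\<Sum>v\<in>V. c v (f v))" (is "?S \<le> _")
  proof -
    have LA: "L \<subseteq> A" by (auto simp: L_def)
    have inj_mate: "inj_on mate L"
      by (rule inj_onI) (metis mate mate_L LA subsetD)
    have "?S = (\<Sum>l\<in>A. c (rp l) (g (rp l)) + (if l \<in> L then c (mate l) (g (mate l)) else 0))"
    proof (rule sum.cong)
      fix l assume l: "l \<in> A"
      show "(if r l = l then c (rp l) (mate l) + c (mate l) (rp l) else c (rp l) (rp (r l)))
        = c (rp l) (g (rp l)) + (if l \<in> L then c (mate l) (g (mate l)) else 0)"
        using lone[of l] r_rp[OF l] r_ne[OF l] by (cases "l \<in> L") (auto simp: r_def)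
    qed simp
    also have "\<dots> = (\<Sum>l\<in>A. c (rp l) (g (rp l))) + (\<Sum>l\<in>L. c (mate l) (g (mate l)))"
      using finA LA by (simp add: sum.distrib sum.inter_restrict[symmetric] Int_absorb1)
    also have "\<dots> = (\<Sum>x\<in>U. c x (g x)) + (\<Sum>x\<in>mate ` L. c x (g x))"
      by (simp add: U_def sum.reindex[OF inj_rp] sum.reindex[OF inj_mate])
    also have "\<dots> = (\<Sum>x\<in>K. c x (g x))"
    proof -
      have "finite U" "finite (mate ` L)"
        using finA finite_subset[OF LA finA] by (auto simp: U_def)
      moreover have "U \<inter> mate ` L = {}" using mateU by blast
      ultimately show ?thesis unfolding K_def by (rule sum.union_disjoint[symmetric])
    qed
    also have "\<dots> \<le> (\<Sum>v\<in>V. c v (f v))" by (rule g(3))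
    finally show ?thesis .
  qed
  ultimately show ?thesis using that by blast
qed

end

section \<open>Min-plus powers and minimum mean cycles\<close>

text \<open>\<open>D k x y\<close> is the least weight of a walk from \<open>x\<close> to \<open>y\<close> with \<open>k + 1\<close> arcs.\<close>

locale min_plus =
  fixes A :: "'l set" and D :: "nat \<Rightarrow> 'l \<Rightarrow> 'l \<Rightarrow> real"
  assumes finite_A: "finite A"
    and D_le: "x \<in> A \<Longrightarrow> y \<in> A \<Longrightarrow> z \<in> A \<Longrightarrow> D (Suc k) x z \<le> D k x y + D 0 y z"
    and D_attained: "x \<in> A \<Longrightarrow> z \<in> A \<Longrightarrow> \<exists>y\<in>A. D (Suc k) x z = D k x y + D 0 y z"
begin

text \<open>Indices are one less than numbers of arcs, so joining walks with \<open>j + 1\<close>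
  and \<open>k + 1\<close> arcs gives the index \<open>Suc (j + k)\<close>. The induction splits off
  the last arc of the second walk.\<close>

lemma D_add_le:
  assumes "x \<in> A" "y \<in> A" "z \<in> A"
  shows "D (Suc (j + k)) x z \<le> D j x y + D k y z"
  using assms
proof (induction k arbitrary: z)
  case 0
  then show ?case using D_le by simp
next
  case (Suc k)
  obtain t where t: "t \<in> A" "D (Suc k) y z = D k y t + D 0 t z"
    using D_attained Suc.prems by blast
  have "D (Suc (j + Suc k)) x z \<le> D (Suc (j + k)) x t + D 0 t z"
    using D_le[of x t z "Suc (j + k)"] Suc.prems t by simp
  then show ?case using Suc.IH[of t] Suc.prems t by simp
qed

lemma D_le_walk:
  assumes r: "r permutes A" and x: "x \<in> A"
  shows "D k x ((r ^^ Suc k) x) \<le> (\<Sum>i<Suc k. D 0 ((r ^^ i) x) (r ((r ^^ i) x)))"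
proof (induction k)
  case 0
  show ?case by simp
next
  case (Suc k)
  have mem: "(r ^^ i) x \<in> A" for i
    using r x by (induction i) (auto simp: permutes_in_image)
  have "D (Suc k) x ((r ^^ Suc (Suc k)) x)
      \<le> D k x ((r ^^ Suc k) x) + D 0 ((r ^^ Suc k) x) ((r ^^ Suc (Suc k)) x)"
    using mem[of "Suc k"] mem[of "Suc (Suc k)"] x by (intro D_le) auto
  then show ?case using Suc.IH by simp
qed

text \<open>Every cycle \<open>Q\<close> of \<open>r\<close> is a closed walk with
  \<open>card Q <= card A\<close> arcs and so weighs at least \<open>m * card Q\<close>; the cycles
  partition \<open>A\<close>. Hence the minimum mean is at most the average arc weight of any cover
  by disjoint cycles.\<close>

lemma mean_le_weight:
  assumes r: "r permutes A"
    and mean: "\<And>x k. x \<in> A \<Longrightarrow> k < card A \<Longrightarrow> m * real (Suc k) \<le> D k x x"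
  shows "m * real (card A) \<le> (\<Sum>x\<in>A. D 0 x (r x))"
proof -
  obtain C where C: "\<forall>c\<in>C. cyclic_on r c" "\<Union>C = A"
    "\<forall>c1\<in>C. \<forall>c2\<in>C. c1 \<noteq> c2 \<longrightarrow> c1 \<inter> c2 = {}"
    using permutes_decompose[OF r finite_A] by blast
  have fin: "\<forall>Q\<in>C. finite Q" using C finite_A by (metis Union_upper finite_subset)
  have "m * real (card Q) \<le> (\<Sum>x\<in>Q. D 0 x (r x))" if Q: "Q \<in> C" for Q
  proof -
    obtain x where x: "x \<in> Q" "Q = orbit r x" using C Q by (auto simp: cyclic_on_def)
    have xA: "x \<in> A" using C x Q by auto
    define k where "k = funpow_dist r (r x) x"
    have kd: "funpow_dist1 r x x = Suc k" by (simp add: k_def)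
    have self: "x \<in> orbit r x" using x by simp
    have orb: "Q = (\<lambda>i. (r ^^ i) x) ` {0..<Suc k}"
      using orbit_conv_funpow_dist1[OF self] x(2) kd by simp
    have inj: "inj_on (\<lambda>i. (r ^^ i) x) {0..<Suc k}"
      using inj_on_funpow_dist1[OF self] kd by simp
    have ret: "(r ^^ Suc k) x = x" using funpow_dist1_prop[OF self] kd by simp
    have card: "card Q = Suc k" using card_image[OF inj] orb by simp
    have "card Q \<le> card A" using C Q finite_A by (intro card_mono) auto
    then have "m * real (Suc k) \<le> D k x x" using mean xA card by simp
    also have "\<dots> \<le> (\<Sum>i<Suc k. D 0 ((r ^^ i) x) (r ((r ^^ i) x)))"
      using D_le_walk[OF r xA, of k] ret by simp
    also have "\<dots> = (\<Sum>y\<in>Q. D 0 y (r y))"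
      unfolding orb sum.reindex[OF inj] by (simp add: atLeast0LessThan o_def)
    finally show ?thesis using card by simp
  qed
  then have "(\<Sum>Q\<in>C. m * real (card Q)) \<le> (\<Sum>Q\<in>C. \<Sum>x\<in>Q. D 0 x (r x))" by (rule sum_mono)
  moreover have "(\<Sum>Q\<in>C. \<Sum>x\<in>Q. D 0 x (r x)) = (\<Sum>x\<in>A. D 0 x (r x))"
    unfolding C(2)[symmetric] using fin C(3) by (intro sum.Union_disjoint[symmetric, simplified o_def]) auto
  moreover have "card A = (\<Sum>Q\<in>C. card Q)"
    unfolding C(2)[symmetric] using fin C(3)
    by (intro card_Union_disjoint) (auto simp: pairwise_def disjnt_def)
  ultimately show ?thesis by (simp add: sum_distrib_left)
qed

text \<open>A closed walk attaining \<open>D k u u\<close>, read backwards: it runs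
  \<open>u, bt k, ..., bt 1, bt 0 = u\<close>. Its part up to \<open>bt i\<close> has
  \<open>k - i + 1\<close> arcs, which explains the index \<open>k - i\<close>.\<close>

context
  fixes u :: 'l and k :: nat and bt :: "nat \<Rightarrow> 'l"
  assumes u: "bt 0 = u"
    and btA: "i \<le> k \<Longrightarrow> bt i \<in> A"
    and bt_step: "i < k \<Longrightarrow>
      D (k - i) u (bt i) = D (k - Suc i) u (bt (Suc i)) + D 0 (bt (Suc i)) (bt i)"
begin

text \<open>The part up to \<open>bt i\<close> splits at \<open>bt j\<close> into a shorter prefix
  and a stretch of \<open>j - i\<close> arcs, and the stretch weighs at least the table entry for
  its ends.\<close>

lemma D_backtrack_segment:
  assumes "i < j" "j \<le> k"
  shows "D (k - j) u (bt j) + D (j - Suc i) (bt j) (bt i) \<le> D (k - i) u (bt i)"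
  using assms
proof (induction j)
  case 0
  then show ?case by simp
next
  case (Suc j)
  show ?case
  proof (cases "i = j")
    case True
    then show ?thesis using bt_step[of j] Suc.prems by simp
  next
    case False
    then have "Suc (0 + (j - Suc i)) = Suc j - Suc i" using Suc.prems by simp
    then have "D (Suc j - Suc i) (bt (Suc j)) (bt i)
        \<le> D 0 (bt (Suc j)) (bt j) + D (j - Suc i) (bt j) (bt i)"
      using D_add_le[of "bt (Suc j)" "bt j" "bt i" 0 "j - Suc i"] btA Suc.prems by simp
    then show ?thesis using Suc False bt_step[of j] by simp
  qed
qed

lemma D_backtrack_weight:
  "D k u u = D 0 u (bt k) + (\<Sum>i<k. D 0 (bt (Suc i)) (bt i))"
proof -
  have "D k u u = D (k - j) u (bt j) + (\<Sum>i<j. D 0 (bt (Suc i)) (bt i))" if "j \<le> k" for j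
    using that by (induction j) (use u bt_step in auto)
  from this[of k] show ?thesis by simp
qed

text \<open>A repeated vertex would split the closed walk into two shorter ones, one of them with
  at most the same mean.\<close>

lemma inj_on_backtrack:
  assumes first: "\<And>x j. x \<in> A \<Longrightarrow> j < k \<Longrightarrow> D k u u * real (Suc j) < D j x x * real (Suc k)"
  shows "inj_on bt {..k}"
proof -
  have "bt i \<noteq> bt j" if ij: "i < j" "j \<le> k" for i j
  proof
    assume eq: "bt i = bt j"
    have uA: "u \<in> A" using btA[of 0] u by simp
    have seg: "D (k - j) u (bt i) + D (j - Suc i) (bt i) (bt i) \<le> D (k - i) u (bt i)"
      using D_backtrack_segment[OF ij] eq by simp
    \<comment> \<open>Cutting out the stretch between the two visits leaves a closed walk at
      \<open>u\<close>. For \<open>i = 0\<close> the repeated vertex is \<open>u\<close> itself, and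
      the prefix up to \<open>bt j\<close> is already closed.\<close>
    have "D (k - (j - i)) u u + D (j - Suc i) (bt i) (bt i) \<le> D k u u"
    proof (cases "i = 0")
      case True
      then show ?thesis using seg u by simp
    next
      case False
      have "D (k - i) u (bt i) + D (i - 1) (bt i) u \<le> D k u u"
        using D_backtrack_segment[of 0 i] False ij u by simp
      moreover have "Suc (k - j + (i - 1)) = k - (j - i)" using False ij by simp
      then have "D (k - (j - i)) u u \<le> D (k - j) u (bt i) + D (i - 1) (bt i) u"
        using D_add_le[of u "bt i" u "k - j" "i - 1"] uA btA[of i] ij by (simp only:)
      ultimately show ?thesis using seg by simp
    qed
    \<comment> \<open>Both pieces have fewer arcs than the whole and hence strictly larger means by
      \<open>first\<close>. But their numbers of arcs add up to \<open>Suc k\<close>, while their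
      weights add up to at most \<open>D k u u\<close>.\<close>
    then have "(D (k - (j - i)) u u + D (j - Suc i) (bt i) (bt i)) * real (Suc k) \<le> D k u u * real (Suc k)"
      by (intro mult_right_mono) auto
    moreover have "D k u u * real (Suc (k - (j - i))) < D (k - (j - i)) u u * real (Suc k)"
      using ij uA by (intro first) auto
    moreover have "D k u u * real (Suc (j - Suc i)) < D (j - Suc i) (bt i) (bt i) * real (Suc k)"
      using ij btA[of i] by (intro first) auto
    moreover have "real (Suc (k - (j - i))) + real (Suc (j - Suc i)) = real (Suc k)"
      using ij by simp
    then have "D k u u * real (Suc (k - (j - i))) + D k u u * real (Suc (j - Suc i)) = D k u u * real (Suc k)"
      by (metis distrib_left)
    ultimately show False by (simp only: distrib_right)
  qed
  then show ?thesis by (intro inj_onI) (metis atMost_iff linorder_neq_iff)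
qed

end

end

section \<open>Directed 2-factors as permutations\<close>

lemma cas_orbit_walk:
  assumes "j \<le> m"
  shows "pre_digraph.cas (with_proj D) ((f ^^ j) x)
      (map (\<lambda>i. ((f ^^ i) x, (f ^^ Suc i) x)) [j..<m]) ((f ^^ m) x)"
  using assms
proof (induction "m - j" arbitrary: j)
  case 0
  then show ?case by (simp add: pre_digraph.cas.simps)
next
  case (Suc d)
  then have "[j..<m] = j # [Suc j..<m]" by (simp add: upt_conv_Cons)
  moreover have "d = m - Suc j" "Suc j \<le> m" using Suc.hyps by auto
  note Suc.hyps(1)[OF this]
  ultimately show ?case by (simp add: pre_digraph.cas.simps)
qed

lemma awalk_verts_eq_Cons_map:
  "pre_digraph.cas (with_proj D) u p v \<Longrightarrow>
     pre_digraph.awalk_verts (with_proj D) u p = u # map snd p"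
  by (induction p arbitrary: u) (auto simp: pre_digraph.cas.simps pre_digraph.awalk_verts.simps)

lemma two_factor_of_permutation:
  assumes fin: "finite (pverts D)"
    and arcs: "parcs D = {(u, v). (u, v) \<in> pverts D \<times> pverts D \<and> u \<noteq> v}"
    and s: "s permutes pverts D"
    and no_fix: "\<forall>v\<in>pverts D. s v \<noteq> v"
  obtains F where "directed_two_factor D F"
    "two_factor_arcs F = {(v, s v) |v. v \<in> pverts D}"
    "\<forall>C\<in>F. \<exists>v\<in>pverts D. cycle_verts C = orbit s v"
proof -
  let ?V = "pverts D"
  have ps: "permutation s" using s fin permutation_permutes by blast
  have self: "x \<in> orbit s x" for x using ps by (rule permutation_self_in_orbit)
  have orb_eq: "orbit s x = orbit s y" if "x \<in> orbit s y" for x y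
    using that ps by (metis cyclic_on_orbit' orbit_cyclic_eq3)
  \<comment> \<open>\<open>rep x\<close> depends on the orbit only, so every orbit contributes a
    single list. Two rotations of one cycle would be distinct members of \<open>F\<close> with
    common vertices.\<close>
  define rep where "rep x = (SOME y. y \<in> orbit s x)" for x
  have rep: "rep x \<in> orbit s x" for x unfolding rep_def by (rule someI) (rule self)
  have rep_orbit: "orbit s (rep x) = orbit s x" for x using orb_eq rep by blast
  define cyc where "cyc x = map (\<lambda>i. ((s ^^ i) x, (s ^^ Suc i) x)) [0..<funpow_dist1 s x x]" for x
  have tails: "fst ` set (cyc x) = orbit s x" for x
    unfolding orbit_conv_funpow_dist1[OF self, of x] cyc_def by (simp only: set_map set_upt image_image fst_conv)
  have arc: "snd e = s (fst e)" if "e \<in> set (cyc x)" for e x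
    using that by (auto simp: cyc_def)
  have orbV: "orbit s x \<subseteq> ?V" if "x \<in> ?V" for x using permutes_orbit_subset[OF s that] .
  have set_cyc: "set (cyc x) = {(v, s v) |v. v \<in> orbit s x}" for x
    unfolding tails[symmetric] using arc[of _ x] by (force simp: image_iff)
  have cycle: "pre_digraph.cycle (with_proj D) (cyc x)" if x: "x \<in> ?V" for x
    unfolding pre_digraph.cycle_def pre_digraph.awalk_def
  proof (intro exI conjI)
    have cas: "pre_digraph.cas (with_proj D) x (cyc x) x"
      using cas_orbit_walk[of 0 "funpow_dist1 s x x" D s x] funpow_dist1_prop[OF self, of x]
      by (simp add: cyc_def)
    show "pre_digraph.cas (with_proj D) x (cyc x) x" by (rule cas)
    show "x \<in> verts (with_proj D)" using x by simp
    show "set (cyc x) \<subseteq> arcs (with_proj D)"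
    proof -
      have "(v, s v) \<in> parcs D" if "v \<in> orbit s x" for v
      proof -
        have v: "v \<in> ?V" using orbV[OF x] that by blast
        then have "s v \<noteq> v" using no_fix by blast
        then show ?thesis using v s by (auto simp: arcs permutes_in_image)
      qed
      then show ?thesis unfolding set_cyc by auto
    qed
    show "cyc x \<noteq> []" by (simp add: cyc_def)
    have "distinct (map (\<lambda>i. (s ^^ i) x) [0..<funpow_dist1 s x x])"
      using inj_on_funpow_dist1[OF self, of x] by (simp only: distinct_map distinct_upt set_upt)
    then have "distinct (map s (map (\<lambda>i. (s ^^ i) x) [0..<funpow_dist1 s x x]))"
      using permutes_inj[OF s] by (simp only: distinct_map) (metis inj_on_subset subset_UNIV)
    moreover have "map snd (cyc x) = map s (map (\<lambda>i. (s ^^ i) x) [0..<funpow_dist1 s x x])"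
      by (simp add: cyc_def)
    ultimately show "distinct (tl (pre_digraph.awalk_verts (with_proj D) x (cyc x)))"
      using awalk_verts_eq_Cons_map[OF cas] by simp
  qed
  define F where "F = (\<lambda>x. cyc (rep x)) ` ?V"
  have repV: "rep x \<in> ?V" if "x \<in> ?V" for x using rep orbV that by blast
  have "directed_two_factor D F"
    unfolding directed_two_factor_def
  proof (intro conjI)
    show "\<forall>C\<in>F. pre_digraph.cycle (with_proj D) C" using cycle repV F_def by auto
    show "disjoint_family_on cycle_verts F"
      unfolding disjoint_family_on_def
    proof (intro ballI impI)
      fix C C' assume C: "C \<in> F" "C' \<in> F" "C \<noteq> C'"
      obtain x x' where x: "C = cyc (rep x)" "C' = cyc (rep x')" using C F_def by auto
      have "orbit s x \<noteq> orbit s x'" using C x by (auto simp: rep_def)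
      then have "orbit s x \<inter> orbit s x' = {}" using orb_eq by blast
      then show "cycle_verts C \<inter> cycle_verts C' = {}"
        by (simp add: cycle_verts_def x tails rep_orbit)
    qed
    show "(\<Union>C\<in>F. cycle_verts C) = ?V"
      unfolding F_def cycle_verts_def using tails rep_orbit orbV self by (auto dest: subsetD[OF orbV])
  qed
  moreover have "two_factor_arcs F = {(v, s v) |v. v \<in> ?V}"
    unfolding two_factor_arcs_def F_def using set_cyc rep_orbit orbV self
    by (auto dest: subsetD[OF orbV])
  moreover have "\<forall>C\<in>F. \<exists>v\<in>?V. cycle_verts C = orbit s v"
    by (auto simp: F_def cycle_verts_def tails rep_orbit)
  ultimately show ?thesis using that by blast
qed

lemma cas_tails_heads:
  "pre_digraph.cas (with_proj D) u p v \<Longrightarrow> map fst p @ [v] = u # map snd p"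
  by (induction p arbitrary: u) (auto simp: pre_digraph.cas.simps)

text \<open>The start \<open>u\<close> is a separate case because \<open>orbit s u\<close> begins
  with \<open>s u\<close>.\<close>

lemma cas_tails_in_orbit:
  assumes "pre_digraph.cas (with_proj D) u p v" "\<And>e. e \<in> set p \<Longrightarrow> snd e = s (fst e)"
    and "e \<in> set p"
  shows "fst e = u \<or> fst e \<in> orbit s u"
  using assms
proof (induction p arbitrary: u)
  case Nil
  then show ?case by simp
next
  case (Cons a p)
  have a: "fst a = u" "snd a = s u" using Cons.prems by (auto simp: pre_digraph.cas.simps)
  show ?case
  proof (cases "e = a")
    case True
    then show ?thesis using a by simp
  next
    case False
    then have "fst e = s u \<or> fst e \<in> orbit s (s u)"
      using Cons.IH[of "s u"] Cons.prems a by (auto simp: pre_digraph.cas.simps)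
    then show ?thesis by (auto intro: orbit.base orbit_subset)
  qed
qed

text \<open>In a 2-factor every vertex is the tail of exactly one arc and the head of exactly one
  arc, so its successor is well defined and depends bijectively on it.\<close>

lemma permutation_of_two_factor:
  fixes w :: "'a \<times> 'a \<Rightarrow> rat"
  assumes fin: "finite (pverts D)" and F: "directed_two_factor D F"
  obtains s where "s permutes pverts D"
    "two_factor_weight w F = (\<Sum>v\<in>pverts D. w (v, s v))"
    "\<forall>C\<in>F. \<forall>u\<in>cycle_verts C. \<forall>v\<in>cycle_verts C. v \<in> orbit s u"
    "\<forall>v\<in>pverts D. (v, s v) \<in> parcs D"
proof -
  let ?V = "pverts D" and ?E = "two_factor_arcs F"
  have cyc: "set C \<subseteq> parcs D \<and> inj_on fst (set C) \<and> inj_on snd (set C) \<and>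
      snd ` set C = cycle_verts C \<and> (\<exists>u. pre_digraph.cas (with_proj D) u C u)" if C: "C \<in> F" for C
  proof -
    have "pre_digraph.cycle (with_proj D) C" using F C by (auto simp: directed_two_factor_def)
    then obtain u where u: "set C \<subseteq> parcs D" "pre_digraph.cas (with_proj D) u C u"
      "distinct (tl (pre_digraph.awalk_verts (with_proj D) u C))"
      by (auto simp: pre_digraph.cycle_def pre_digraph.awalk_def)
    have d: "distinct (map snd C)" using u awalk_verts_eq_Cons_map[OF u(2)] by simp
    \<comment> \<open>The definition of a cycle makes the heads distinct. As the walk is closed,
      tails and heads form the same multiset, so the tails are distinct as well.\<close>
    have "mset (map fst C @ [u]) = mset (u # map snd C)" using cas_tails_heads[OF u(2)] by simp
    then have m: "mset (map fst C) = mset (map snd C)" by simp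
    then have "distinct (map fst C)" "set (map fst C) = set (map snd C)"
      using d by (metis mset_eq_imp_distinct_iff) (metis m mset_eq_setD)
    then show ?thesis using u d by (auto simp: distinct_map cycle_verts_def)
  qed
  have disj: "C = C'" if "C \<in> F" "C' \<in> F" "x \<in> cycle_verts C" "x \<in> cycle_verts C'" for C C' x
    using F that by (auto simp: directed_two_factor_def disjoint_family_on_def)
  have inj_fst: "inj_on fst ?E"
  proof (rule inj_onI)
    fix e e' assume "e \<in> ?E" "e' \<in> ?E" and eq: "fst e = fst e'"
    then obtain C C' where C: "C \<in> F" "C' \<in> F" "e \<in> set C" "e' \<in> set C'"
      by (auto simp: two_factor_arcs_def)
    then have "fst e \<in> cycle_verts C" "fst e \<in> cycle_verts C'"
      using eq by (auto simp: cycle_verts_def intro: imageI) (metis imageI)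
    then have "C = C'" using C by (intro disj[of C C' "fst e"])
    then show "e = e'" using C cyc[of C] eq by (auto dest: inj_onD)
  qed
  have inj_snd: "inj_on snd ?E"
  proof (rule inj_onI)
    fix e e' assume "e \<in> ?E" "e' \<in> ?E" and eq: "snd e = snd e'"
    then obtain C C' where C: "C \<in> F" "C' \<in> F" "e \<in> set C" "e' \<in> set C'"
      by (auto simp: two_factor_arcs_def)
    have "snd e \<in> cycle_verts C" "snd e' \<in> cycle_verts C'" using C cyc by blast+
    then have "C = C'" using eq C by (intro disj[of C C' "snd e"]) auto
    then show "e = e'" using C cyc[of C] eq by (auto dest: inj_onD)
  qed
  have V: "(\<Union>C\<in>F. cycle_verts C) = ?V" using F by (simp add: directed_two_factor_def)
  have fst_E: "fst ` ?E = ?V"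
    unfolding V[symmetric] two_factor_arcs_def cycle_verts_def by auto
  have snd_E: "snd ` ?E = ?V"
    unfolding V[symmetric] two_factor_arcs_def using cyc by (simp add: image_UN)
  define s where "s v = (if v \<in> ?V then snd (the_inv_into ?E fst v) else v)" for v
  have s_arc: "snd e = s (fst e)" if "e \<in> ?E" for e
    using that fst_E inj_fst by (auto simp: s_def the_inv_into_f_f)
  have E_eq: "?E = (\<lambda>v. (v, s v)) ` ?V"
    unfolding fst_E[symmetric] using s_arc by (force simp: image_iff)
  have "bij_betw s ?V ?V"
    unfolding bij_betw_def
  proof
    show "inj_on s ?V"
    proof (rule inj_onI)
      fix x y assume "x \<in> ?V" "y \<in> ?V" "s x = s y"
      then have "(x, s x) \<in> ?E" "(y, s y) \<in> ?E" "snd (x, s x) = snd (y, s y)"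
        using E_eq by auto
      then show "x = y" using inj_snd by (metis inj_onD prod.inject)
    qed
    have "snd ` ?E = s ` ?V" unfolding E_eq by (simp add: image_image)
    then show "s ` ?V = ?V" using snd_E by simp
  qed
  then have perm: "s permutes ?V" by (rule bij_imp_permutes) (simp add: s_def)
  then have ps: "permutation s" using fin permutation_permutes by blast
  have orb_eq: "orbit s x = orbit s y" if "x \<in> orbit s y" for x y
    using that ps by (metis cyclic_on_orbit' orbit_cyclic_eq3)
  have same: "v \<in> orbit s u" if C: "C \<in> F" "u \<in> cycle_verts C" "v \<in> cycle_verts C" for C u v
  proof -
    obtain a where a: "pre_digraph.cas (with_proj D) a C a" using cyc C by blast
    have "x \<in> orbit s a" if "x \<in> cycle_verts C" for x
    proof -
      obtain e where "e \<in> set C" "x = fst e" using \<open>x \<in> cycle_verts C\<close> by (auto simp: cycle_verts_def)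
      then have "x = a \<or> x \<in> orbit s a"
        using cas_tails_in_orbit[OF a, of s e] s_arc C by (auto simp: two_factor_arcs_def)
      then show ?thesis using permutation_self_in_orbit[OF ps] by auto
    qed
    then show ?thesis using C orb_eq by metis
  qed
  have weight: "two_factor_weight w F = (\<Sum>v\<in>?V. w (v, s v))"
    unfolding two_factor_weight_def E_eq by (subst sum.reindex) (auto simp: inj_on_def)
  have "(v, s v) \<in> parcs D" if "v \<in> ?V" for v
  proof -
    have "(v, s v) \<in> ?E" using E_eq that by auto
    then show ?thesis using cyc by (auto simp: two_factor_arcs_def)
  qed
  with perm weight same show ?thesis using that by blast
qed

section \<open>Loop programs and their running time\<close>

text \<open>As all loops run up to the input size \<open>n\<close>, programs have a total semantics, and a polynomial
  time bound can be read off their syntax as soon as no assignment multiplies two computed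
  numbers.\<close>

datatype lprog =
    LSkip
  | LAssign string aexp aexp
  | LSeq lprog lprog
  | LCond bexp lprog lprog
  | LFor string lprog

definition set_cell :: "string \<Rightarrow> int \<Rightarrow> int \<Rightarrow> store \<Rightarrow> store" where
  "set_cell x i v s = s(x := (s x)(i := v))"

abbreviation Var :: "string \<Rightarrow> aexp" where
  "Var x \<equiv> Cell x (Const 0)"

fun sem :: "lprog \<Rightarrow> store \<Rightarrow> store" where
  "sem LSkip s = s"
| "sem (LAssign x i a) s = set_cell x (aval i s) (aval a s) s"
| "sem (LSeq p q) s = sem q (sem p s)"
| "sem (LCond b p q) s = (if bval b s then sem p s else sem q s)"
| "sem (LFor i p) s =
     ((\<lambda>s. set_cell i 0 (sem p s i 0 + 1) (sem p s)) ^^ nat (s ''size'' 0)) (set_cell i 0 0 s)"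

fun compile :: "lprog \<Rightarrow> com" where
  "compile LSkip = SKIP"
| "compile (LAssign x i a) = Assign x i a"
| "compile (LSeq p q) = Seq (compile p) (compile q)"
| "compile (LCond b p q) = Cond b (compile p) (compile q)"
| "compile (LFor i p) = Seq (Assign i (Const 0) (Const 0))
     (While (Less (Var i) (Var ''size''))
        (Seq (compile p) (Assign i (Const 0) (Plus (Var i) (Const 1)))))"

fun writes :: "lprog \<Rightarrow> string set" where
  "writes LSkip = {}"
| "writes (LAssign x i a) = {x}"
| "writes (LSeq p q) = writes p \<union> writes q"
| "writes (LCond b p q) = writes p \<union> writes q"
| "writes (LFor i p) = insert i (writes p)"

definition read_only :: "string set" where
  "read_only = {''size'', ''num'', ''den'', ''term''}"

text \<open>A product with an input cell lengthens a value by at most the length of that cell,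
  whatever length has been reached already. A divisor may be anything, since a quotient is never
  longer than its dividend.\<close>

fun slow :: "aexp \<Rightarrow> bool" where
  "slow (Const k) \<longleftrightarrow> k = 0 \<or> k = 1"
| "slow (Cell x a) \<longleftrightarrow> True"
| "slow (Plus a b) \<longleftrightarrow> slow a \<and> slow b"
| "slow (Minus a b) \<longleftrightarrow> slow a \<and> slow b"
| "slow (Times a b) \<longleftrightarrow> slow a \<and> (\<exists>x i. b = Cell x i \<and> x \<in> read_only)"
| "slow (Div a b) \<longleftrightarrow> slow a"

text \<open>Only stored values have to be \<open>slow\<close>. Addresses and conditions may multiply
  computed numbers, which the comparison of means relies on. A body must not touch its own counter,
  so that the compiled while loop makes exactly as many passes as \<open>sem\<close>.\<close>

fun wf_prog :: "lprog \<Rightarrow> bool" where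
  "wf_prog LSkip \<longleftrightarrow> True"
| "wf_prog (LAssign x i a) \<longleftrightarrow> x \<notin> read_only \<and> slow a"
| "wf_prog (LSeq p q) \<longleftrightarrow> wf_prog p \<and> wf_prog q"
| "wf_prog (LCond b p q) \<longleftrightarrow> wf_prog p \<and> wf_prog q"
| "wf_prog (LFor i p) \<longleftrightarrow> i \<notin> read_only \<and> i \<notin> writes p \<and> wf_prog p"

lemma set_cell_same [simp]: "set_cell x i v s x = (s x)(i := v)"
  by (simp add: set_cell_def)

lemma set_cell_other [simp]: "y \<noteq> x \<Longrightarrow> set_cell x i v s y = s y"
  by (simp add: set_cell_def)

lemma sem_not_written: "x \<notin> writes p \<Longrightarrow> sem p s x = s x"
proof (induction p arbitrary: s)
  case (LFor i p)
  let ?f = "\<lambda>s. set_cell i 0 (sem p s i 0 + 1) (sem p s)"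
  have "(?f ^^ k) t x = t x" for k t
    using LFor by (induction k) auto
  then show ?case using LFor.prems by simp
qed auto

lemma wf_writes: "wf_prog p \<Longrightarrow> writes p \<inter> read_only = {}"
  by (induction p) auto

text \<open>The step may assume that arrays outside \<open>writes p\<close>, other than the counter,
  are as before the loop. So an invariant has to speak only of what the loop changes.\<close>

lemma sem_LFor:
  assumes size: "s0 ''size'' 0 = int n"
    and wf: "i \<notin> writes p" "i \<noteq> ''size''" "''size'' \<notin> writes p"
    and init: "I 0 (set_cell i 0 0 s0)"
    and step: "\<And>k s. k < n \<Longrightarrow> I k s \<Longrightarrow> s i 0 = int k \<Longrightarrow>
      (\<And>x. x \<noteq> i \<Longrightarrow> x \<notin> writes p \<Longrightarrow> s x = s0 x) \<Longrightarrow>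
      I (Suc k) (set_cell i 0 (int (Suc k)) (sem p s))"
  shows "I n (sem (LFor i p) s0)"
proof -
  let ?f = "\<lambda>s. set_cell i 0 (sem p s i 0 + 1) (sem p s)"
  let ?s = "\<lambda>k. (?f ^^ k) (set_cell i 0 0 s0)"
  have "I k (?s k) \<and> ?s k i 0 = int k \<and> (\<forall>x. x \<noteq> i \<longrightarrow> x \<notin> writes p \<longrightarrow> ?s k x = s0 x)"
    if "k \<le> n" for k
    using that
  proof (induction k)
    case 0
    then show ?case using init by simp
  next
    case (Suc k)
    then have IH: "I k (?s k)" "?s k i 0 = int k"
      "\<And>x. x \<noteq> i \<Longrightarrow> x \<notin> writes p \<Longrightarrow> ?s k x = s0 x" by auto
    have i: "sem p (?s k) i 0 = int k" using sem_not_written[OF wf(1)] IH(2) by simp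
    then have eq: "?s (Suc k) = set_cell i 0 (int (Suc k)) (sem p (?s k))" by (simp add: add.commute)
    have "I (Suc k) (?s (Suc k))" unfolding eq using Suc.prems IH by (intro step) auto
    moreover have "?s (Suc k) i 0 = int (Suc k)" unfolding eq by simp
    moreover have "?s (Suc k) x = s0 x" if "x \<noteq> i" "x \<notin> writes p" for x
      unfolding eq using that sem_not_written[OF that(2)] IH(3) by simp
    ultimately show ?case by blast
  qed
  from this[of n] show ?thesis using size by simp
qed

subsection \<open>Sizes of values\<close>

lemma int_size_pos: "1 \<le> int_size k"
  by (simp add: int_size_def)

lemma int_size_le_iff: "int_size k \<le> Suc b \<longleftrightarrow> \<bar>k\<bar> < 2 ^ b"
proof -
  have "int_size k \<le> Suc b \<longleftrightarrow> bitlen \<bar>k\<bar> \<le> int b" by (simp add: int_size_def nat_le_iff)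
  also have "\<dots> \<longleftrightarrow> \<bar>k\<bar> < 2 ^ b" by (simp add: bitlen_le_iff_power)
  finally show ?thesis .
qed

lemma int_size_eq_Suc:
  obtains b where "int_size k = Suc b" "\<bar>k\<bar> < 2 ^ b"
proof -
  obtain b where b: "int_size k = Suc b" using int_size_pos[of k] by (cases "int_size k") auto
  then have "\<bar>k\<bar> < 2 ^ b" unfolding int_size_le_iff[symmetric] by (rule eq_imp_le)
  with b show ?thesis by (rule that)
qed

lemma int_size_mono:
  assumes "\<bar>j\<bar> \<le> \<bar>k\<bar>"
  shows "int_size j \<le> int_size k"
proof -
  obtain b where b: "int_size k = Suc b" "\<bar>k\<bar> < 2 ^ b" by (rule int_size_eq_Suc)
  have "\<bar>j\<bar> < 2 ^ b" using assms b(2) by (rule le_less_trans)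
  then show ?thesis unfolding b(1) int_size_le_iff .
qed

lemma int_size_add_le:
  assumes "int_size j \<le> b" "int_size k \<le> b"
  shows "int_size (j + k) \<le> b + 1" "int_size (j - k) \<le> b + 1"
proof -
  obtain a where b: "b = Suc a" using assms int_size_pos[of j] by (cases b) auto
  have jk: "\<bar>j\<bar> < 2 ^ a" "\<bar>k\<bar> < 2 ^ a"
    using assms unfolding b int_size_le_iff by simp_all
  have "\<bar>j + k\<bar> < 2 ^ b" "\<bar>j - k\<bar> < 2 ^ b" unfolding b power_Suc using jk by linarith+
  then show "int_size (j + k) \<le> b + 1" "int_size (j - k) \<le> b + 1"
    unfolding Suc_eq_plus1[symmetric] int_size_le_iff by simp_all
qed

lemma int_size_mult_le: "int_size (j * k) \<le> int_size j + int_size k"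
proof -
  obtain a where a: "int_size j = Suc a" "\<bar>j\<bar> < 2 ^ a" by (rule int_size_eq_Suc)
  obtain b where b: "int_size k = Suc b" "\<bar>k\<bar> < 2 ^ b" by (rule int_size_eq_Suc)
  have "\<bar>j * k\<bar> < 2 ^ (a + b)"
    unfolding abs_mult power_add using a(2) b(2) by (intro mult_strict_mono') auto
  then have "int_size (j * k) \<le> Suc (a + b)" unfolding int_size_le_iff .
  then show ?thesis using a(1) b(1) by simp
qed

lemma int_size_div_le: "int_size (j div k) \<le> int_size j"
proof (rule int_size_mono)
  show "\<bar>j div k\<bar> \<le> \<bar>j\<bar>"
  proof (cases "k = 0 \<or> j = 0")
    case False
    \<comment> \<open>Division rounds down, which for a negative dividend is away from 0, hence the
      two cases. A negative divisor is reduced to a positive one by changing both signs.\<close>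
    have 1: "\<bar>j div k\<bar> \<le> \<bar>j\<bar>" if "k > 0" for j k :: int
    proof (cases "j \<ge> 0")
      case True
      then have "0 \<le> j div k" using that by (simp add: pos_imp_zdiv_nonneg_iff)
      then have "1 * (j div k) \<le> k * (j div k)" using that by (intro mult_right_mono) auto
      also have "\<dots> \<le> j"
        using mult_div_mod_eq[of k j] pos_mod_sign[OF that, of j] by linarith
      finally show ?thesis using \<open>0 \<le> j div k\<close> by simp
    next
      case False
      then have neg: "j div k < 0" using that by (simp add: neg_imp_zdiv_nonneg_iff pos_imp_zdiv_neg_iff)
      have "j < k * (j div k) + k"
        using mult_div_mod_eq[of k j] pos_mod_bound[OF that, of j] by linarith
      also have "\<dots> = k * (j div k + 1)" by (simp add: distrib_left)
      also have "\<dots> \<le> 1 * (j div k + 1)" using that neg by (intro mult_right_mono_neg) auto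
      finally show ?thesis using neg by simp
    qed
    show ?thesis
    proof (cases "k > 0")
      case True
      then show ?thesis by (rule 1)
    next
      case False
      then have "-k > 0" using \<open>\<not> (k = 0 \<or> j = 0)\<close> by auto
      from 1[OF this, of "-j"] show ?thesis by simp
    qed
  qed auto
qed

section \<open>Lengths of values and costs of expressions\<close>

definition bounded_store :: "nat \<Rightarrow> store \<Rightarrow> bool" where
  "bounded_store b s \<longleftrightarrow> (\<forall>x i. int_size (s x i) \<le> b)"

text \<open>Factors linear in \<open>b\<close> are good enough for the cost of one evaluation. As
  bounds on stored values they would multiply from pass to pass of a loop; those values are handled
  by \<open>slow_growth\<close>.\<close>

fun val_coeff :: "aexp \<Rightarrow> nat" where
  "val_coeff (Const k) = int_size k"
| "val_coeff (Cell x a) = 1"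
| "val_coeff (Plus a b) = val_coeff a + val_coeff b"
| "val_coeff (Minus a b) = val_coeff a + val_coeff b"
| "val_coeff (Times a b) = val_coeff a + val_coeff b"
| "val_coeff (Div a b) = val_coeff a"

fun cost_coeff :: "aexp \<Rightarrow> nat" where
  "cost_coeff (Const k) = int_size k"
| "cost_coeff (Cell x a) = cost_coeff a + 1"
| "cost_coeff (Plus a b) = cost_coeff a + cost_coeff b + val_coeff a + val_coeff b"
| "cost_coeff (Minus a b) = cost_coeff a + cost_coeff b + val_coeff a + val_coeff b"
| "cost_coeff (Times a b) = cost_coeff a + cost_coeff b + val_coeff a + val_coeff b"
| "cost_coeff (Div a b) = cost_coeff a + cost_coeff b + val_coeff a"

fun bcost_coeff :: "bexp \<Rightarrow> nat" where
  "bcost_coeff (Less a b) = cost_coeff a + cost_coeff b + 1"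
| "bcost_coeff (Neg b) = bcost_coeff b + 1"
| "bcost_coeff (And b c) = bcost_coeff b + bcost_coeff c + 1"

lemma int_size_aval_le:
  assumes "bounded_store b s" "1 \<le> b"
  shows "int_size (aval a s) \<le> val_coeff a * b"
proof (induction a)
  case (Plus a c)
  have "int_size (aval a s + aval c s) \<le> max (int_size (aval a s)) (int_size (aval c s)) + 1"
    by (rule int_size_add_le) auto
  then show ?case using Plus int_size_pos[of "aval a s"] int_size_pos[of "aval c s"]
    by (simp add: distrib_right)
next
  case (Minus a c)
  have "int_size (aval a s - aval c s) \<le> max (int_size (aval a s)) (int_size (aval c s)) + 1"
    by (rule int_size_add_le) auto
  then show ?case using Minus int_size_pos[of "aval a s"] int_size_pos[of "aval c s"]
    by (simp add: distrib_right)
next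
  case (Times a c)
  then show ?case using int_size_mult_le[of "aval a s" "aval c s"] by (simp add: distrib_right)
next
  case (Div a c)
  then show ?case using int_size_div_le[of "aval a s" "aval c s"] by simp
qed (use assms in \<open>auto simp: bounded_store_def\<close>)

lemma acost_le:
  assumes "bounded_store b s" "1 \<le> b"
  shows "acost a s \<le> cost_coeff a * b"
proof (induction a)
  case (Cell x a)
  moreover have "int_size (s x (aval a s)) \<le> b" using assms by (simp add: bounded_store_def)
  ultimately show ?case by simp
next
  case (Plus a c)
  then show ?case using int_size_aval_le[OF assms, of "Plus a c"] by (simp add: distrib_right)
next
  case (Minus a c)
  then show ?case using int_size_aval_le[OF assms, of "Minus a c"] by (simp add: distrib_right)
next
  case (Times a c)
  then show ?case using int_size_aval_le[OF assms, of "Times a c"] by (simp add: distrib_right)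
next
  case (Div a c)
  then show ?case using int_size_aval_le[OF assms, of "Div a c"] by (simp add: distrib_right)
qed (use assms in \<open>auto simp: bounded_store_def\<close>)

lemma bcost_le:
  assumes "bounded_store b s" "1 \<le> b"
  shows "bcost e s \<le> bcost_coeff e * b"
proof (induction e)
  case (Less x y)
  then show ?case using acost_le[OF assms, of x] acost_le[OF assms, of y] assms(2)
    by (simp add: distrib_right)
qed (use assms(2) in \<open>auto simp: distrib_right\<close>)

text \<open>The bound is \<open>b\<close> plus a term without \<open>b\<close>, not a multiple of
  \<open>b\<close>: repeating an assignment \<open>n\<close> times then adds \<open>n\<close> such
  terms instead of compounding a factor.\<close>

lemma slow_growth:
  assumes "slow a" "bounded_store b s" "2 \<le> b" "1 \<le> b0"
    "\<And>x i. x \<in> read_only \<Longrightarrow> int_size (s x i) \<le> b0"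
  shows "int_size (aval a s) \<le> b + size a * b0"
  using assms(1)
proof (induction a)
  case (Const k)
  have "int_size k \<le> 2" using Const int_size_le_iff[of k 1] by auto
  then show ?case using assms(3) by simp
next
  case (Cell x a)
  then show ?case using assms(2) by (auto simp: bounded_store_def intro: trans_le_add1)
next
  case (Plus a c)
  have "int_size (aval a s + aval c s) \<le> (b + (size a + size c) * b0) + 1"
    using Plus by (intro int_size_add_le) (auto simp: distrib_right)
  then show ?case using assms(4) by (simp add: distrib_right)
next
  case (Minus a c)
  have "int_size (aval a s - aval c s) \<le> (b + (size a + size c) * b0) + 1"
    using Minus by (intro int_size_add_le) (auto simp: distrib_right)
  then show ?case using assms(4) by (simp add: distrib_right)
next
  case (Times a c)
  then have "int_size (aval c s) \<le> b0" using assms(5) by auto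
  then show ?case
    using Times int_size_mult_le[of "aval a s" "aval c s"] by (simp add: distrib_right)
next
  case (Div a c)
  then show ?case using int_size_div_le[of "aval a s" "aval c s"] by (simp add: distrib_right)
qed

subsection \<open>Polynomial running time\<close>

text \<open>The argument of the polynomial is the number of passes of a loop, and its value counts
  units of input length by which values may grow. Conditionals add both branches in place of a
  maximum; the \<open>3\<close> in a loop pays for incrementing the counter.\<close>

fun growth :: "lprog \<Rightarrow> nat poly" where
  "growth LSkip = 0"
| "growth (LAssign x i a) = [:size a:]"
| "growth (LSeq p q) = growth p + growth q"
| "growth (LCond b p q) = growth p + growth q"
| "growth (LFor i p) = [:1:] + [:0, 1:] * (growth p + [:3:])"

text \<open>To be multiplied by the bound on the lengths of values at the end of the program. Both
  constants \<open>20\<close> in a loop are generous: one covers a pass without its body, the other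
  the initial assignment and the last test.\<close>

fun time_coeff :: "lprog \<Rightarrow> nat poly" where
  "time_coeff LSkip = 1"
| "time_coeff (LAssign x i a) = [:cost_coeff i + cost_coeff a + 1:]"
| "time_coeff (LSeq p q) = time_coeff p + time_coeff q"
| "time_coeff (LCond b p q) = [:bcost_coeff b + 1:] + time_coeff p + time_coeff q"
| "time_coeff (LFor i p) = [:20:] + [:0, 1:] * (time_coeff p + [:20:])"

lemma poly_nat_mono:
  fixes p :: "nat poly"
  assumes "x \<le> y"
  shows "poly p x \<le> poly p y"
  by (induction p) (auto intro!: add_mono mult_mono assms)

lemma bounded_store_mono: "bounded_store b s \<Longrightarrow> b \<le> b' \<Longrightarrow> bounded_store b' s"
  by (auto simp: bounded_store_def intro: le_trans)

lemma bounded_set_cell: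
  "bounded_store b s \<Longrightarrow> int_size v \<le> b \<Longrightarrow> bounded_store b (set_cell x i v s)"
  by (auto simp: bounded_store_def set_cell_def)

text \<open>\<open>b\<close> bounds all values and increases along the run, whereas
  \<open>b0\<close> bounds only the read-only arrays and never changes. In a sequence the second
  program is therefore entered with a larger \<open>b\<close> but the same unit \<open>b0\<close> of
  growth.\<close>

lemma exec_compile:
  assumes "wf_prog p" "bounded_store b s" "2 \<le> b" "1 \<le> b0" "s ''size'' 0 = int n"
    "\<And>x i. x \<in> read_only \<Longrightarrow> int_size (s x i) \<le> b0"
  shows "\<exists>t. exec (compile p) s t (sem p s) \<and>
      t \<le> poly (time_coeff p) n * (b + poly (growth p) n * b0) \<and>
      bounded_store (b + poly (growth p) n * b0) (sem p s)"
  using assms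
proof (induction p arbitrary: b s)
  case LSkip
  have "exec (compile LSkip) s 1 (sem LSkip s)" using exec_SKIP by simp
  then show ?case using LSkip.prems by (intro exI[of _ 1]) auto
next
  case (LAssign x i a)
  have v: "int_size (aval a s) \<le> b + size a * b0"
    using LAssign.prems by (intro slow_growth) auto
  have "bounded_store (b + size a * b0) (set_cell x (aval i s) (aval a s) s)"
    using LAssign.prems v by (intro bounded_set_cell) (auto intro: bounded_store_mono)
  moreover have "acost i s + acost a s + 1 \<le> (cost_coeff i + cost_coeff a + 1) * b"
    using acost_le[of b s i] acost_le[of b s a] LAssign.prems by (simp add: distrib_right)
  then have "acost i s + acost a s + 1 \<le> (cost_coeff i + cost_coeff a + 1) * (b + size a * b0)"
    by (rule le_trans) (intro mult_mono, auto)
  moreover have "exec (compile (LAssign x i a)) s (acost i s + acost a s + 1) (sem (LAssign x i a) s)"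
    using exec_Assign[of x i a s] by (simp add: set_cell_def)
  ultimately show ?case by auto
next
  case (LSeq p q)
  obtain t where t: "exec (compile p) s t (sem p s)"
    "t \<le> poly (time_coeff p) n * (b + poly (growth p) n * b0)"
    "bounded_store (b + poly (growth p) n * b0) (sem p s)"
    using LSeq.IH(1)[of b s] LSeq.prems by auto
  have ro: "sem p s x = s x" if "x \<in> read_only" for x
    using wf_writes[of p] LSeq.prems that by (intro sem_not_written) auto
  have "''size'' \<in> read_only" by (simp add: read_only_def)
  then have "sem p s ''size'' 0 = int n" using ro LSeq.prems by simp
  then obtain u where u: "exec (compile q) (sem p s) u (sem q (sem p s))"
    "u \<le> poly (time_coeff q) n * (b + poly (growth p) n * b0 + poly (growth q) n * b0)"
    "bounded_store (b + poly (growth p) n * b0 + poly (growth q) n * b0) (sem q (sem p s))"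
    using LSeq.IH(2)[of "b + poly (growth p) n * b0" "sem p s"] LSeq.prems t ro by auto
  have eq: "b + poly (growth (LSeq p q)) n * b0
      = b + poly (growth p) n * b0 + poly (growth q) n * b0" by (simp add: distrib_right)
  have "t \<le> poly (time_coeff p) n * (b + poly (growth p) n * b0 + poly (growth q) n * b0)"
    using t(2) by (rule le_trans) simp
  then have "t + u \<le> poly (time_coeff (LSeq p q)) n * (b + poly (growth (LSeq p q)) n * b0)"
    unfolding eq using u(2) by (simp add: distrib_right)
  moreover have "exec (compile (LSeq p q)) s (t + u) (sem (LSeq p q) s)"
    using exec_Seq[OF t(1) u(1)] by simp
  ultimately show ?case using u(3) eq by (metis sem.simps(3))
next
  case (LCond e p q)
  let ?G = "b + poly (growth (LCond e p q)) n * b0"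
  have "bcost e s \<le> bcost_coeff e * b" using LCond.prems by (intro bcost_le) auto
  also have "\<dots> \<le> bcost_coeff e * ?G" by (intro mult_mono) auto
  finally have bc: "bcost e s \<le> bcost_coeff e * ?G" .
  have one: "1 \<le> ?G" using LCond.prems by simp
  show ?case
  proof (cases "bval e s")
    case True
    obtain t where t: "exec (compile p) s t (sem p s)"
      "t \<le> poly (time_coeff p) n * (b + poly (growth p) n * b0)"
      "bounded_store (b + poly (growth p) n * b0) (sem p s)"
      using LCond.IH(1)[of b s] LCond.prems by auto
    have "t \<le> poly (time_coeff p) n * ?G"
      using t(2) by (rule le_trans) (intro mult_mono, auto simp: distrib_right)
    then have "bcost e s + t + 1 \<le> poly (time_coeff (LCond e p q)) n * ?G"
      using bc one by (simp add: distrib_right del: growth.simps)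
    moreover have "bounded_store ?G (sem p s)"
      using t(3) by (rule bounded_store_mono) (simp add: distrib_right)
    moreover have "exec (compile (LCond e p q)) s (bcost e s + t + 1) (sem (LCond e p q) s)"
      using exec_CondTrue[OF True t(1)] True by simp
    ultimately show ?thesis using True by (metis sem.simps(4))
  next
    case False
    obtain t where t: "exec (compile q) s t (sem q s)"
      "t \<le> poly (time_coeff q) n * (b + poly (growth q) n * b0)"
      "bounded_store (b + poly (growth q) n * b0) (sem q s)"
      using LCond.IH(2)[of b s] LCond.prems by auto
    have "t \<le> poly (time_coeff q) n * ?G"
      using t(2) by (rule le_trans) (intro mult_mono, auto simp: distrib_right)
    then have "bcost e s + t + 1 \<le> poly (time_coeff (LCond e p q)) n * ?G"
      using bc one by (simp add: distrib_right del: growth.simps)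
    moreover have "bounded_store ?G (sem q s)"
      using t(3) by (rule bounded_store_mono) (simp add: distrib_right)
    moreover have "exec (compile (LCond e p q)) s (bcost e s + t + 1) (sem (LCond e p q) s)"
      using exec_CondFalse[OF False t(1)] False by simp
    ultimately show ?thesis using False by (metis sem.simps(4))
  qed
next
  case (LFor i p)
  let ?f = "\<lambda>s. set_cell i 0 (sem p s i 0 + 1) (sem p s)"
  let ?b = "Less (Var i) (Var ''size'')"
  let ?c = "Seq (compile p) (Assign i (Const 0) (Plus (Var i) (Const 1)))"
  let ?g = "poly (growth p) n + 3"
  let ?T = "poly (time_coeff p) n"
  have i: "i \<notin> read_only" "i \<notin> writes p" "wf_prog p" using LFor.prems by auto
  have sz: "''size'' \<in> read_only" by (simp add: read_only_def)
  have i_sz: "i \<noteq> ''size''" using i sz by auto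
  have is01: "int_size 0 \<le> 2" "int_size 1 \<le> 2"
    using int_size_le_iff[of 0 1] int_size_le_iff[of 1 1] by auto
  \<comment> \<open>Induction on the number \<open>m\<close> of remaining passes, so that
    \<open>b\<close> may grow from one pass to the next. In units of the final length a pass costs
    \<open>?T\<close> for the body, 7 for the test, 11 for the increment and 1 for the step; 10
    covers the failing test.\<close>
  have loop: "\<exists>t. exec (While ?b ?c) s t ((?f ^^ m) s) \<and>
      t \<le> (m * (?T + 20) + 10) * (b + m * ?g * b0) \<and> bounded_store (b + m * ?g * b0) ((?f ^^ m) s)"
    if "bounded_store b s" "2 \<le> b" "s i 0 = int (n - m)" "m \<le> n" "s ''size'' 0 = int n"
      "\<And>x i. x \<in> read_only \<Longrightarrow> int_size (s x i) \<le> b0" for m b s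
    using that
  proof (induction m arbitrary: b s)
    case 0
    have "bcost ?b s \<le> bcost_coeff ?b * b" using 0 by (intro bcost_le) auto
    also have "\<dots> \<le> 9 * b" using is01 by simp
    finally have "bcost ?b s + 1 \<le> 10 * b" using 0 by simp
    moreover have "exec (While ?b ?c) s (bcost ?b s + 1) s"
      using 0 by (intro exec_WhileFalse) simp
    ultimately show ?case using 0 by auto
  next
    case (Suc m)
    let ?b1 = "b + poly (growth p) n * b0" and ?b2 = "b + ?g * b0"
    obtain t where t: "exec (compile p) s t (sem p s)" "t \<le> ?T * ?b1" "bounded_store ?b1 (sem p s)"
      using LFor.IH[of b s] i Suc.prems LFor.prems(4) by auto
    have ro: "sem p s x = s x" if "x \<in> read_only" for x
      using wf_writes[of p] i that by (intro sem_not_written) auto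
    have ival: "sem p s i = s i" using i by (intro sem_not_written)
    let ?a = "Plus (Var i) (Const 1)"
    have asg: "exec (Assign i (Const 0) ?a) (sem p s)
        (acost (Const 0) (sem p s) + acost ?a (sem p s) + 1) (?f s)"
      using exec_Assign[of i "Const 0" ?a "sem p s"] by (simp add: set_cell_def)
    define u where "u = acost (Const 0) (sem p s) + acost ?a (sem p s) + 1"
    have "acost (Const 0) (sem p s) \<le> 2 * ?b1" "acost ?a (sem p s) \<le> cost_coeff ?a * ?b1"
      using is01 Suc.prems t(3) acost_le[of ?b1 "sem p s" ?a] by auto
    moreover have "cost_coeff ?a * ?b1 \<le> 8 * ?b1" using is01 by (intro mult_right_mono) auto
    ultimately have u: "u \<le> 11 * ?b1" using Suc.prems by (simp add: u_def del: acost.simps cost_coeff.simps)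
    have "int_size (aval ?a (sem p s)) \<le> ?b1 + size ?a * b0"
      using t(3) Suc.prems LFor.prems(4) ro by (intro slow_growth) auto
    then have "bounded_store (?b1 + 3 * b0) (?f s)"
      using t(3) by (intro bounded_set_cell) (auto intro: bounded_store_mono)
    then have bs: "bounded_store ?b2 (?f s)" by (simp add: distrib_right add.assoc)
    have "bcost ?b s \<le> bcost_coeff ?b * b" using Suc by (intro bcost_le) auto
    also have "\<dots> \<le> 7 * b" using is01 by simp
    finally have bc: "bcost ?b s \<le> 7 * b" .
    have fi: "?f s i 0 = int (n - m)" using ival Suc.prems by simp
    have fs: "?f s ''size'' 0 = int n" using ro[OF sz] Suc.prems i_sz by simp
    have fro: "int_size (?f s x j) \<le> b0" if "x \<in> read_only" for x j
      using ro[OF that] Suc.prems(6)[OF that] i(1) that by (metis set_cell_other)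
    obtain v where v: "exec (While ?b ?c) (?f s) v ((?f ^^ m) (?f s))"
      "v \<le> (m * (?T + 20) + 10) * (?b2 + m * ?g * b0)"
      "bounded_store (?b2 + m * ?g * b0) ((?f ^^ m) (?f s))"
      using Suc.IH[of ?b2 "?f s", OF bs _ fi _ fs fro] Suc.prems by auto
    have eq: "b + Suc m * ?g * b0 = ?b2 + m * ?g * b0" by (simp add: distrib_right)
    have pow: "(?f ^^ Suc m) s = (?f ^^ m) (?f s)" by (simp only: funpow_Suc_right o_apply)
    have "bval ?b s" using Suc.prems by simp
    from exec_WhileTrue[OF this exec_Seq[OF t(1) asg] v(1)]
    have ex: "exec (While ?b ?c) s (bcost ?b s + (t + u) + v + 1) ((?f ^^ Suc m) s)"
      by (simp only: u_def pow)
    let ?B = "?b2 + m * ?g * b0"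
    have "b \<le> ?B" "?b1 \<le> ?B" by (auto simp: distrib_right)
    then have "bcost ?b s \<le> 7 * ?B" "t \<le> ?T * ?B" "u \<le> 11 * ?B" "1 \<le> ?B"
      using bc t(2) u Suc.prems(2) le_trans[OF t(2) mult_le_mono2] by auto
    moreover have "x + (t + u) + v + 1 \<le> (T + 20) * B + C * B"
      if "x \<le> 7 * B" "t \<le> T * B" "u \<le> 11 * B" "1 \<le> B" "v \<le> C * B"
      for x t u v T C B :: nat using that by (simp add: distrib_right)
    ultimately have "bcost ?b s + (t + u) + v + 1 \<le> (?T + 20) * ?B + (m * (?T + 20) + 10) * ?B"
      using v(2) by blast
    also have "\<dots> = (Suc m * (?T + 20) + 10) * ?B" by (simp only: distrib_right mult_Suc add.assoc)
    finally show ?case using ex v(3) unfolding eq pow by blast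
  qed
  let ?s = "set_cell i 0 0 s"
  have "exec (Assign i (Const 0) (Const 0)) s (acost (Const 0) s + acost (Const 0) s + 1) ?s"
    using exec_Assign[of i "Const 0" "Const 0" s] by (simp add: set_cell_def)
  moreover define u where "u = acost (Const 0) s + acost (Const 0) s + 1"
  ultimately have asg: "exec (Assign i (Const 0) (Const 0)) s u ?s" by simp
  have "\<exists>t. exec (While ?b ?c) ?s t ((?f ^^ n) ?s) \<and>
      t \<le> (n * (?T + 20) + 10) * (b + n * ?g * b0) \<and> bounded_store (b + n * ?g * b0) ((?f ^^ n) ?s)"
  proof (rule loop)
    show "bounded_store b ?s" using LFor.prems is01 by (intro bounded_set_cell) auto
    show "int_size (?s x j) \<le> b0" if "x \<in> read_only" for x j
      using LFor.prems(6)[OF that] i that by (metis set_cell_other)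
  qed (use LFor.prems i_sz in auto)
  then obtain t where t: "exec (While ?b ?c) ?s t ((?f ^^ n) ?s)"
    "t \<le> (n * (?T + 20) + 10) * (b + n * ?g * b0)"
    "bounded_store (b + n * ?g * b0) ((?f ^^ n) ?s)" by blast
  let ?B = "b + poly (growth (LFor i p)) n * b0"
  have le: "b + n * ?g * b0 \<le> ?B" by (simp add: algebra_simps)
  have "u \<le> 5" using is01 by (simp add: u_def)
  then have u: "u \<le> 10 * ?B" using LFor.prems by (simp del: growth.simps)
  have "t \<le> (n * (?T + 20) + 10) * ?B" using t(2) le by (meson le_trans mult_le_mono2)
  then have "u + t \<le> poly (time_coeff (LFor i p)) n * ?B"
    using u by (simp add: distrib_right del: growth.simps)
  moreover have "exec (compile (LFor i p)) s (u + t) (sem (LFor i p) s)"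
    using exec_Seq[OF asg t(1)] LFor.prems by simp
  moreover have "bounded_store ?B (sem (LFor i p) s)"
    using bounded_store_mono[OF t(3) le] LFor.prems by simp
  ultimately show ?case by blast
qed

section \<open>Merging the components of a permutation\<close>

text \<open>Labels are themselves numbers below \<open>n\<close>, so arrays over labels are
  traversed by the same loops as arrays over vertices.\<close>

definition consistent :: "nat \<Rightarrow> (nat \<Rightarrow> nat) \<Rightarrow> (nat \<Rightarrow> nat) \<Rightarrow> bool" where
  "consistent n \<sigma> cp \<longleftrightarrow> \<sigma> permutes {..<n} \<and> (\<forall>u<n. cp u < n) \<and>
     (\<forall>u<n. \<forall>v<n. cp u = cp v \<longleftrightarrow> v \<in> orbit \<sigma> u)"

definition active :: "nat \<Rightarrow> (nat \<Rightarrow> nat) \<Rightarrow> (nat \<Rightarrow> nat) \<Rightarrow> nat set" where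
  "active n tm cp = {cp u |u v. u < n \<and> v < n \<and> tm u = tm v \<and> cp u \<noteq> cp v}"

definition merge_labels :: "nat \<Rightarrow> nat \<Rightarrow> (nat \<Rightarrow> nat) \<Rightarrow> nat \<Rightarrow> nat" where
  "merge_labels a b cp v = (if cp v = cp b then cp a else cp v)"

text \<open>The transpositions come in the order in which \<open>cycle_of_list\<close> unfolds on
  \<open>vs j, ..., vs 0\<close>, so their product is that single cycle, although every step merges
  just two orbits.\<close>

fun merges :: "(nat \<Rightarrow> nat) \<Rightarrow> nat \<Rightarrow> (nat \<Rightarrow> nat) \<times> (nat \<Rightarrow> nat) \<Rightarrow> (nat \<Rightarrow> nat) \<times> (nat \<Rightarrow> nat)" where
  "merges vs 0 st = st"
| "merges vs (Suc j) st = (Transposition.transpose (vs (Suc j)) (vs j) \<circ> fst (merges vs j st),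
     merge_labels (vs (Suc j)) (vs j) (snd (merges vs j st)))"

lemma permutes_lessThan: "f permutes {..<n} \<Longrightarrow> f x < n \<longleftrightarrow> x < (n :: nat)"
  by (metis lessThan_iff permutes_in_image)

lemma active_subset: "\<forall>u<n. cp u < n \<Longrightarrow> active n tm cp \<subseteq> {..<n}"
  by (auto simp: active_def)

lemma consistent_merge:
  assumes cons: "consistent n \<sigma> cp" and ab: "a < n" "b < n" "cp a \<noteq> cp b"
  shows "consistent n (Transposition.transpose a b \<circ> \<sigma>) (merge_labels a b cp)"
proof -
  have \<sigma>: "\<sigma> permutes {..<n}" and cp: "\<And>u. u < n \<Longrightarrow> cp u < n"
    and orb: "\<And>u v. u < n \<Longrightarrow> v < n \<Longrightarrow> v \<in> orbit \<sigma> u \<longleftrightarrow> cp u = cp v"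
    using cons by (auto simp: consistent_def)
  have p\<sigma>: "permutation \<sigma>" using \<sigma> permutation_permutes by blast
  have "b \<notin> orbit \<sigma> a" using orb ab by simp
  note orbit = orbit_transpose_comp[OF p\<sigma> this]
  have "Transposition.transpose a b \<circ> \<sigma> permutes {..<n}"
    using \<sigma> ab by (intro permutes_compose permutes_swap_id) auto
  moreover have "merge_labels a b cp u < n" if "u < n" for u
    using cp ab that by (simp add: merge_labels_def)
  moreover have "merge_labels a b cp u = merge_labels a b cp v
      \<longleftrightarrow> v \<in> orbit (Transposition.transpose a b \<circ> \<sigma>) u" if "u < n" "v < n" for u v
    unfolding orbit using orb that ab by (auto simp: merge_labels_def)
  ultimately show ?thesis unfolding consistent_def by blast
qed

text \<open>Two vertices with different labels after the merge had different labels before. The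
  superset \<open>X\<close> makes the lemma iterable: the surviving label \<open>cp a\<close> may
  cease to be active on the way, but it stays in the set of labels active at the beginning.\<close>

lemma active_merge:
  assumes "active n tm cp \<subseteq> X" "cp a \<in> X" "cp a \<noteq> cp b"
  shows "active n tm (merge_labels a b cp) \<subseteq> X - {cp b}"
proof
  fix l assume "l \<in> active n tm (merge_labels a b cp)"
  then obtain u v where uv: "u < n" "v < n" "tm u = tm v" "l = merge_labels a b cp u"
    "merge_labels a b cp u \<noteq> merge_labels a b cp v" by (auto simp: active_def)
  show "l \<in> X - {cp b}"
  proof (cases "cp u = cp b")
    case True
    then show ?thesis using assms uv by (simp add: merge_labels_def)
  next
    case False
    then have "l = cp u" using uv by (simp add: merge_labels_def)
    moreover have "cp u \<noteq> cp v" using uv False by (auto simp: merge_labels_def)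
    then have "cp u \<in> active n tm cp" using uv by (auto simp: active_def)
    ultimately show ?thesis using assms False by auto
  qed
qed

text \<open>Every merge keeps the label of the vertex that is added last. So the labels of
  \<open>vs 0, ..., vs (j - 1)\<close> vanish one after the other, and those of the vertices still
  to come are untouched.\<close>

lemma merges_correct:
  assumes cons: "consistent n \<sigma> cp"
    and vs: "\<And>i. i \<le> J \<Longrightarrow> vs i < n" "\<And>i. i \<le> J \<Longrightarrow> cp (vs i) \<in> active n tm cp"
    and inj: "inj_on (cp \<circ> vs) {..J}"
    and j: "j \<le> J"
  shows "consistent n (fst (merges vs j (\<sigma>, cp))) (snd (merges vs j (\<sigma>, cp)))"
    and "fst (merges vs j (\<sigma>, cp)) = cycle_of_list (rev (map vs [0..<Suc j])) \<circ> \<sigma>"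
    and "active n tm (snd (merges vs j (\<sigma>, cp))) \<subseteq> active n tm cp - (cp \<circ> vs) ` {..<j}"
proof -
  let ?cp = "\<lambda>j. snd (merges vs j (\<sigma>, cp))" and ?\<sigma> = "\<lambda>j. fst (merges vs j (\<sigma>, cp))"
  have inj': "cp (vs i) \<noteq> cp (vs i')" if "i < i'" "i' \<le> J" for i i'
    using inj that by (auto dest: inj_onD[of _ _ i i'])
  have "consistent n (?\<sigma> j) (?cp j) \<and> ?\<sigma> j = cycle_of_list (rev (map vs [0..<Suc j])) \<circ> \<sigma> \<and>
      active n tm (?cp j) \<subseteq> active n tm cp - (cp \<circ> vs) ` {..<j} \<and>
      ?cp j (vs j) = cp (vs j) \<and> (\<forall>i. j < i \<and> i \<le> J \<longrightarrow> ?cp j (vs i) = cp (vs i))"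
    using j
  proof (induction j)
    case 0
    then show ?case using cons by simp
  next
    case (Suc j)
    then have IH: "consistent n (?\<sigma> j) (?cp j)"
      "?\<sigma> j = cycle_of_list (rev (map vs [0..<Suc j])) \<circ> \<sigma>"
      "active n tm (?cp j) \<subseteq> active n tm cp - (cp \<circ> vs) ` {..<j}"
      "?cp j (vs j) = cp (vs j)" "\<And>i. j < i \<Longrightarrow> i \<le> J \<Longrightarrow> ?cp j (vs i) = cp (vs i)"
      by auto
    have a: "?cp j (vs (Suc j)) = cp (vs (Suc j))" using IH(5) Suc.prems by simp
    have ne: "?cp j (vs (Suc j)) \<noteq> ?cp j (vs j)" using a IH(4) inj'[of j "Suc j"] Suc.prems by simp
    have "consistent n (?\<sigma> (Suc j)) (?cp (Suc j))"
      using consistent_merge[OF IH(1) _ _ ne] vs Suc.prems by simp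
    moreover have "?\<sigma> (Suc j) = cycle_of_list (rev (map vs [0..<Suc (Suc j)])) \<circ> \<sigma>"
      by (simp add: IH(2) comp_assoc)
    moreover have "active n tm (?cp (Suc j)) \<subseteq> active n tm cp - (cp \<circ> vs) ` {..<Suc j}"
    proof -
      have "cp (vs (Suc j)) \<notin> (cp \<circ> vs) ` {..<j}"
      proof
        assume "cp (vs (Suc j)) \<in> (cp \<circ> vs) ` {..<j}"
        then obtain i where "i < j" "cp (vs (Suc j)) = cp (vs i)" by auto
        then show False using inj'[of i "Suc j"] Suc.prems by simp
      qed
      then have "?cp j (vs (Suc j)) \<in> active n tm cp - (cp \<circ> vs) ` {..<j}"
        using a vs Suc.prems by simp
      from active_merge[OF IH(3) this ne] IH(4) show ?thesis by (auto simp: lessThan_Suc)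
    qed
    moreover have "?cp (Suc j) (vs (Suc j)) = cp (vs (Suc j))"
      using a ne by (simp add: merge_labels_def)
    moreover have "?cp (Suc j) (vs i) = cp (vs i)" if "Suc j < i" "i \<le> J" for i
      using IH(4) IH(5)[of i] inj'[of j i] that by (simp add: merge_labels_def)
    ultimately show ?case by blast
  qed
  then show "consistent n (?\<sigma> j) (?cp j)" "?\<sigma> j = cycle_of_list (rev (map vs [0..<Suc j])) \<circ> \<sigma>"
    "active n tm (?cp j) \<subseteq> active n tm cp - (cp \<circ> vs) ` {..<j}" by auto
qed

section \<open>One round of the algorithm\<close>

text \<open>\<open>f\<close> is a competitor whose orbits contain whole terminal sets; it will be an
  optimal 2-factor.\<close>

locale merge_round =
  asym_metric "{..<n}" c for n :: nat and c :: "nat \<Rightarrow> nat \<Rightarrow> real" +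
  fixes tm \<sigma> cp rp mate f :: "nat \<Rightarrow> nat"
  assumes cons: "consistent n \<sigma> cp"
    and rp: "\<And>l. l \<in> active n tm cp \<Longrightarrow> rp l < n \<and> cp (rp l) = l"
    and mate: "\<And>l. l \<in> active n tm cp \<Longrightarrow> mate l < n \<and> tm (mate l) = tm (rp l) \<and> cp (mate l) \<noteq> l"
    and f: "f permutes {..<n}"
    and f_respects: "\<And>u v. u < n \<Longrightarrow> v < n \<Longrightarrow> tm u = tm v \<Longrightarrow> v \<in> orbit f u"
begin

abbreviation "A \<equiv> active n tm cp"

abbreviation weight :: "(nat \<Rightarrow> nat) \<Rightarrow> real" where
  "weight g \<equiv> \<Sum>v<n. c v (g v)"

lemma A_subset: "A \<subseteq> {..<n}"
  using cons by (intro active_subset) (auto simp: consistent_def)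

lemma finite_active: "finite A"
  using A_subset finite_subset by blast

text \<open>Splitting is symmetric: a terminal set split by the orbit of the representative is also
  split by that of the mate.\<close>

lemma cp_mate: "l \<in> A \<Longrightarrow> cp (mate l) \<in> A"
  using rp[of l] mate[of l] by (auto simp: active_def) metis

text \<open>Of \<open>J + 1\<close> merged labels one survives. The cycle that is added runs down
  from \<open>vs J\<close> to \<open>vs 0\<close> and back, hence the direction of the arcs in the
  bound.\<close>

lemma merges_weight:
  assumes vs: "\<And>i. i \<le> J \<Longrightarrow> vs i < n" "\<And>i. i \<le> J \<Longrightarrow> cp (vs i) \<in> A"
    and inj: "inj_on (cp \<circ> vs) {..J}"
  defines "\<sigma>' \<equiv> fst (merges vs J (\<sigma>, cp))" and "cp' \<equiv> snd (merges vs J (\<sigma>, cp))"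
  shows "consistent n \<sigma>' cp'" "card (active n tm cp') + J \<le> card A"
    "weight \<sigma>' \<le> weight \<sigma> + (\<Sum>i<J. c (vs (Suc i)) (vs i)) + c (vs 0) (vs J)"
proof -
  note m = merges_correct[OF cons vs inj order_refl, folded \<sigma>'_def cp'_def]
  show "consistent n \<sigma>' cp'" using m(1) vs by blast
  have sub: "active n tm cp' \<subseteq> A - (cp \<circ> vs) ` {..<J}" using m(3) vs by blast
  have im: "(cp \<circ> vs) ` {..<J} \<subseteq> A" using vs by auto
  have card: "card ((cp \<circ> vs) ` {..<J}) = J"
    using card_image[OF inj_on_subset[OF inj, of "{..<J}"]] by (simp add: lessThan_subset_iff subset_eq)
  have "card (active n tm cp') \<le> card (A - (cp \<circ> vs) ` {..<J})"
    using sub finite_active by (intro card_mono) auto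
  also have "\<dots> = card A - J"
    using card_Diff_subset[OF _ im] card by simp
  finally show "card (active n tm cp') + J \<le> card A"
    using card_mono[OF finite_active im] card by simp
  define xs where "xs = rev (map vs [0..<Suc J])"
  have len: "length xs = Suc J" by (simp add: xs_def)
  have nth: "xs ! i = vs (J - i)" if "i \<le> J" for i
    using that by (simp add: xs_def rev_nth del: upt_Suc)
  have injv: "inj_on vs {..J}" using inj by (rule inj_on_imageI2)
  have "distinct xs" unfolding xs_def using injv by (simp add: distinct_map atLeast0AtMost[symmetric] atLeastLessThanSuc_atLeastAtMost del: upt_Suc)
  moreover have "set xs \<subseteq> {..<n}" using vs by (auto simp: xs_def)
  ultimately have "weight (cycle_of_list xs) = (\<Sum>i<Suc J. c (xs ! i) (xs ! (Suc i mod Suc J)))"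
    unfolding len[symmetric] by (rule weight_cycle_of_list)
  also have "\<dots> = (\<Sum>i<J. c (xs ! i) (xs ! (Suc i))) + c (xs ! J) (xs ! 0)" by simp
  also have "\<dots> = (\<Sum>i<J. c (vs (Suc (J - Suc i))) (vs (J - Suc i))) + c (vs 0) (vs J)"
    by (simp add: nth Suc_diff_Suc)
  also have "\<dots> = (\<Sum>i<J. c (vs (Suc i)) (vs i)) + c (vs 0) (vs J)"
    using sum.nat_diff_reindex[of "\<lambda>i. c (vs (Suc i)) (vs i)" J] by simp
  finally have w: "weight (cycle_of_list xs) = (\<Sum>i<J. c (vs (Suc i)) (vs i)) + c (vs 0) (vs J)" .
  have "cycle_of_list xs permutes {..<n}"
    using cycle_permutes[of xs] \<open>set xs \<subseteq> {..<n}\<close> by (rule permutes_subset)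
  then have "weight (cycle_of_list xs \<circ> \<sigma>) \<le> weight \<sigma> + weight (cycle_of_list xs)"
    using cons by (intro weight_comp_le) (auto simp: consistent_def)
  then show "weight \<sigma>' \<le> weight \<sigma> + (\<Sum>i<J. c (vs (Suc i)) (vs i)) + c (vs 0) (vs J)"
    using m(2) w vs by (simp add: xs_def del: upt_Suc)
qed

text \<open>In the label graph a loop stands for the 2-cycle through the mate.\<close>

definition W :: "nat \<Rightarrow> nat \<Rightarrow> real" where
  "W l l' = (if l = l' then c (rp l) (mate l) + c (mate l) (rp l) else c (rp l) (rp l'))"

context
  fixes D :: "nat \<Rightarrow> nat \<Rightarrow> nat \<Rightarrow> real" and k u :: nat
  assumes min_plus: "min_plus A D"
    and D0: "\<And>l l'. l \<in> A \<Longrightarrow> l' \<in> A \<Longrightarrow> D 0 l l' = W l l'"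
    and u: "u \<in> A"
    and best: "\<And>l j. l \<in> A \<Longrightarrow> j < n \<Longrightarrow> D k u u * real (Suc j) \<le> D j l l * real (Suc k)"
begin

text \<open>The permutation of the labels obtained from \<open>f\<close> has \<open>card A\<close>
  arcs and weighs at most as much as \<open>f\<close>; its average arc is no lighter than the
  minimum mean.\<close>

lemma best_mean_le: "D k u u * real (card A) \<le> real (Suc k) * weight f"
proof -
  interpret M: min_plus A D by (rule min_plus)
  obtain r where r: "r permutes A"
    "(\<Sum>l\<in>A. if r l = l then c (rp l) (mate l) + c (mate l) (rp l) else c (rp l) (rp (r l)))
      \<le> weight f"
  proof (rule label_permutation_le[OF f, of A rp cp mate])
    show "rp l \<in> {..<n} \<and> cp (rp l) = l" if "l \<in> A" for l using rp that by simp
    show "mate l \<in> orbit f (rp l) \<and> cp (mate l) \<noteq> l" if "l \<in> A" for l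
      using rp[OF that] mate[OF that] f_respects by simp
  qed
  have "D k u u / real (Suc k) * real (card A) \<le> (\<Sum>l\<in>A. D 0 l (r l))"
  proof (rule M.mean_le_weight[OF r(1)])
    fix l j assume "l \<in> A" "j < card A"
    then have "D k u u * real (Suc j) \<le> D j l l * real (Suc k)"
      using card_mono[OF _ A_subset] by (intro best) auto
    then show "D k u u / real (Suc k) * real (Suc j) \<le> D j l l"
      by (simp add: pos_divide_le_eq)
  qed
  also have "\<dots> = (\<Sum>l\<in>A. if r l = l then c (rp l) (mate l) + c (mate l) (rp l)
      else c (rp l) (rp (r l)))"
    using r(1) by (intro sum.cong) (auto simp: D0 W_def permutes_in_image)
  also note r(2)
  finally show ?thesis by (simp add: divide_le_eq mult.commute)
qed

text \<open>The loop at \<open>u\<close> is the 2-cycle through its mate; merging along it spends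
  one arc of the label graph and removes one label. The factor 2 matches the bound for longer
  cycles.\<close>

lemma merge_loop:
  assumes "k = 0" "vs 0 = mate u" "vs 1 = rp u"
  defines "\<sigma>' \<equiv> fst (merges vs 1 (\<sigma>, cp))" and "cp' \<equiv> snd (merges vs 1 (\<sigma>, cp))"
  shows "consistent n \<sigma>' cp'" "card (active n tm cp') + 1 \<le> card A"
    "(weight \<sigma>' - weight \<sigma>) * real (card A) \<le> 2 * real 1 * weight f"
proof -
  have vs: "vs i < n" "cp (vs i) \<in> A" if "i \<le> 1" for i
    using that assms(2,3) rp[OF u] mate[OF u] cp_mate[OF u] u
    by (auto simp: le_Suc_eq)
  have inj: "inj_on (cp \<circ> vs) {..1}"
    using assms(2,3) rp[OF u] mate[OF u] by (auto simp: inj_on_def le_Suc_eq)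
  note m = merges_weight[OF vs inj, folded \<sigma>'_def cp'_def]
  show "consistent n \<sigma>' cp'" "card (active n tm cp') + 1 \<le> card A" using m(1,2) by auto
  have "weight \<sigma>' - weight \<sigma> \<le> D k u u"
    using m(3) assms(1-3) D0[OF u u] by (simp add: W_def)
  then have "(weight \<sigma>' - weight \<sigma>) * real (card A) \<le> D k u u * real (card A)"
    by (intro mult_right_mono) auto
  also have "\<dots> \<le> weight f" using best_mean_le assms(1) by simp
  also have "\<dots> \<le> 2 * real 1 * weight f"
    using f by (simp, intro sum_nonneg nonneg) (auto simp: permutes_lessThan)
  finally show "(weight \<sigma>' - weight \<sigma>) * real (card A) \<le> 2 * real 1 * weight f" .
qed

text \<open>Here \<open>k + 1\<close> arcs pay for the removal of \<open>k\<close> labels, and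
  \<open>k + 1 <= 2 * k\<close> because \<open>k\<close> is positive. A vertex repeated on the walk
  would spoil the merge, which is why \<open>first\<close> is assumed.\<close>

lemma merge_cycle:
  assumes k: "0 < k" and bt0: "bt 0 = u" and btA: "\<And>i. i \<le> k \<Longrightarrow> bt i \<in> A"
    and bt_step: "\<And>i. i < k \<Longrightarrow>
      D (k - i) u (bt i) = D (k - Suc i) u (bt (Suc i)) + D 0 (bt (Suc i)) (bt i)"
    and first: "\<And>l j. l \<in> A \<Longrightarrow> j < k \<Longrightarrow> D k u u * real (Suc j) < D j l l * real (Suc k)"
    and vs: "\<And>i. i \<le> k \<Longrightarrow> vs i = rp (bt i)"
  defines "\<sigma>' \<equiv> fst (merges vs k (\<sigma>, cp))" and "cp' \<equiv> snd (merges vs k (\<sigma>, cp))"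
  shows "consistent n \<sigma>' cp'" "card (active n tm cp') + k \<le> card A"
    "(weight \<sigma>' - weight \<sigma>) * real (card A) \<le> 2 * real k * weight f"
proof -
  interpret M: min_plus A D by (rule min_plus)
  have inj_bt: "inj_on bt {..k}"
    by (rule M.inj_on_backtrack[OF bt0 btA bt_step first]) auto
  have cp_vs: "cp (vs i) = bt i" if "i \<le> k" for i using vs rp btA that by simp
  have inj: "inj_on (cp \<circ> vs) {..k}"
    using inj_bt cp_vs by (simp add: inj_on_def)
  have vs': "vs i < n" "cp (vs i) \<in> A" if "i \<le> k" for i
    using that vs rp btA cp_vs by auto
  note m = merges_weight[OF vs' inj, folded \<sigma>'_def cp'_def]
  show "consistent n \<sigma>' cp'" "card (active n tm cp') + k \<le> card A" using m(1,2) by auto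
  have W_bt: "D 0 (bt i) (bt j) = c (vs i) (vs j)" if "i \<le> k" "j \<le> k" "i \<noteq> j" for i j
    using D0 btA that vs inj_bt by (auto simp: W_def dest: inj_onD)
  have "D k u u = D 0 u (bt k) + (\<Sum>i<k. D 0 (bt (Suc i)) (bt i))"
    by (rule M.D_backtrack_weight[OF bt0 btA bt_step]) auto
  also have "\<dots> = c (vs 0) (vs k) + (\<Sum>i<k. c (vs (Suc i)) (vs i))"
    using W_bt[of 0 k] bt0 k by (simp add: W_bt)
  finally have "weight \<sigma>' - weight \<sigma> \<le> D k u u" using m(3) by simp
  then have "(weight \<sigma>' - weight \<sigma>) * real (card A) \<le> D k u u * real (card A)"
    by (intro mult_right_mono) auto
  also have "\<dots> \<le> real (Suc k) * weight f" by (rule best_mean_le)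
  also have "\<dots> \<le> 2 * real k * weight f"
    using f k by (intro mult_right_mono sum_nonneg nonneg) (auto simp: permutes_lessThan)
  finally show "(weight \<sigma>' - weight \<sigma>) * real (card A) \<le> 2 * real k * weight f" .
qed

end

end

section \<open>Harmonic numbers\<close>

lemma harm_diff_ge:
  assumes "m' + p \<le> m"
  shows "real p \<le> real m * (harm m - harm m' :: real)"
proof -
  \<comment> \<open>The \<open>p\<close> summands between the two harmonic numbers are each at least
    \<open>1 / m\<close>. This turns the charge of a round that removes \<open>p\<close> of
    \<open>m\<close> labels into a telescoping difference.\<close>
  have "real p / real m \<le> harm m - harm (m - p)" if "p \<le> m" for p
    using that
  proof (induction p)
    case 0
    then show ?case by simp
  next
    case (Suc p)
    then have "m - p = Suc (m - Suc p)" by simp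
    then have "harm (m - p) = harm (m - Suc p) + 1 / real (m - p)"
      by (metis harm_Suc inverse_eq_divide of_nat_Suc)
    moreover have "1 / real m \<le> 1 / real (m - p)"
      using Suc.prems by (intro divide_left_mono) auto
    ultimately show ?case using Suc by (simp add: add_divide_distrib)
  qed
  then have "real p / real m \<le> harm m - harm (m - p)" using assms by simp
  also have "(harm m' :: real) \<le> harm (m - p)" using assms by (intro harm_mono) auto
  then have "harm m - harm (m - p) \<le> harm m - (harm m' :: real)" by simp
  finally show ?thesis using assms by (cases "m = 0") (simp_all add: divide_le_eq mult.commute)
qed

lemma harm_bigo_log: "(\<lambda>n. 2 * harm n) \<in> O(\<lambda>n. log 2 (real n))"
\<comment> \<open>For \<open>n >= 2\<close> both 1 and \<open>ln n\<close> are at most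
  \<open>log 2 n\<close>, so \<open>2 * harm n <= 4 * log 2 n\<close>; 6 leaves room.\<close>
proof (rule bigoI[of _ 6])
  have "norm (2 * harm n :: real) \<le> 6 * norm (log 2 (real n))" if n: "2 \<le> n" for n
  proof -
    have "harm n - ln (real n) \<le> harm 1 - ln (real 1)"
      using n by (intro euler_mascheroni_sequence_decreasing) auto
    then have "harm n \<le> 1 + ln (real n)" by (simp add: harm_def)
    moreover have l: "ln (real n) \<le> log 2 (real n)"
    proof -
      have "log 2 (real n) * ln 2 = ln (real n)" by (simp add: log_def)
      moreover have "log 2 (real n) * ln 2 \<le> log 2 (real n) * 1"
        using n ln_2_less_1 by (intro mult_left_mono) auto
      ultimately show ?thesis by simp
    qed
    moreover have "1 \<le> log 2 (real n)" using n by simp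
    moreover have "0 \<le> (harm n :: real)" by (rule harm_nonneg)
    ultimately show ?thesis by simp
  qed
  then show "\<forall>\<^sub>F n in at_top. norm (2 * harm n :: real) \<le> 6 * norm (log 2 (real n))"
    using eventually_ge_at_top[of 2] by (rule eventually_mono[rotated]) auto
qed

section \<open>The program\<close>

text \<open>For \<open>k = 0\<close> this is the address of the arc \<open>(u, v)\<close> in the
  input arrays. Larger \<open>k\<close> give further layers of the same shape for the tables
  \<open>D\<close> and \<open>par\<close>.\<close>

definition ix :: "int \<Rightarrow> int \<Rightarrow> int \<Rightarrow> int \<Rightarrow> int" where
  "ix n k u v = (k * n + u) * n + v"

abbreviation N :: aexp where "N \<equiv> Var ''size''"

definition Ix :: "aexp \<Rightarrow> aexp \<Rightarrow> aexp \<Rightarrow> aexp" where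
  "Ix k u v = Plus (Times (Plus (Times k N) u) N) v"

definition BEq :: "aexp \<Rightarrow> aexp \<Rightarrow> bexp" where
  "BEq a b = And (Neg (Less a b)) (Neg (Less b a))"

text \<open>The plain product serves as a common multiple, as its length is at most the sum of the
  lengths of its factors. The test skips the diagonal, whose cells hold 0 and would annihilate the
  product.\<close>

definition denominators_prog :: lprog where
  "denominators_prog = LFor ''u'' (LFor ''v''
     (LCond (Less (Const 0) (Cell ''den'' (Ix (Const 0) (Var ''u'') (Var ''v''))))
        (LAssign ''P'' (Const 0)
           (Times (Var ''P'') (Cell ''den'' (Ix (Const 0) (Var ''u'') (Var ''v'')))))
        LSkip))"

text \<open>The division is exact and comes first, so that the product has the input cell
  \<open>num\<close> as a factor. On the diagonal both input cells are 0, which yields the weight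
  0.\<close>

definition weights_prog :: lprog where
  "weights_prog = LFor ''u'' (LFor ''v''
     (LAssign ''W'' (Ix (Const 0) (Var ''u'') (Var ''v''))
        (Times (Div (Var ''P'') (Cell ''den'' (Ix (Const 0) (Var ''u'') (Var ''v''))))
           (Cell ''num'' (Ix (Const 0) (Var ''u'') (Var ''v''))))))"

definition init_prog :: lprog where
  "init_prog = LFor ''v'' (LSeq (LAssign ''succ'' (Var ''v'') (Var ''v''))
     (LAssign ''cp'' (Var ''v'') (Var ''v'')))"

text \<open>An inactive label is marked by the representative \<open>n\<close>.\<close>

definition clear_prog :: lprog where
  "clear_prog = LFor ''u'' (LAssign ''rp'' (Var ''u'') N)"

text \<open>A later pair with the same label overwrites both entries, so \<open>rp\<close> and
  \<open>mate\<close> always stem from one and the same pair.\<close>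

definition reps_prog :: lprog where
  "reps_prog = LFor ''u'' (LFor ''v''
     (LCond (And (BEq (Cell ''term'' (Var ''u'')) (Cell ''term'' (Var ''v'')))
              (Neg (BEq (Cell ''cp'' (Var ''u'')) (Cell ''cp'' (Var ''v'')))))
        (LSeq (LAssign ''rp'' (Cell ''cp'' (Var ''u'')) (Var ''u''))
           (LAssign ''mate'' (Cell ''cp'' (Var ''u'')) (Var ''v'')))
        LSkip))"

text \<open>Entries of inactive labels are computed from whatever cells \<open>rp\<close> and
  \<open>mate\<close> point to. They do no harm, because paths between active labels are only
  extended through labels with \<open>rp\<close> below \<open>n\<close>.\<close>

definition base_prog :: lprog where
  "base_prog = LFor ''u'' (LFor ''v''
     (LCond (BEq (Var ''u'') (Var ''v''))
        (LAssign ''D'' (Ix (Const 0) (Var ''u'') (Var ''v''))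
           (Plus (Cell ''W'' (Ix (Const 0) (Cell ''rp'' (Var ''u'')) (Cell ''mate'' (Var ''u''))))
              (Cell ''W'' (Ix (Const 0) (Cell ''mate'' (Var ''u'')) (Cell ''rp'' (Var ''u''))))))
        (LAssign ''D'' (Ix (Const 0) (Var ''u'') (Var ''v''))
           (Cell ''W'' (Ix (Const 0) (Cell ''rp'' (Var ''u'')) (Cell ''rp'' (Var ''v'')))))))"

text \<open>Starting the minimum with the candidate \<open>u\<close> avoids a representation of
  infinity. For an active \<open>u\<close> it is one of the regular candidates.\<close>

definition cell_prog :: lprog where
  "cell_prog =
     (let next = Ix (Plus (Var ''k'') (Const 1)) (Var ''u'') (Var ''v'');
          via = (\<lambda>x. Plus (Cell ''D'' (Ix (Var ''k'') (Var ''u'') x))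
                        (Cell ''D'' (Ix (Const 0) x (Var ''v''))))
      in LSeq (LAssign ''D'' next (via (Var ''u'')))
        (LSeq (LAssign ''par'' next (Var ''u''))
        (LFor ''x''
           (LCond (And (Less (Cell ''rp'' (Var ''x'')) N) (Less (via (Var ''x'')) (Cell ''D'' next)))
              (LSeq (LAssign ''D'' next (via (Var ''x''))) (LAssign ''par'' next (Var ''x'')))
              LSkip))))"

definition dp_prog :: lprog where
  "dp_prog = LFor ''k'' (LFor ''u'' (LFor ''v'' cell_prog))"

text \<open>The initial mean \<open>1 / 0\<close> is larger than every other one under cross multiplication.\<close>

definition select_init_prog :: lprog where
  "select_init_prog = LSeq (LAssign ''bv'' (Const 0) (Const 1))
     (LSeq (LAssign ''bk'' (Const 0) (Const 0)) (LAssign ''bu'' (Const 0) (Const 0)))"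

text \<open>With \<open>k\<close> in the outer loop and a strict comparison, the smallest number of
  arcs among the minimum means is kept. \<open>bk\<close> stores this number of arcs, so that 0 is
  free to signal that no label is active.\<close>

definition select_prog :: lprog where
  "select_prog = LFor ''k'' (LFor ''u''
     (LCond (And (Less (Cell ''rp'' (Var ''u'')) N)
              (Less (Times (Cell ''D'' (Ix (Var ''k'') (Var ''u'') (Var ''u''))) (Var ''bk''))
                 (Times (Var ''bv'') (Plus (Var ''k'') (Const 1)))))
        (LSeq (LAssign ''bv'' (Const 0) (Cell ''D'' (Ix (Var ''k'') (Var ''u'') (Var ''u''))))
           (LSeq (LAssign ''bk'' (Const 0) (Plus (Var ''k'') (Const 1)))
              (LAssign ''bu'' (Const 0) (Var ''u''))))
        LSkip))"

text \<open>\<open>par\<close> records the last but one vertex of walks from a given start, so every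
  lookup stays in row \<open>bu\<close> while the layer decreases.\<close>

definition backtrack_prog :: lprog where
  "backtrack_prog = LSeq (LAssign ''bt'' (Const 0) (Var ''bu''))
     (LFor ''k'' (LCond (Less (Plus (Var ''k'') (Const 1)) (Var ''bk''))
        (LAssign ''bt'' (Plus (Var ''k'') (Const 1))
           (Cell ''par'' (Ix (Minus (Minus (Var ''bk'') (Const 1)) (Var ''k'')) (Var ''bu'')
              (Cell ''bt'' (Var ''k'')))))
        LSkip))"

definition vertices_prog :: lprog where
  "vertices_prog = LFor ''k'' (LAssign ''vs'' (Var ''k'') (Cell ''rp'' (Cell ''bt'' (Var ''k''))))"

text \<open>A closed walk with \<open>bk\<close> arcs needs \<open>bk - 1\<close> merges. Without
  active labels \<open>J\<close> is \<open>-1\<close> and no merge follows; a loop has to be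
  expanded by hand into its two vertices and one merge.\<close>

definition loop_prog :: lprog where
  "loop_prog = LSeq (LAssign ''J'' (Const 0) (Minus (Var ''bk'') (Const 1)))
     (LCond (BEq (Var ''bk'') (Const 1))
        (LSeq (LAssign ''vs'' (Const 0) (Cell ''mate'' (Var ''bu'')))
           (LSeq (LAssign ''vs'' (Const 1) (Cell ''rp'' (Var ''bu'')))
              (LAssign ''J'' (Const 0) (Const 1))))
        LSkip)"

text \<open>Both labels are read in advance because the loop overwrites \<open>cp\<close>.
  Exchanging the values \<open>a\<close> and \<open>b\<close> in \<open>succ\<close> composes with
  the transposition from the left.\<close>

definition merge_prog :: lprog where
  "merge_prog = LSeq (LAssign ''a'' (Const 0) (Cell ''vs'' (Plus (Var ''k'') (Const 1))))
     (LSeq (LAssign ''b'' (Const 0) (Cell ''vs'' (Var ''k'')))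
     (LSeq (LAssign ''ca'' (Const 0) (Cell ''cp'' (Var ''a'')))
     (LSeq (LAssign ''cb'' (Const 0) (Cell ''cp'' (Var ''b'')))
     (LFor ''v'' (LSeq
        (LCond (BEq (Cell ''succ'' (Var ''v'')) (Var ''a''))
           (LAssign ''succ'' (Var ''v'') (Var ''b''))
           (LCond (BEq (Cell ''succ'' (Var ''v'')) (Var ''b''))
              (LAssign ''succ'' (Var ''v'') (Var ''a''))
              LSkip))
        (LCond (BEq (Cell ''cp'' (Var ''v'')) (Var ''cb''))
           (LAssign ''cp'' (Var ''v'') (Var ''ca''))
           LSkip))))))"

definition merges_prog :: lprog where
  "merges_prog = LFor ''k'' (LCond (Less (Var ''k'') (Var ''J'')) merge_prog LSkip)"

definition round_prog :: lprog where
  "round_prog = LSeq clear_prog (LSeq reps_prog (LSeq base_prog (LSeq dp_prog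
     (LSeq select_init_prog (LSeq select_prog (LSeq backtrack_prog (LSeq vertices_prog
     (LSeq loop_prog merges_prog))))))))"

text \<open>\<open>n\<close> rounds are enough: there are at most \<open>n\<close> active labels,
  and every round removes one as long as there are any.\<close>

definition main_prog :: lprog where
  "main_prog = LSeq (LAssign ''P'' (Const 0) (Const 1)) (LSeq denominators_prog
     (LSeq weights_prog (LSeq init_prog (LFor ''r'' round_prog))))"

lemmas prog_defs = denominators_prog_def weights_prog_def init_prog_def clear_prog_def
  reps_prog_def base_prog_def cell_prog_def Let_def dp_prog_def select_init_prog_def
  select_prog_def backtrack_prog_def vertices_prog_def loop_prog_def merge_prog_def
  merges_prog_def round_prog_def main_prog_def

lemma wf_main_prog: "wf_prog main_prog"
  by (simp add: prog_defs read_only_def)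

section \<open>Addresses and invariant rules for nested loops\<close>

lemma aval_Ix [simp]:
  "aval (Ix k u v) s = ix (s ''size'' 0) (aval k s) (aval u s) (aval v s)"
  by (simp add: Ix_def ix_def)

lemma bval_BEq [simp]: "bval (BEq a b) s \<longleftrightarrow> aval a s = aval b s"
  by (auto simp: BEq_def)

lemma ix_eq_iff:
  assumes "0 \<le> u" "u < n" "0 \<le> u'" "u' < n" "0 \<le> v" "v < n" "0 \<le> v'" "v' < n"
  shows "ix n k u v = ix n k' u' v' \<longleftrightarrow> k = k' \<and> u = u' \<and> v = v'"
proof -
  have *: "a * n + x = a' * n + x' \<longleftrightarrow> a = a' \<and> x = x'"
    if "0 \<le> x" "x < n" "0 \<le> x'" "x' < n" for a a' x x' :: int
  proof
    assume eq: "a * n + x = a' * n + x'"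
    have "(a * n + x) div n = a" "(a' * n + x') div n = a'" using that by simp_all
    then show "a = a' \<and> x = x'" using eq by simp
  qed simp
  show ?thesis unfolding ix_def using assms by (simp add: *)
qed

text \<open>For invariants that do not depend on the counter cell, setting the counter can be hidden
  from the step.\<close>

lemma sem_LFor1:
  assumes size: "st ''size'' 0 = int n"
    and wf: "i \<notin> writes p" "i \<noteq> ''size''" "''size'' \<notin> writes p"
    and insensitive: "\<And>k s x. I k s \<Longrightarrow> I k (set_cell i 0 x s)"
    and init: "I 0 st"
    and step: "\<And>k s. k < n \<Longrightarrow> I k s \<Longrightarrow> s i 0 = int k \<Longrightarrow>
      (\<And>x. x \<noteq> i \<Longrightarrow> x \<notin> writes p \<Longrightarrow> s x = st x) \<Longrightarrow> I (Suc k) (sem p s)"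
  shows "I n (sem (LFor i p) st)"
  by (rule sem_LFor[where ?s0.0 = st, OF size wf]) (use init step insensitive in auto)

text \<open>The pairs that a double loop has dealt with when its counters stand at \<open>k\<close>
  and \<open>m\<close>.\<close>

definition lex_before :: "nat \<Rightarrow> nat \<Rightarrow> nat \<Rightarrow> nat \<Rightarrow> bool" where
  "lex_before k m u v \<longleftrightarrow> u < k \<or> u = k \<and> v < m"

lemma lex_before_simps [simp]:
  "\<not> lex_before 0 0 u v"
  "lex_before k (Suc m) u v \<longleftrightarrow> lex_before k m u v \<or> u = k \<and> v = m"
  "lex_before k 0 u v \<longleftrightarrow> u < k"
  by (auto simp: lex_before_def)

lemma lex_before_row: "v < n \<Longrightarrow> lex_before k n u v \<longleftrightarrow> u < Suc k"
  by (auto simp: lex_before_def)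

text \<open>The premise \<open>row\<close> identifies the end of row \<open>k\<close> with the
  beginning of row \<open>Suc k\<close>; in applications it comes down to
  \<open>lex_before_row\<close>.\<close>

lemma sem_LFor2:
  assumes size: "st ''size'' 0 = int n"
    and wf: "i \<notin> writes p" "j \<notin> writes p" "i \<noteq> j" "i \<noteq> ''size''" "j \<noteq> ''size''" "''size'' \<notin> writes p"
    and insensitive: "\<And>k m s x. I k m s \<Longrightarrow> I k m (set_cell i 0 x s)"
      "\<And>k m s x. I k m s \<Longrightarrow> I k m (set_cell j 0 x s)"
    and init: "I 0 0 st"
    and row: "\<And>k s. k < n \<Longrightarrow> I k n s \<Longrightarrow> I (Suc k) 0 s"
    and step: "\<And>k m s. k < n \<Longrightarrow> m < n \<Longrightarrow> I k m s \<Longrightarrow> s i 0 = int k \<Longrightarrow> s j 0 = int m \<Longrightarrow>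
      (\<And>x. x \<noteq> i \<Longrightarrow> x \<noteq> j \<Longrightarrow> x \<notin> writes p \<Longrightarrow> s x = st x) \<Longrightarrow> I k (Suc m) (sem p s)"
  shows "I n 0 (sem (LFor i (LFor j p)) st)"
proof (rule sem_LFor1[where I = "\<lambda>k. I k 0" and st = st, OF size])
  fix k s assume k: "k < n" "I k 0 s" "s i 0 = int k"
    and frame: "\<And>x. x \<noteq> i \<Longrightarrow> x \<notin> writes (LFor j p) \<Longrightarrow> s x = st x"
  have size': "s ''size'' 0 = int n" using frame[of "''size''"] wf size by simp
  have "I k n (sem (LFor j p) s)"
  proof (rule sem_LFor1[where st = s, OF size'])
    fix m t assume m: "m < n" "I k m t" "t j 0 = int m"
      and frame': "\<And>x. x \<noteq> j \<Longrightarrow> x \<notin> writes p \<Longrightarrow> t x = s x"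
    show "I k (Suc m) (sem p t)"
      using k m frame frame' wf by (intro step) auto
  qed (use wf insensitive k in auto)
  then show "I (Suc k) 0 (sem (LFor j p) s)" using row k by blast
qed (use wf insensitive init in auto)

section \<open>Verification of the phases\<close>

lemma sem_denominators:
  assumes size: "s0 ''size'' 0 = int n" and P: "0 < s0 ''P'' 0"
  defines "s \<equiv> sem denominators_prog s0"
  shows "0 < s ''P'' 0"
    "\<And>u v. u < n \<Longrightarrow> v < n \<Longrightarrow> 0 < s0 ''den'' (ix n 0 u v) \<Longrightarrow> s0 ''den'' (ix n 0 u v) dvd s ''P'' 0"
proof -
  let ?I = "\<lambda>k m s. 0 < s ''P'' 0 \<and> (\<forall>u<n. \<forall>v<n. lex_before k m u v \<longrightarrow>
    0 < s0 ''den'' (ix n 0 u v) \<longrightarrow> s0 ''den'' (ix n 0 u v) dvd s ''P'' 0)"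
  have "?I n 0 s"
    unfolding s_def denominators_prog_def
  proof (rule sem_LFor2[where I = ?I and st = s0, OF size])
    fix k m s assume km: "k < n" "m < n" "?I k m s" "s ''u'' 0 = int k" "s ''v'' 0 = int m"
      and frame: "\<And>x. x \<noteq> ''u'' \<Longrightarrow> x \<noteq> ''v'' \<Longrightarrow> x \<notin> writes (LCond
        (Less (Const 0) (Cell ''den'' (Ix (Const 0) (Var ''u'') (Var ''v''))))
        (LAssign ''P'' (Const 0)
           (Times (Var ''P'') (Cell ''den'' (Ix (Const 0) (Var ''u'') (Var ''v'')))))
        LSkip) \<Longrightarrow> s x = s0 x"
    have [simp]: "s ''den'' = s0 ''den''" "s ''size'' 0 = int n" using size by (simp_all add: frame)
    show "?I k (Suc m) (sem (LCond
        (Less (Const 0) (Cell ''den'' (Ix (Const 0) (Var ''u'') (Var ''v''))))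
        (LAssign ''P'' (Const 0)
           (Times (Var ''P'') (Cell ''den'' (Ix (Const 0) (Var ''u'') (Var ''v'')))))
        LSkip) s)"
      using km by (auto intro: dvd_mult2)
  qed (use P in \<open>auto simp: lex_before_row less_Suc_eq\<close>)
  then show "0 < s ''P'' 0"
    "\<And>u v. u < n \<Longrightarrow> v < n \<Longrightarrow> 0 < s0 ''den'' (ix n 0 u v) \<Longrightarrow> s0 ''den'' (ix n 0 u v) dvd s ''P'' 0"
    by auto
qed

lemma sem_weights:
  assumes size: "s0 ''size'' 0 = int n" and uv: "u < n" "v < n"
  shows "sem weights_prog s0 ''W'' (ix n 0 u v) =
    (s0 ''P'' 0 div s0 ''den'' (ix n 0 u v)) * s0 ''num'' (ix n 0 u v)"
proof -
  let ?I = "\<lambda>k m s. (\<forall>u<n. \<forall>v<n. lex_before k m u v \<longrightarrow> s ''W'' (ix n 0 u v) =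
    (s0 ''P'' 0 div s0 ''den'' (ix n 0 u v)) * s0 ''num'' (ix n 0 u v))"
  have "?I n 0 (sem weights_prog s0)"
    unfolding weights_prog_def
  proof (rule sem_LFor2[where I = ?I and st = s0, OF size], goal_cases)
    case (11 k m s)
    have [simp]: "s ''P'' = s0 ''P''" "s ''den'' = s0 ''den''" "s ''num'' = s0 ''num''"
      "s ''size'' 0 = int n" using size by (simp_all add: 11)
    show ?case using 11(1-5) by (auto simp: ix_eq_iff)
  qed (auto simp: lex_before_row)
  then show ?thesis using uv by simp
qed

lemma sem_init:
  assumes size: "s0 ''size'' 0 = int n" and v: "v < n"
  shows "sem init_prog s0 ''succ'' (int v) = int v" "sem init_prog s0 ''cp'' (int v) = int v"
proof -
  let ?I = "\<lambda>k s. (\<forall>v<k. s ''succ'' (int v) = int v \<and> s ''cp'' (int v) = int v)"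
  have "?I n (sem init_prog s0)"
    unfolding init_prog_def
    by (rule sem_LFor1[where I = ?I and st = s0, OF size]) (auto simp: less_Suc_eq)
  then show "sem init_prog s0 ''succ'' (int v) = int v" "sem init_prog s0 ''cp'' (int v) = int v"
    using v by auto
qed

lemma sem_clear:
  assumes size: "s0 ''size'' 0 = int n" and v: "v < n"
  shows "sem clear_prog s0 ''rp'' (int v) = int n"
proof -
  let ?I = "\<lambda>k s. (\<forall>v<k. s ''rp'' (int v) = int n)"
  have "?I n (sem clear_prog s0)"
    unfolding clear_prog_def
  proof (rule sem_LFor1[where I = ?I and st = s0, OF size], goal_cases)
    case (6 k s)
    have "s ''size'' 0 = int n" using size by (simp add: 6)
    then show ?case using 6(1-3) by (auto simp: less_Suc_eq)
  qed auto
  then show ?thesis using v by auto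
qed

text \<open>Entries are overwritten during the loop, so the invariant claims only that each label
  has some valid entry or that no pair seen so far shows it to be active. The functions
  \<open>rp\<close> and \<open>mate\<close> are read off the final store.\<close>

lemma sem_reps:
  assumes size: "s0 ''size'' 0 = int n"
    and tm: "\<And>v. v < n \<Longrightarrow> s0 ''term'' (int v) = int (tm v)"
    and cp: "\<And>v. v < n \<Longrightarrow> s0 ''cp'' (int v) = int (cp v) \<and> cp v < n"
    and rp0: "\<And>v. v < n \<Longrightarrow> s0 ''rp'' (int v) = int n"
  defines "s \<equiv> sem reps_prog s0"
  obtains rp mate where
    "\<And>l. l < n \<Longrightarrow> l \<notin> active n tm cp \<Longrightarrow> s ''rp'' (int l) = int n"
    "\<And>l. l \<in> active n tm cp \<Longrightarrow> s ''rp'' (int l) = int (rp l) \<and> s ''mate'' (int l) = int (mate l) \<and>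
       rp l < n \<and> cp (rp l) = l \<and> mate l < n \<and> tm (mate l) = tm (rp l) \<and> cp (mate l) \<noteq> l"
proof -
  define good where "good s l a b \<longleftrightarrow> s ''rp'' (int l) = int a \<and> s ''mate'' (int l) = int b \<and>
       a < n \<and> cp a = l \<and> b < n \<and> tm b = tm a \<and> cp b \<noteq> l" for s :: store and l a b
  define none where "none k m l \<longleftrightarrow>
    (\<forall>u<n. \<forall>v<n. lex_before k m u v \<longrightarrow> tm u = tm v \<longrightarrow> cp u = l \<longrightarrow> cp v = l)" for k m l
  have good_cong: "good s l a b \<longleftrightarrow> good s' l a b"
    if "s ''rp'' (int l) = s' ''rp'' (int l)" "s ''mate'' (int l) = s' ''mate'' (int l)" for s s' l a b
    using that by (simp add: good_def)
  let ?I = "\<lambda>k m s. \<forall>l<n. (\<exists>a b. good s l a b) \<or> s ''rp'' (int l) = int n \<and> none k m l"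
  define body where "body =
     LCond (And (BEq (Cell ''term'' (Var ''u'')) (Cell ''term'' (Var ''v'')))
              (Neg (BEq (Cell ''cp'' (Var ''u'')) (Cell ''cp'' (Var ''v'')))))
        (LSeq (LAssign ''rp'' (Cell ''cp'' (Var ''u'')) (Var ''u''))
           (LAssign ''mate'' (Cell ''cp'' (Var ''u'')) (Var ''v'')))
        LSkip"
  have writes: "writes body = {''rp'', ''mate''}" by (auto simp: body_def)
  have "?I n 0 s"
    unfolding s_def reps_prog_def body_def[symmetric]
  proof (rule sem_LFor2[where I = ?I and st = s0, OF size], goal_cases)
    case (11 k m s)
    have fr: "s ''term'' = s0 ''term''" "s ''cp'' = s0 ''cp''" by (simp_all add: 11(6) writes)
    have vals: "s0 ''term'' (int k) = int (tm k)" "s0 ''term'' (int m) = int (tm m)"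
      "s0 ''cp'' (int k) = int (cp k)" "s0 ''cp'' (int m) = int (cp m)"
      using tm cp 11(1,2) by simp_all
    have cond: "bval (And (BEq (Cell ''term'' (Var ''u'')) (Cell ''term'' (Var ''v'')))
              (Neg (BEq (Cell ''cp'' (Var ''u'')) (Cell ''cp'' (Var ''v''))))) s
        \<longleftrightarrow> tm k = tm m \<and> cp k \<noteq> cp m"
      by (simp add: 11(4,5) fr vals)
    show ?case
    proof (cases "tm k = tm m \<and> cp k \<noteq> cp m")
      case True
      define s' where "s' = set_cell ''mate'' (int (cp k)) (int m) (set_cell ''rp'' (int (cp k)) (int k) s)"
      have "?I k (Suc m) s'"
      proof (intro allI impI)
        fix l assume l: "l < n"
        show "(\<exists>a b. good s' l a b) \<or> s' ''rp'' (int l) = int n \<and> none k (Suc m) l"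
        proof (cases "l = cp k")
          case True
          then have "good s' l k m"
            using \<open>tm k = tm m \<and> cp k \<noteq> cp m\<close> 11(1,2) by (simp add: good_def s'_def)
          then show ?thesis by blast
        next
          case False
          then have eq: "s' ''rp'' (int l) = s ''rp'' (int l)" "s' ''mate'' (int l) = s ''mate'' (int l)"
            by (simp_all add: s'_def)
          have "none k (Suc m) l" if "none k m l" using that False by (auto simp: none_def)
          moreover have "(\<exists>a b. good s l a b) \<or> s ''rp'' (int l) = int n \<and> none k m l"
            using 11(3) l by blast
          moreover have "good s' l a b \<longleftrightarrow> good s l a b" for a b using good_cong[of s' l s] eq by simp
          ultimately show ?thesis unfolding eq(1) by blast
        qed
      qed
      moreover have "sem body s = s'"
        unfolding body_def sem.simps(4) cond using True by (simp add: s'_def 11(4,5) fr vals)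
      ultimately show ?thesis by simp
    next
      case False
      have "none k (Suc m) l" if "none k m l" for l using that False by (auto simp: none_def)
      then have "?I k (Suc m) s" using 11(3) by blast
      moreover have "sem body s = s"
        unfolding body_def sem.simps(4) cond by (subst if_not_P[OF False]) simp
      ultimately show ?thesis by simp
    qed
  next
    case (7 k m s x)
    have "good (set_cell ''u'' 0 x s) l a b \<longleftrightarrow> good s l a b" for l a b by (simp add: good_def)
    then show ?case using 7 by simp
  next
    case (8 k m s x)
    have "good (set_cell ''v'' 0 x s) l a b \<longleftrightarrow> good s l a b" for l a b by (simp add: good_def)
    then show ?case using 8 by simp
  next
    case 9
    then show ?case using rp0 by (simp add: none_def)
  next
    case (10 k s)
    then show ?case by (simp add: none_def lex_before_row)
  qed (simp_all add: writes)
  then have fin: "(\<exists>a b. good s l a b) \<or> s ''rp'' (int l) = int n \<and> none n 0 l" if "l < n" for l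
    using that by simp
  have act: "\<exists>a b. good s l a b" if l: "l \<in> active n tm cp" for l
  proof -
    have "l < n" using l cp by (auto simp: active_def)
    moreover have "\<not> none n 0 l"
    proof
      assume none: "none n 0 l"
      obtain u v where "u < n" "v < n" "tm u = tm v" "l = cp u" "cp u \<noteq> cp v"
        using l by (auto simp: active_def)
      then show False using none unfolding none_def lex_before_simps by metis
    qed
    ultimately show ?thesis using fin[of l] by blast
  qed
  define rp where "rp l = (SOME a. \<exists>b. good s l a b)" for l
  define mate where "mate l = (SOME b. good s l (rp l) b)" for l
  have rm: "good s l (rp l) (mate l)" if "l \<in> active n tm cp" for l
  proof -
    have "\<exists>b. good s l (rp l) b" unfolding rp_def using act[OF that] by (rule someI_ex)
    then show ?thesis unfolding mate_def by (rule someI_ex)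
  qed
  have inact: "s ''rp'' (int l) = int n" if l: "l < n" "l \<notin> active n tm cp" for l
  proof (rule ccontr)
    assume "s ''rp'' (int l) \<noteq> int n"
    then obtain a b where "good s l a b" using fin[OF l(1)] by blast
    then have "a < n \<and> b < n \<and> tm a = tm b \<and> cp a = l \<and> cp b \<noteq> l" by (simp add: good_def)
    then have "l \<in> active n tm cp" unfolding active_def by (intro CollectI exI[of _ a] exI[of _ b]) auto
    then show False using l by simp
  qed
  show ?thesis
  proof (rule that[of rp mate])
    fix l assume "l \<in> active n tm cp"
    from rm[OF this] show "s ''rp'' (int l) = int (rp l) \<and> s ''mate'' (int l) = int (mate l) \<and>
       rp l < n \<and> cp (rp l) = l \<and> mate l < n \<and> tm (mate l) = tm (rp l) \<and> cp (mate l) \<noteq> l"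
      by (simp add: good_def)
  qed (rule inact)
qed

lemma sem_base:
  assumes size: "s0 ''size'' 0 = int n" and uv: "u < n" "v < n"
  shows "sem base_prog s0 ''D'' (ix n 0 u v) =
    (if u = v then s0 ''W'' (ix n 0 (s0 ''rp'' u) (s0 ''mate'' u)) + s0 ''W'' (ix n 0 (s0 ''mate'' u) (s0 ''rp'' u))
     else s0 ''W'' (ix n 0 (s0 ''rp'' u) (s0 ''rp'' v)))"
proof -
  let ?I = "\<lambda>k m s. (\<forall>u<n. \<forall>v<n. lex_before k m u v \<longrightarrow> s ''D'' (ix n 0 u v) =
    (if u = v then s0 ''W'' (ix n 0 (s0 ''rp'' u) (s0 ''mate'' u)) + s0 ''W'' (ix n 0 (s0 ''mate'' u) (s0 ''rp'' u))
     else s0 ''W'' (ix n 0 (s0 ''rp'' u) (s0 ''rp'' v))))"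
  have "?I n 0 (sem base_prog s0)"
    unfolding base_prog_def
  proof (rule sem_LFor2[where I = ?I and st = s0, OF size], goal_cases)
    case (11 k m s)
    have [simp]: "s ''W'' = s0 ''W''" "s ''rp'' = s0 ''rp''" "s ''mate'' = s0 ''mate''"
      "s ''size'' 0 = int n" using size by (simp_all add: 11)
    show ?case using 11(1-5) by (auto simp: ix_eq_iff)
  qed (auto simp: lex_before_row)
  then show ?thesis using uv by simp
qed

text \<open>The recursion mirrors the program, with \<open>u\<close> as initial candidate. For
  \<open>u\<close> in \<open>X\<close> the minimum is over \<open>X\<close>, as a min-plus power
  requires.\<close>

fun dp_value :: "nat set \<Rightarrow> (nat \<Rightarrow> nat \<Rightarrow> int) \<Rightarrow> nat \<Rightarrow> nat \<Rightarrow> nat \<Rightarrow> int" where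
  "dp_value X d 0 u v = d u v"
| "dp_value X d (Suc k) u v = Min ((\<lambda>x. dp_value X d k u x + d x v) ` insert u X)"

lemma sem_cell:
  assumes size: "s0 ''size'' 0 = int n"
    and kuv: "s0 ''k'' 0 = int k" "s0 ''u'' 0 = int u" "s0 ''v'' 0 = int v" "u < n" "v < n"
  defines "X \<equiv> {x. x < n \<and> s0 ''rp'' (int x) < int n}"
    and "e \<equiv> \<lambda>x. s0 ''D'' (ix n k u (int x)) + s0 ''D'' (ix n 0 (int x) v)"
  shows "\<exists>x\<in>insert u X. sem cell_prog s0 ''D'' = (s0 ''D'')(ix n (int k + 1) u v := e x) \<and>
    sem cell_prog s0 ''par'' = (s0 ''par'')(ix n (int k + 1) u v := int x) \<and>
    (\<forall>y\<in>insert u X. e x \<le> e y)"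
proof -
  let ?i = "ix n (int k + 1) u v"
  let ?I = "\<lambda>m s. \<exists>x\<in>insert u X. s ''D'' = (s0 ''D'')(?i := e x) \<and>
    s ''par'' = (s0 ''par'')(?i := int x) \<and> (\<forall>y\<in>insert u (X \<inter> {..<m}). e x \<le> e y)"
  define s1 where "s1 = set_cell ''par'' ?i (int u) (set_cell ''D'' ?i (e u) s0)"
  define body where "body = LCond (And (Less (Cell ''rp'' (Var ''x'')) N)
      (Less (Plus (Cell ''D'' (Ix (Var ''k'') (Var ''u'') (Var ''x'')))
         (Cell ''D'' (Ix (Const 0) (Var ''x'') (Var ''v''))))
         (Cell ''D'' (Ix (Plus (Var ''k'') (Const 1)) (Var ''u'') (Var ''v'')))))
      (LSeq (LAssign ''D'' (Ix (Plus (Var ''k'') (Const 1)) (Var ''u'') (Var ''v''))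
         (Plus (Cell ''D'' (Ix (Var ''k'') (Var ''u'') (Var ''x'')))
         (Cell ''D'' (Ix (Const 0) (Var ''x'') (Var ''v'')))))
         (LAssign ''par'' (Ix (Plus (Var ''k'') (Const 1)) (Var ''u'') (Var ''v'')) (Var ''x'')))
      LSkip"
  have eq: "sem cell_prog s0 = sem (LFor ''x'' body) s1"
    unfolding cell_prog_def Let_def body_def using size kuv by (simp add: s1_def e_def)
  have writes: "writes body = {''D'', ''par''}" by (auto simp: body_def)
  have s1: "s1 x = s0 x" if "x \<noteq> ''D''" "x \<noteq> ''par''" for x using that by (simp add: s1_def)
  have size1: "s1 ''size'' 0 = int n" using size s1 by simp
  have "?I n (sem (LFor ''x'' body) s1)"
  proof (rule sem_LFor1[where I = ?I and st = s1, OF size1])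
    fix m s assume m: "m < n" "?I m s" "s ''x'' 0 = int m"
      and frame: "\<And>x. x \<noteq> ''x'' \<Longrightarrow> x \<notin> writes body \<Longrightarrow> s x = s1 x"
    have [simp]: "s ''size'' 0 = int n" "s ''k'' 0 = int k" "s ''u'' 0 = int u"
      "s ''v'' 0 = int v" "s ''rp'' = s0 ''rp''"
      using size kuv by (simp_all add: frame writes s1)
    obtain x where x: "x \<in> insert u X" "s ''D'' = (s0 ''D'')(?i := e x)"
      "s ''par'' = (s0 ''par'')(?i := int x)" "\<forall>y\<in>insert u (X \<inter> {..<m}). e x \<le> e y"
      using m(2) by blast
    \<comment> \<open>The loop writes only into layer \<open>k + 1\<close> and reads candidates from
      the layers \<open>k\<close> and 0, so the candidates keep their values.\<close>
    have v1: "s ''D'' (ix n k u m) + s ''D'' (ix n 0 m v) = e m"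
      unfolding x(2) e_def using m(1) kuv(4,5) by (simp add: ix_eq_iff)
    have mX: "m \<in> X \<longleftrightarrow> s0 ''rp'' (int m) < int n" using m(1) by (simp add: X_def)
    show "?I (Suc m) (sem body s)"
    proof (cases "m \<in> X \<and> e m < e x")
      case True
      then have "sem body s = set_cell ''par'' ?i (int m) (set_cell ''D'' ?i (e m) s)"
        using v1 mX m(3) x(2) by (simp add: body_def)
      then have "sem body s ''D'' = (s0 ''D'')(?i := e m)" "sem body s ''par'' = (s0 ''par'')(?i := int m)"
        using x(2,3) by (simp_all add: fun_eq_iff)
      moreover have "\<forall>y\<in>insert u (X \<inter> {..<Suc m}). e m \<le> e y"
        using True x(4) by (force simp: less_Suc_eq)
      ultimately show ?thesis using True by blast
    next
      case False
      then have "sem body s = s" using v1 mX m(3) x(2) by (auto simp: body_def)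
      moreover have "\<forall>y\<in>insert u (X \<inter> {..<Suc m}). e x \<le> e y"
        using False x(4) by (force simp: less_Suc_eq)
      ultimately show ?thesis using x by auto
    qed
  qed (auto simp: writes s1_def)
  moreover have "X \<inter> {..<n} = X" by (auto simp: X_def)
  ultimately show ?thesis unfolding eq by simp
qed

lemma sem_dp:
  assumes size: "s0 ''size'' 0 = int n"
  defines "X \<equiv> {x. x < n \<and> s0 ''rp'' (int x) < int n}"
    and "d \<equiv> \<lambda>u v. s0 ''D'' (ix n 0 (int u) (int v))"
    and "s \<equiv> sem dp_prog s0"
  shows "\<And>j u v. j \<le> n \<Longrightarrow> u < n \<Longrightarrow> v < n \<Longrightarrow> s ''D'' (ix n (int j) u v) = dp_value X d j u v"
    and "\<And>j u v. j < n \<Longrightarrow> u < n \<Longrightarrow> v < n \<Longrightarrow> \<exists>x\<in>insert u X.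
      s ''par'' (ix n (int j + 1) u v) = int x \<and>
      dp_value X d (Suc j) u v = dp_value X d j u x + d x v"
proof -
  define Dok where "Dok s j u v \<longleftrightarrow> s ''D'' (ix n (int j) (int u) (int v)) = dp_value X d j u v"
    for s :: store and j u v
  define Pok where "Pok s j u v \<longleftrightarrow> (\<exists>x\<in>insert u X. s ''par'' (ix n (int j + 1) (int u) (int v)) = int x \<and>
      dp_value X d (Suc j) u v = dp_value X d j u x + d x v)" for s :: store and j u v
  have X: "x < n" if "x \<in> X" for x using that by (simp add: X_def)
  have finX: "finite X" by (simp add: X_def)
  let ?I = "\<lambda>k s. (\<forall>j u v. j \<le> k \<longrightarrow> u < n \<longrightarrow> v < n \<longrightarrow> Dok s j u v) \<and>
    (\<forall>j u v. j < k \<longrightarrow> u < n \<longrightarrow> v < n \<longrightarrow> Pok s j u v)"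
  have writes: "writes cell_prog = {''D'', ''par'', ''x''}" by (auto simp: cell_prog_def Let_def)
  have "?I n s"
    unfolding s_def dp_prog_def
  proof (rule sem_LFor1[where I = ?I and st = s0, OF size])
    fix k s assume k: "k < n" "?I k s" "s ''k'' 0 = int k"
      and frame: "\<And>x. x \<noteq> ''k'' \<Longrightarrow> x \<notin> writes (LFor ''u'' (LFor ''v'' cell_prog)) \<Longrightarrow> s x = s0 x"
    have sz: "s ''size'' 0 = int n" using frame size writes by simp
    have rps: "s ''rp'' = s0 ''rp''" using frame writes by simp
    \<comment> \<open>The layers up to \<open>k\<close> are complete, and layer \<open>k + 1\<close>
      is filled up to the pair \<open>(a, b)\<close>.\<close>
    let ?K = "\<lambda>a b t. ?I k t \<and> (\<forall>u v. u < n \<longrightarrow> v < n \<longrightarrow> lex_before a b u v \<longrightarrow>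
      Dok t (Suc k) u v \<and> Pok t k u v)"
    have "?K n 0 (sem (LFor ''u'' (LFor ''v'' cell_prog)) s)"
    proof (rule sem_LFor2[where I = ?K and st = s, OF sz])
      fix a b t assume ab: "a < n" "b < n" "?K a b t" "t ''u'' 0 = int a" "t ''v'' 0 = int b"
        and frame': "\<And>x. x \<noteq> ''u'' \<Longrightarrow> x \<noteq> ''v'' \<Longrightarrow> x \<notin> writes cell_prog \<Longrightarrow> t x = s x"
      have t: "t ''size'' 0 = int n" "t ''k'' 0 = int k" "t ''rp'' = s0 ''rp''"
        using frame' writes sz k rps by simp_all
      let ?t = "sem cell_prog t"
      let ?i = "ix n (int k + 1) (int a) (int b)"
      define e where "e x = t ''D'' (ix n k a (int x)) + t ''D'' (ix n 0 (int x) b)" for x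
      obtain x where x: "x \<in> insert a X" "?t ''D'' = (t ''D'')(?i := e x)"
        "?t ''par'' = (t ''par'')(?i := int x)" "\<forall>y\<in>insert a X. e x \<le> e y"
        using sem_cell[where ?s0.0 = t, OF t(1,2) ab(4,5,1,2)] unfolding t(3) X_def[symmetric] e_def by blast
      have e_eq: "e y = dp_value X d k a y + d y b" if "y \<in> insert a X" for y
      proof -
        have y: "y < n" using that X ab(1) by auto
        have "Dok t k a y" "Dok t 0 y b" using ab(1-3) y by auto
        then show ?thesis by (simp add: Dok_def e_def)
      qed
      have val: "dp_value X d (Suc k) a b = e x"
      proof -
        have "dp_value X d (Suc k) a b = Min (e ` insert a X)"
          using e_eq by (simp cong: image_cong)
        also have "\<dots> = e x" using x(1,4) finX by (intro Min_eqI) auto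
        finally show ?thesis .
      qed
      have D_other: "Dok ?t j u v \<longleftrightarrow> Dok t j u v" if "u < n" "v < n" "(j, u, v) \<noteq> (Suc k, a, b)" for j u v
        unfolding Dok_def x(2) using that ab(1,2) by (auto simp: ix_eq_iff)
      have P_other: "Pok ?t j u v \<longleftrightarrow> Pok t j u v" if "u < n" "v < n" "(j, u, v) \<noteq> (k, a, b)" for j u v
        unfolding Pok_def x(3) using that ab(1,2) by (auto simp: ix_eq_iff)
      have "Dok ?t (Suc k) a b" unfolding Dok_def x(2) using val by (simp add: add.commute)
      moreover have "Pok ?t k a b"
        unfolding Pok_def x(3) using val e_eq[OF x(1)] x(1) by auto
      ultimately have "Dok ?t (Suc k) u v \<and> Pok ?t k u v"
        if "u < n" "v < n" "lex_before a (Suc b) u v" for u v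
        using that ab(3) D_other[of u v "Suc k"] P_other[of u v k] by (cases "(u, v) = (a, b)") auto
      moreover have "?I k ?t" using ab(3) D_other P_other by auto
      ultimately show "?K a (Suc b) ?t" by blast
    next
      fix a t assume "a < n" "?K a n t"
      then show "?K (Suc a) 0 t" by (simp add: lex_before_row)
    qed (use k(2) in \<open>simp_all add: writes Dok_def Pok_def\<close>)
    then show "?I (Suc k) (sem (LFor ''u'' (LFor ''v'' cell_prog)) s)"
      by (auto simp: le_Suc_eq less_Suc_eq)
  qed (simp_all add: writes Dok_def Pok_def d_def)
  then show "\<And>j u v. j \<le> n \<Longrightarrow> u < n \<Longrightarrow> v < n \<Longrightarrow> s ''D'' (ix n (int j) u v) = dp_value X d j u v"
    and "\<And>j u v. j < n \<Longrightarrow> u < n \<Longrightarrow> v < n \<Longrightarrow> \<exists>x\<in>insert u X.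
      s ''par'' (ix n (int j + 1) u v) = int x \<and>
      dp_value X d (Suc j) u v = dp_value X d j u x + d x v"
    by (auto simp: Dok_def Pok_def)
qed

text \<open>Transitivity for the fractions \<open>a / p\<close>, \<open>b / q\<close> and
  \<open>c / r\<close>.\<close>

lemma cross_mult_less_trans:
  fixes a b c p q r :: int
  assumes "a * q < b * p" "b * r \<le> c * q" "0 < p" "0 < q" "0 < r"
  shows "a * r < c * p"
proof -
  have "(a * r) * q = (a * q) * r" by simp
  also have "\<dots> < (b * p) * r" using assms by (intro mult_strict_right_mono) auto
  also have "\<dots> = (b * r) * p" by simp
  also have "\<dots> \<le> (c * q) * p" using assms by (intro mult_right_mono) auto
  also have "\<dots> = (c * p) * q" by simp
  finally show ?thesis using assms by (simp add: mult_less_cancel_right)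
qed

lemma sem_select:
  assumes size: "s0 ''size'' 0 = int n" and init: "s0 ''bv'' 0 = 1" "s0 ''bk'' 0 = 0"
  defines "X \<equiv> {x. x < n \<and> s0 ''rp'' (int x) < int n}"
    and "G \<equiv> \<lambda>k u. s0 ''D'' (ix n (int k) (int u) (int u))"
    and "s \<equiv> sem select_prog s0"
  shows "X = {} \<Longrightarrow> s ''bk'' 0 = 0"
    and "X \<noteq> {} \<Longrightarrow> \<exists>k u. k < n \<and> u \<in> X \<and> s ''bk'' 0 = int k + 1 \<and> s ''bu'' 0 = int u \<and>
      (\<forall>j l. j < n \<longrightarrow> l \<in> X \<longrightarrow> G k u * (int j + 1) \<le> G j l * (int k + 1)) \<and>
      (\<forall>j l. j < k \<longrightarrow> l \<in> X \<longrightarrow> G k u * (int j + 1) < G j l * (int k + 1))"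
proof -
  define none where "none k m \<longleftrightarrow> (\<forall>j l. lex_before k m j l \<longrightarrow> l \<notin> X)" for k m
  define best where "best k m kb ub \<longleftrightarrow> ub \<in> X \<and> kb < n \<and> lex_before k m kb ub \<and>
    (\<forall>j l. lex_before k m j l \<longrightarrow> l \<in> X \<longrightarrow> G kb ub * (int j + 1) \<le> G j l * (int kb + 1) \<and>
      (j < kb \<longrightarrow> G kb ub * (int j + 1) < G j l * (int kb + 1)))" for k m kb ub
  define cur where "cur s kb ub \<longleftrightarrow> s ''bk'' 0 = int kb + 1 \<and> s ''bu'' 0 = int ub \<and> s ''bv'' 0 = G kb ub"
    for s :: store and kb ub
  have X: "x < n" if "x \<in> X" for x using that by (simp add: X_def)
  let ?I = "\<lambda>k m s. (s ''bk'' 0 = 0 \<and> s ''bv'' 0 = 1 \<and> none k m) \<or>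
    (\<exists>kb ub. best k m kb ub \<and> cur s kb ub)"
  have "?I n 0 s"
    unfolding s_def select_prog_def
  proof (rule sem_LFor2[where I = ?I and st = s0, OF size], goal_cases)
    case (11 k m s)
    have [simp]: "s ''rp'' = s0 ''rp''" "s ''D'' = s0 ''D''" "s ''size'' 0 = int n"
      using size by (simp_all add: 11)
    have mX: "s0 ''rp'' (int m) < int n \<longleftrightarrow> m \<in> X" using 11(2) by (simp add: X_def)
    define s' where "s' = set_cell ''bu'' 0 (int m) (set_cell ''bk'' 0 (int k + 1) (set_cell ''bv'' 0 (G k m) s))"
    have cur': "cur s' k m" by (simp add: cur_def s'_def)
    have acc: "?I k (Suc m) s'" if c: "m \<in> X" "G k m * s ''bk'' 0 < s ''bv'' 0 * (int k + 1)"
    proof -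
      \<comment> \<open>A candidate is accepted only if it is strictly better than everything seen
        so far. This gives the strict inequality for all smaller numbers of arcs.\<close>
      have "G k m * (int j + 1) < G j l * (int k + 1)" if jl: "lex_before k m j l" "l \<in> X" for j l
        using 11(3)
      proof (elim disjE exE conjE)
        assume "none k m"
        then show ?thesis using jl by (auto simp: none_def)
      next
        fix kb ub assume b: "best k m kb ub" "cur s kb ub"
        have "G k m * (int kb + 1) < G kb ub * (int k + 1)" using c b(2) by (simp add: cur_def)
        moreover have "G kb ub * (int j + 1) \<le> G j l * (int kb + 1)" using b(1) jl by (simp add: best_def)
        ultimately show ?thesis by (rule cross_mult_less_trans) auto
      qed
      then have "best k (Suc m) k m"
        using c 11(1) by (auto simp: best_def intro: less_imp_le)
      with cur' show ?thesis by blast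
    qed
    have rej: "?I k (Suc m) s" if c: "\<not> (m \<in> X \<and> G k m * s ''bk'' 0 < s ''bv'' 0 * (int k + 1))"
      using 11(3)
    proof (elim disjE exE conjE)
      assume a: "s ''bk'' 0 = 0" "s ''bv'' 0 = 1" "none k m"
      \<comment> \<open>Against the initial \<open>1 / 0\<close> the test reads
        \<open>0 < k + 1\<close>, so any active label would have been accepted.\<close>
      then have "m \<notin> X" using c by auto
      then have "none k (Suc m)" using a by (auto simp: none_def)
      then show ?thesis using a by blast
    next
      fix kb ub assume b: "best k m kb ub" "cur s kb ub"
      have "kb \<le> k" using b(1) by (auto simp: best_def lex_before_def)
      moreover have "G kb ub * (int k + 1) \<le> G k m * (int kb + 1)" if "m \<in> X"
        using c that b(2) by (simp add: cur_def)
      ultimately have "best k (Suc m) kb ub" using b(1) by (auto simp: best_def)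
      with b show ?thesis by blast
    qed
    show ?case
    proof (cases "m \<in> X \<and> G k m * s ''bk'' 0 < s ''bv'' 0 * (int k + 1)")
      case True
      then show ?thesis using acc 11(4,5) mX by (simp add: s'_def G_def)
    next
      case False
      then show ?thesis using rej[OF False] 11(4,5) mX by (auto simp: G_def)
    qed
  next
    case (7 k m s x)
    then show ?case by (simp add: cur_def)
  next
    case (8 k m s x)
    then show ?case by (simp add: cur_def)
  next
    case 9
    then show ?case using init by (simp add: none_def)
  next
    case (10 k s)
    have "lex_before k n j l \<longleftrightarrow> lex_before (Suc k) 0 j l" if "l \<in> X" for j l
      using X[OF that] by (simp add: lex_before_row)
    then have "none k n \<longleftrightarrow> none (Suc k) 0" "best k n kb ub \<longleftrightarrow> best (Suc k) 0 kb ub" for kb ub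
      unfolding none_def best_def by blast+
    then show ?case using 10(2) by simp
  qed simp_all
  then have fin: "(s ''bk'' 0 = 0 \<and> s ''bv'' 0 = 1 \<and> none n 0) \<or>
    (\<exists>kb ub. best n 0 kb ub \<and> cur s kb ub)" .
  show "s ''bk'' 0 = 0" if "X = {}"
    using fin that by (auto simp: best_def)
  show "\<exists>k u. k < n \<and> u \<in> X \<and> s ''bk'' 0 = int k + 1 \<and> s ''bu'' 0 = int u \<and>
      (\<forall>j l. j < n \<longrightarrow> l \<in> X \<longrightarrow> G k u * (int j + 1) \<le> G j l * (int k + 1)) \<and>
      (\<forall>j l. j < k \<longrightarrow> l \<in> X \<longrightarrow> G k u * (int j + 1) < G j l * (int k + 1))" if ne: "X \<noteq> {}"
  proof -
    obtain x where "x \<in> X" using ne by blast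
    moreover have "lex_before n 0 0 x" using X[OF \<open>x \<in> X\<close>] by simp
    ultimately have "\<not> none n 0" unfolding none_def by blast
    then obtain kb ub where "best n 0 kb ub" "cur s kb ub" using fin by blast
    then show ?thesis by (intro exI[of _ kb] exI[of _ ub]) (auto simp: best_def cur_def)
  qed
qed

lemma sem_backtrack:
  assumes size: "s0 ''size'' 0 = int n"
    and k: "s0 ''bk'' 0 = int k + 1" "s0 ''bu'' 0 = int u" "k < n"
  defines "s \<equiv> sem backtrack_prog s0"
  shows "s ''bt'' 0 = int u"
    and "\<And>i. i < k \<Longrightarrow> s ''bt'' (int i + 1) = s0 ''par'' (ix n (int k - int i) u (s ''bt'' (int i)))"
proof -
  define s1 where "s1 = set_cell ''bt'' 0 (int u) s0"
  have s1: "s1 x = s0 x" if "x \<noteq> ''bt''" for x using that by (simp add: s1_def)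
  have sz: "s1 ''size'' 0 = int n" using s1 size by simp
  let ?I = "\<lambda>m s. s ''bt'' 0 = int u \<and> (\<forall>i<k. i < m \<longrightarrow>
    s ''bt'' (int i + 1) = s0 ''par'' (ix n (int k - int i) (int u) (s ''bt'' (int i))))"
  have eq: "s = sem (LFor ''k'' (LCond (Less (Plus (Var ''k'') (Const 1)) (Var ''bk''))
        (LAssign ''bt'' (Plus (Var ''k'') (Const 1))
           (Cell ''par'' (Ix (Minus (Minus (Var ''bk'') (Const 1)) (Var ''k'')) (Var ''bu'')
              (Cell ''bt'' (Var ''k'')))))
        LSkip)) s1"
    unfolding s_def backtrack_prog_def s1_def using k by simp
  have "?I n s"
    unfolding eq
  proof (rule sem_LFor1[where I = ?I and st = s1, OF sz], goal_cases)
    case (6 m s)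
    have [simp]: "s ''par'' = s0 ''par''" "s ''size'' 0 = int n" "s ''bk'' 0 = int k + 1"
      "s ''bu'' 0 = int u"
      using size k by (simp_all add: 6 s1)
    show ?case
    proof (cases "m < k")
      case True
      then show ?thesis using 6(2,3) by (auto simp: less_Suc_eq)
    next
      case False
      then show ?thesis using 6(2,3) by auto
    qed
  qed (auto simp: s1_def)
  then show "s ''bt'' 0 = int u"
    and "\<And>i. i < k \<Longrightarrow> s ''bt'' (int i + 1) = s0 ''par'' (ix n (int k - int i) u (s ''bt'' (int i)))"
    using k(3) by auto
qed

lemma sem_vertices:
  assumes size: "s0 ''size'' 0 = int n" and i: "i < n"
  shows "sem vertices_prog s0 ''vs'' (int i) = s0 ''rp'' (s0 ''bt'' (int i))"
proof -
  let ?I = "\<lambda>k s. (\<forall>i<k. s ''vs'' (int i) = s0 ''rp'' (s0 ''bt'' (int i)))"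
  have "?I n (sem vertices_prog s0)"
    unfolding vertices_prog_def
  proof (rule sem_LFor1[where I = ?I and st = s0, OF size], goal_cases)
    case (6 k s)
    have [simp]: "s ''rp'' = s0 ''rp''" "s ''bt'' = s0 ''bt''" by (simp_all add: 6)
    show ?case using 6(1-3) by (auto simp: less_Suc_eq)
  qed auto
  then show ?thesis using i by auto
qed

lemma sem_merge:
  assumes size: "s0 ''size'' 0 = int n" and k: "s0 ''k'' 0 = int k"
    and ab: "s0 ''vs'' (int k + 1) = int a" "s0 ''vs'' (int k) = int b" "a < n" "b < n"
    and succ: "\<And>v. v < n \<Longrightarrow> s0 ''succ'' (int v) = int (\<sigma> v)"
    and cp: "\<And>v. v < n \<Longrightarrow> s0 ''cp'' (int v) = int (cp v)"
    and v: "v < n"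
  shows "sem merge_prog s0 ''succ'' (int v) = int (Transposition.transpose a b (\<sigma> v))"
    "sem merge_prog s0 ''cp'' (int v) = int (merge_labels a b cp v)"
proof -
  define body where "body = LSeq
        (LCond (BEq (Cell ''succ'' (Var ''v'')) (Var ''a''))
           (LAssign ''succ'' (Var ''v'') (Var ''b''))
           (LCond (BEq (Cell ''succ'' (Var ''v'')) (Var ''b''))
              (LAssign ''succ'' (Var ''v'') (Var ''a''))
              LSkip))
        (LCond (BEq (Cell ''cp'' (Var ''v'')) (Var ''cb''))
           (LAssign ''cp'' (Var ''v'') (Var ''ca''))
           LSkip)"
  define s1 where "s1 = set_cell ''cb'' 0 (int (cp b)) (set_cell ''ca'' 0 (int (cp a))
    (set_cell ''b'' 0 (int b) (set_cell ''a'' 0 (int a) s0)))"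
  have eq: "sem merge_prog s0 = sem (LFor ''v'' body) s1"
    unfolding merge_prog_def body_def s1_def using k ab cp by simp
  have writes: "writes body = {''succ'', ''cp''}" by (auto simp: body_def)
  have sz: "s1 ''size'' 0 = int n" using size by (simp add: s1_def)
  let ?I = "\<lambda>m s. (\<forall>v<n. s ''succ'' (int v) = int (if v < m then Transposition.transpose a b (\<sigma> v) else \<sigma> v)) \<and>
    (\<forall>v<n. s ''cp'' (int v) = int (if v < m then merge_labels a b cp v else cp v))"
  have "?I n (sem (LFor ''v'' body) s1)"
  proof (rule sem_LFor1[where I = ?I and st = s1, OF sz], goal_cases)
    case (6 m s)
    have [simp]: "s ''a'' 0 = int a" "s ''b'' 0 = int b" "s ''ca'' 0 = int (cp a)" "s ''cb'' 0 = int (cp b)"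
      by (simp_all add: 6 writes) (simp_all add: s1_def)
    have m: "s ''succ'' (int m) = int (\<sigma> m)" "s ''cp'' (int m) = int (cp m)" using 6(1,2) by auto
    have "sem body s ''succ'' = (s ''succ'')(int m := int (Transposition.transpose a b (\<sigma> m)))"
      using 6(3) m by (auto simp: body_def Transposition.transpose_def fun_eq_iff)
    moreover have "sem body s ''cp'' = (s ''cp'')(int m := int (merge_labels a b cp m))"
      using 6(3) m by (auto simp: body_def merge_labels_def fun_eq_iff)
    ultimately show ?case using 6(2) by (auto simp: less_Suc_eq)
  qed (use succ cp in \<open>auto simp: writes s1_def\<close>)
  then show "sem merge_prog s0 ''succ'' (int v) = int (Transposition.transpose a b (\<sigma> v))"
    "sem merge_prog s0 ''cp'' (int v) = int (merge_labels a b cp v)"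
    unfolding eq using v by auto
qed

text \<open>Passes from \<open>J\<close> on are idle, hence \<open>min m J\<close> in the invariant.
  \<open>vs\<close> is constrained only for positive \<open>J\<close>, as it holds arbitrary values
  when nothing has been selected.\<close>

lemma sem_merges:
  assumes size: "s0 ''size'' 0 = int n"
    and J: "nat (s0 ''J'' 0) = J" "J \<le> n"
    and vs: "\<And>i. 0 < J \<Longrightarrow> i \<le> J \<Longrightarrow> s0 ''vs'' (int i) = int (vs i) \<and> vs i < n"
    and succ: "\<And>v. v < n \<Longrightarrow> s0 ''succ'' (int v) = int (\<sigma> v)"
    and cp: "\<And>v. v < n \<Longrightarrow> s0 ''cp'' (int v) = int (cp v)"
    and v: "v < n"
  shows "sem merges_prog s0 ''succ'' (int v) = int (fst (merges vs J (\<sigma>, cp)) v)"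
    "sem merges_prog s0 ''cp'' (int v) = int (snd (merges vs J (\<sigma>, cp)) v)"
proof -
  let ?I = "\<lambda>m s. (\<forall>v<n. s ''succ'' (int v) = int (fst (merges vs (min m J) (\<sigma>, cp)) v)) \<and>
    (\<forall>v<n. s ''cp'' (int v) = int (snd (merges vs (min m J) (\<sigma>, cp)) v))"
  have writes: "writes merge_prog = {''a'', ''b'', ''ca'', ''cb'', ''v'', ''succ'', ''cp''}"
    by (auto simp: merge_prog_def)
  have "?I n (sem merges_prog s0)"
    unfolding merges_prog_def
  proof (rule sem_LFor1[where I = ?I and st = s0, OF size], goal_cases)
    case (6 m s)
    have fr: "s ''J'' = s0 ''J''" "s ''vs'' = s0 ''vs''" "s ''size'' 0 = int n"
      using size by (simp_all add: 6 writes)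
    have cond: "bval (Less (Var ''k'') (Var ''J'')) s \<longleftrightarrow> m < J" using 6(3) fr J(1) by auto
    show ?case
    proof (cases "m < J")
      case True
      have "s ''vs'' (int (Suc m)) = int (vs (Suc m)) \<and> vs (Suc m) < n"
        unfolding fr by (rule vs) (use True in auto)
      moreover have "s ''vs'' (int m) = int (vs m) \<and> vs m < n"
        unfolding fr by (rule vs) (use True in auto)
      ultimately have a: "s ''vs'' (int m + 1) = int (vs (Suc m))" "s ''vs'' (int m) = int (vs m)"
        "vs (Suc m) < n" "vs m < n" by (simp_all add: add.commute)
      have mn: "min m J = m" "min (Suc m) J = Suc m" using True by auto
      have pre: "\<And>v. v < n \<Longrightarrow> s ''succ'' (int v) = int (fst (merges vs m (\<sigma>, cp)) v)"
        "\<And>v. v < n \<Longrightarrow> s ''cp'' (int v) = int (snd (merges vs m (\<sigma>, cp)) v)"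
        using 6(2) mn by auto
      note m = sem_merge[where ?s0.0 = s, OF fr(3) 6(3) a pre]
      have "sem (LCond (Less (Var ''k'') (Var ''J'')) merge_prog LSkip) s = sem merge_prog s"
        using cond True by simp
      then show ?thesis using m mn by simp
    next
      case False
      then have mn: "min m J = J" "min (Suc m) J = J" by auto
      have "sem (LCond (Less (Var ''k'') (Var ''J'')) merge_prog LSkip) s = s"
        using cond False by simp
      then show ?thesis using 6(2) mn by simp
    qed
  qed (use succ cp in \<open>auto simp: writes\<close>)
  then show "sem merges_prog s0 ''succ'' (int v) = int (fst (merges vs J (\<sigma>, cp)) v)"
    "sem merges_prog s0 ''cp'' (int v) = int (snd (merges vs J (\<sigma>, cp)) v)"
    using v J(2) by (auto simp: min_def)
qed

section \<open>Assembling the phases into rounds\<close>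

lemma writes_progs:
  "writes denominators_prog = {''u'', ''v'', ''P''}"
  "writes weights_prog = {''u'', ''v'', ''W''}"
  "writes init_prog = {''v'', ''succ'', ''cp''}"
  "writes clear_prog = {''u'', ''rp''}"
  "writes reps_prog = {''u'', ''v'', ''rp'', ''mate''}"
  "writes base_prog = {''u'', ''v'', ''D''}"
  "writes dp_prog = {''k'', ''u'', ''v'', ''x'', ''D'', ''par''}"
  "writes select_init_prog = {''bv'', ''bk'', ''bu''}"
  "writes select_prog = {''k'', ''u'', ''bv'', ''bk'', ''bu''}"
  "writes backtrack_prog = {''k'', ''bt''}"
  "writes vertices_prog = {''k'', ''vs''}"
  "writes loop_prog = {''vs'', ''J''}"
  "writes merges_prog = {''k'', ''a'', ''b'', ''ca'', ''cb'', ''v'', ''succ'', ''cp''}"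
  by (auto simp: prog_defs)

lemma min_plus_dp_value:
  assumes "finite A" "A \<noteq> {}"
  shows "min_plus A (\<lambda>k u v. real_of_int (dp_value A d k u v))"
proof
  show "finite A" by (rule assms)
  fix x z k assume x: "x \<in> A" and z: "z \<in> A"
  have ins: "insert x A = A" using x by auto
  have val: "dp_value A d (Suc k) x z = Min ((\<lambda>y. dp_value A d k x y + d y z) ` A)"
    by (simp add: ins)
  show "real_of_int (dp_value A d (Suc k) x z)
      \<le> real_of_int (dp_value A d k x y) + real_of_int (dp_value A d 0 y z)" if "y \<in> A" for y
  proof -
    have "dp_value A d (Suc k) x z \<le> dp_value A d k x y + d y z"
      unfolding val using that assms by (intro Min_le) auto
    then show ?thesis by simp
  qed
  have "Min ((\<lambda>y. dp_value A d k x y + d y z) ` A) \<in> (\<lambda>y. dp_value A d k x y + d y z) ` A"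
    using assms by (intro Min_in) auto
  then obtain y where "y \<in> A" "dp_value A d (Suc k) x z = dp_value A d k x y + d y z"
    unfolding val by auto
  then show "\<exists>y\<in>A. real_of_int (dp_value A d (Suc k) x z)
      = real_of_int (dp_value A d k x y) + real_of_int (dp_value A d 0 y z)"
    by (intro bexI[of _ y]) auto
qed

text \<open>\<open>p\<close> is the number of labels charged to the round: 0 if none is active, 1
  for a loop, and one less than the number of arcs for a longer cycle. The weight bound has the
  shape that \<open>harm_diff_ge\<close> turns into a telescoping difference.\<close>

lemma sem_round:
  fixes c :: "nat \<Rightarrow> nat \<Rightarrow> real"
  assumes c: "asym_metric {..<n} c"
    and f: "f permutes {..<n}" "\<And>u v. u < n \<Longrightarrow> v < n \<Longrightarrow> tm u = tm v \<Longrightarrow> v \<in> orbit f u"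
    and size: "s0 ''size'' 0 = int n"
    and tm: "\<And>v. v < n \<Longrightarrow> s0 ''term'' (int v) = int (tm v)"
    and W: "\<And>u v. u < n \<Longrightarrow> v < n \<Longrightarrow> real_of_int (s0 ''W'' (ix n 0 u v)) = c u v"
    and cons: "consistent n \<sigma> cp"
    and succ: "\<And>v. v < n \<Longrightarrow> s0 ''succ'' (int v) = int (\<sigma> v)"
    and cp: "\<And>v. v < n \<Longrightarrow> s0 ''cp'' (int v) = int (cp v)"
  shows "\<exists>\<sigma>' cp' p. consistent n \<sigma>' cp' \<and>
    (\<forall>v<n. sem round_prog s0 ''succ'' (int v) = int (\<sigma>' v)) \<and>
    (\<forall>v<n. sem round_prog s0 ''cp'' (int v) = int (cp' v)) \<and>
    card (active n tm cp') + p \<le> card (active n tm cp) \<and>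
    (if active n tm cp = {} then \<sigma>' = \<sigma> else 0 < p) \<and>
    ((\<Sum>v<n. c v (\<sigma>' v)) - (\<Sum>v<n. c v (\<sigma> v))) * real (card (active n tm cp))
      \<le> 2 * real p * (\<Sum>v<n. c v (f v))"
proof -
  let ?A = "active n tm cp"
  have cp_n: "cp v < n" if "v < n" for v using cons that by (simp add: consistent_def)
  have An: "l < n" if "l \<in> ?A" for l using that cp_n by (auto simp: active_def)
  have finA: "finite ?A" using An by (metis finite_nat_set_iff_bounded)
  define s1 where "s1 = sem clear_prog s0"
  define s2 where "s2 = sem reps_prog s1"
  define s3 where "s3 = sem base_prog s2"
  define s4 where "s4 = sem dp_prog s3"
  define s5 where "s5 = sem select_init_prog s4"
  define s6 where "s6 = sem select_prog s5"
  define s7 where "s7 = sem backtrack_prog s6"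
  define s8 where "s8 = sem vertices_prog s7"
  define s9 where "s9 = sem loop_prog s8"
  have round: "sem round_prog s0 = sem merges_prog s9"
    by (simp add: round_prog_def s1_def s2_def s3_def s4_def s5_def s6_def s7_def s8_def s9_def)
  have f1: "s1 x = s0 x" if "x \<notin> {''u'', ''rp''}" for x
    unfolding s1_def using that by (intro sem_not_written) (simp add: writes_progs)
  have f2: "s2 x = s1 x" if "x \<notin> {''u'', ''v'', ''rp'', ''mate''}" for x
    unfolding s2_def using that by (intro sem_not_written) (simp add: writes_progs)
  have f3: "s3 x = s2 x" if "x \<notin> {''u'', ''v'', ''D''}" for x
    unfolding s3_def using that by (intro sem_not_written) (simp add: writes_progs)
  have f4: "s4 x = s3 x" if "x \<notin> {''k'', ''u'', ''v'', ''x'', ''D'', ''par''}" for x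
    unfolding s4_def using that by (intro sem_not_written) (simp add: writes_progs)
  have f5: "s5 x = s4 x" if "x \<notin> {''bv'', ''bk'', ''bu''}" for x
    unfolding s5_def using that by (intro sem_not_written) (simp add: writes_progs)
  have f6: "s6 x = s5 x" if "x \<notin> {''k'', ''u'', ''bv'', ''bk'', ''bu''}" for x
    unfolding s6_def using that by (intro sem_not_written) (simp add: writes_progs)
  have f7: "s7 x = s6 x" if "x \<notin> {''k'', ''bt''}" for x
    unfolding s7_def using that by (intro sem_not_written) (simp add: writes_progs)
  have f8: "s8 x = s7 x" if "x \<notin> {''k'', ''vs''}" for x
    unfolding s8_def using that by (intro sem_not_written) (simp add: writes_progs)
  have f9: "s9 x = s8 x" if "x \<notin> {''vs'', ''J''}" for x
    unfolding s9_def using that by (intro sem_not_written) (simp add: writes_progs)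
  have sz: "s1 ''size'' 0 = int n" "s2 ''size'' 0 = int n" "s3 ''size'' 0 = int n"
    "s4 ''size'' 0 = int n" "s5 ''size'' 0 = int n" "s6 ''size'' 0 = int n"
    "s7 ''size'' 0 = int n" "s8 ''size'' 0 = int n" "s9 ''size'' 0 = int n"
    using size by (simp_all add: f1 f2 f3 f4 f5 f6 f7 f8 f9)
  have succ9: "s9 ''succ'' (int v) = int (\<sigma> v)" "s9 ''cp'' (int v) = int (cp v)" if "v < n" for v
    using succ cp that by (simp_all add: f1 f2 f3 f4 f5 f6 f7 f8 f9)
  obtain rp mate where
    inact: "\<And>l. l < n \<Longrightarrow> l \<notin> ?A \<Longrightarrow> s2 ''rp'' (int l) = int n" and
    act: "\<And>l. l \<in> ?A \<Longrightarrow> s2 ''rp'' (int l) = int (rp l) \<and> s2 ''mate'' (int l) = int (mate l) \<and>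
       rp l < n \<and> cp (rp l) = l \<and> mate l < n \<and> tm (mate l) = tm (rp l) \<and> cp (mate l) \<noteq> l"
  proof (rule sem_reps[where ?s0.0 = s1 and tm = tm and cp = cp, OF sz(1)])
    show "s1 ''term'' (int v) = int (tm v)" if "v < n" for v using tm that by (simp add: f1)
    show "s1 ''cp'' (int v) = int (cp v) \<and> cp v < n" if "v < n" for v
      using cp cp_n that by (simp add: f1)
    show "s1 ''rp'' (int v) = int n" if "v < n" for v
      unfolding s1_def using size that by (rule sem_clear)
  qed (use that in \<open>auto simp: s2_def\<close>)
  interpret R: merge_round n c tm \<sigma> cp rp mate f
    using c f cons act by (intro merge_round.intro merge_round_axioms.intro) auto
  have rp_frame: "s3 ''rp'' = s2 ''rp''" "s5 ''rp'' = s2 ''rp''" "s7 ''rp'' = s2 ''rp''" "s8 ''rp'' = s2 ''rp''"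
    "s8 ''mate'' = s2 ''mate''" "s5 ''D'' = s4 ''D''" "s6 ''par'' = s4 ''par''" "s2 ''W'' = s0 ''W''"
    by (simp_all add: f1 f2 f3 f4 f5 f6 f7 f8)
  have X: "{x. x < n \<and> s2 ''rp'' (int x) < int n} = ?A"
    using inact act An by force
  define d where "d u v = s3 ''D'' (ix n 0 (int u) (int v))" for u v :: nat
  have d_eq: "real_of_int (d l l') = R.W l l'" if l: "l \<in> ?A" "l' \<in> ?A" for l l'
    unfolding d_def s3_def sem_base[where ?s0.0 = s2, OF sz(2) An[OF l(1)] An[OF l(2)]] R.W_def rp_frame
    using act[OF l(1)] act[OF l(2)] W by simp
  define D where "D k u v = real_of_int (dp_value ?A d k u v)" for k u v
  have dpD: "s4 ''D'' (ix n (int j) u v) = dp_value ?A d j u v" if "j \<le> n" "u < n" "v < n" for j u v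
    using sem_dp(1)[where ?s0.0 = s3, OF sz(3) that] unfolding rp_frame X s4_def d_def .
  have dpP: "\<exists>x\<in>insert u ?A. s4 ''par'' (ix n (int j + 1) u v) = int x \<and>
      dp_value ?A d (Suc j) u v = dp_value ?A d j u x + d x v" if "j < n" "u < n" "v < n" for j u v
    using sem_dp(2)[where ?s0.0 = s3, OF sz(3) that] unfolding rp_frame X s4_def d_def .
  have init5: "s5 ''bv'' 0 = 1" "s5 ''bk'' 0 = 0"
    by (simp_all add: s5_def select_init_prog_def)
  show ?thesis
  proof (cases "?A = {}")
    case True
    \<comment> \<open>Nothing is selected, \<open>J\<close> becomes \<open>-1\<close>, and no merge
      is carried out, whatever \<open>vs\<close> holds.\<close>
    have "s6 ''bk'' 0 = 0"
      unfolding s6_def by (rule sem_select(1)[where ?s0.0 = s5, OF sz(5) init5]) (simp add: rp_frame X True)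
    then have "s8 ''bk'' 0 = 0" by (simp add: f7 f8)
    then have "s9 ''J'' 0 = -1" by (simp add: s9_def loop_prog_def)
    then have J: "nat (s9 ''J'' 0) = 0" by simp
    have m: "sem merges_prog s9 ''succ'' (int v) = int (\<sigma> v)"
      "sem merges_prog s9 ''cp'' (int v) = int (cp v)" if "v < n" for v
      using sem_merges[where ?s0.0 = s9, OF sz(9) J _ _ succ9, of id v] that by simp_all
    show ?thesis
      unfolding round
      by (rule exI[of _ \<sigma>], rule exI[of _ cp], rule exI[of _ 0]) (use cons m True in simp)
  next
    case False
    note ne = False
    note mp = min_plus_dp_value[OF finA False, of d, folded D_def]
    have sel: "\<exists>k u. k < n \<and> u \<in> ?A \<and> s6 ''bk'' 0 = int k + 1 \<and> s6 ''bu'' 0 = int u \<and>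
      (\<forall>j l. j < n \<longrightarrow> l \<in> ?A \<longrightarrow> s4 ''D'' (ix n (int k) u u) * (int j + 1) \<le> s4 ''D'' (ix n (int j) l l) * (int k + 1)) \<and>
      (\<forall>j l. j < k \<longrightarrow> l \<in> ?A \<longrightarrow> s4 ''D'' (ix n (int k) u u) * (int j + 1) < s4 ''D'' (ix n (int j) l l) * (int k + 1))"
      using sem_select(2)[where ?s0.0 = s5, OF sz(5) init5] False unfolding rp_frame X s6_def by blast
    then obtain k u where k: "k < n" and u: "u \<in> ?A" and bk: "s6 ''bk'' 0 = int k + 1"
      and bu: "s6 ''bu'' 0 = int u"
      and le: "\<And>j l. j < n \<Longrightarrow> l \<in> ?A \<Longrightarrow> s4 ''D'' (ix n (int k) u u) * (int j + 1) \<le> s4 ''D'' (ix n (int j) l l) * (int k + 1)"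
      and less: "\<And>j l. j < k \<Longrightarrow> l \<in> ?A \<Longrightarrow> s4 ''D'' (ix n (int k) u u) * (int j + 1) < s4 ''D'' (ix n (int j) l l) * (int k + 1)"
      by blast
    have un: "u < n" using An u by simp
    have Dk: "s4 ''D'' (ix n (int j) l l) = dp_value ?A d j l l" if "j < n" "l \<in> ?A" for j l
      using dpD An that by simp
    have best: "D k u u * real (Suc j) \<le> D j l l * real (Suc k)" if "l \<in> ?A" "j < n" for j l
    proof -
      have "dp_value ?A d k u u * (int j + 1) \<le> dp_value ?A d j l l * (int k + 1)"
        using le[OF that(2,1)] Dk k u that by simp
      then have "real_of_int (dp_value ?A d k u u * (int j + 1)) \<le> real_of_int (dp_value ?A d j l l * (int k + 1))"
        by (simp only: of_int_le_iff)
      then show ?thesis by (simp add: D_def add.commute)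
    qed
    have first: "D k u u * real (Suc j) < D j l l * real (Suc k)" if "l \<in> ?A" "j < k" for j l
    proof -
      have "dp_value ?A d k u u * (int j + 1) < dp_value ?A d j l l * (int k + 1)"
        using less[OF that(2,1)] Dk k u that by simp
      then have "real_of_int (dp_value ?A d k u u * (int j + 1)) < real_of_int (dp_value ?A d j l l * (int k + 1))"
        by (simp only: of_int_less_iff)
      then show ?thesis by (simp add: D_def add.commute)
    qed
    have D0: "D 0 l l' = R.W l l'" if "l \<in> ?A" "l' \<in> ?A" for l l'
      using d_eq[OF that] by (simp add: D_def)
    have bk8: "s8 ''bk'' 0 = int k + 1" "s8 ''bu'' 0 = int u" using bk bu by (simp_all add: f7 f8)
    show ?thesis
    proof (cases "k = 0")
      case True
      define vs where "vs i = (if i = 0 then mate u else rp u)" for i :: nat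
      have J: "nat (s9 ''J'' 0) = 1" using bk8 True by (simp add: s9_def loop_prog_def)
      have "s9 ''vs'' (int i) = int (vs i) \<and> vs i < n" if "i \<le> 1" for i
      proof -
        have "i = 0 \<or> i = 1" using that by auto
        then show ?thesis
          using bk8 True act[OF u] by (auto simp: s9_def loop_prog_def vs_def rp_frame)
      qed
      then have m: "sem merges_prog s9 ''succ'' (int v) = int (fst (merges vs 1 (\<sigma>, cp)) v)"
        "sem merges_prog s9 ''cp'' (int v) = int (snd (merges vs 1 (\<sigma>, cp)) v)" if "v < n" for v
        using sem_merges[where ?s0.0 = s9, OF sz(9) J _ _ succ9, of vs v] that k by auto
      have v01: "vs 0 = mate u" "vs 1 = rp u" by (simp_all add: vs_def)
      note loop = R.merge_loop[OF mp D0 u best True v01]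
      show ?thesis
        unfolding round
        by (rule exI[of _ "fst (merges vs 1 (\<sigma>, cp))"], rule exI[of _ "snd (merges vs 1 (\<sigma>, cp))"],
            rule exI[of _ 1]) (use m loop ne in \<open>simp del: merges.simps One_nat_def\<close>)
    next
      case False
      define bt where "bt i = nat (s7 ''bt'' (int i))" for i
      have bt0: "s7 ''bt'' 0 = int u"
        unfolding s7_def by (rule sem_backtrack(1)[where ?s0.0 = s6, OF sz(6) bk bu k])
      have bt_Suc: "s7 ''bt'' (int i + 1) = s4 ''par'' (ix n (int k - int i) u (s7 ''bt'' (int i)))"
        if "i < k" for i
        using sem_backtrack(2)[where ?s0.0 = s6, OF sz(6) bk bu k that] unfolding rp_frame s7_def .
      \<comment> \<open>Parents lie in \<open>insert u A\<close>, which is \<open>A\<close> because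
        \<open>u\<close> is active. So backtracking never leaves the active labels, and the integers
        found in \<open>bt\<close> are labels.\<close>
      have bt_step: "bt (Suc i) \<in> ?A \<and> s7 ''bt'' (int (Suc i)) = int (bt (Suc i)) \<and>
          dp_value ?A d (k - i) u (bt i) = dp_value ?A d (k - Suc i) u (bt (Suc i)) + d (bt (Suc i)) (bt i)"
        if i: "i < k" "bt i \<in> ?A" "s7 ''bt'' (int i) = int (bt i)" for i
      proof -
        have j: "k - Suc i < n" "int (k - Suc i) + 1 = int k - int i" "Suc (k - Suc i) = k - i"
          using i k by auto
        obtain x where x: "x \<in> insert u ?A" "s4 ''par'' (ix n (int k - int i) u (bt i)) = int x"
          "dp_value ?A d (k - i) u (bt i) = dp_value ?A d (k - Suc i) u x + d x (bt i)"
          using dpP[OF j(1) un An[OF i(2)]] unfolding j(2,3) by blast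
        have eq: "s7 ''bt'' (int (Suc i)) = int x"
          using bt_Suc[OF i(1)] x(2) i(3) by (simp add: add.commute)
        then have "bt (Suc i) = x" by (simp add: bt_def)
        then show ?thesis using x(1,3) eq u by auto
      qed
      have btA: "bt i \<in> ?A \<and> s7 ''bt'' (int i) = int (bt i)" if "i \<le> k" for i
        using that
      proof (induction i)
        case 0
        then show ?case using bt0 u by (simp add: bt_def)
      next
        case (Suc i)
        then show ?case using bt_step[of i] by simp
      qed
      define vs where "vs i = rp (bt i)" for i
      have J: "nat (s9 ''J'' 0) = k" using bk8 False by (simp add: s9_def loop_prog_def)
      have vs9: "s9 ''vs'' = s8 ''vs''" using bk8 False by (simp add: s9_def loop_prog_def)
      have "s9 ''vs'' (int i) = int (vs i) \<and> vs i < n" if i: "i \<le> k" for i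
      proof -
        have "s8 ''vs'' (int i) = s7 ''rp'' (s7 ''bt'' (int i))"
          unfolding s8_def using i k by (intro sem_vertices[where ?s0.0 = s7, OF sz(7)]) simp
        then show ?thesis using btA[OF i] act[of "bt i"] by (simp add: vs9 vs_def rp_frame)
      qed
      then have m: "sem merges_prog s9 ''succ'' (int v) = int (fst (merges vs k (\<sigma>, cp)) v)"
        "sem merges_prog s9 ''cp'' (int v) = int (snd (merges vs k (\<sigma>, cp)) v)" if "v < n" for v
        using sem_merges[where ?s0.0 = s9, OF sz(9) J _ _ succ9, of vs v] that k by auto
      have k0: "0 < k" using False by simp
      have bt_u: "bt 0 = u" using bt0 by (simp add: bt_def)
      have bt_mem: "bt i \<in> ?A" if "i \<le> k" for i using btA[OF that] by blast
      have step: "D (k - i) u (bt i) = D (k - Suc i) u (bt (Suc i)) + D 0 (bt (Suc i)) (bt i)"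
        if "i < k" for i
        using bt_step[of i] btA[of i] that by (simp add: D_def)
      have vs_eq: "vs i = rp (bt i)" if "i \<le> k" for i by (simp add: vs_def)
      note cyc = R.merge_cycle[OF mp D0 u best k0 bt_u bt_mem step first vs_eq]
      show ?thesis
        unfolding round
        by (rule exI[of _ "fst (merges vs k (\<sigma>, cp))"], rule exI[of _ "snd (merges vs k (\<sigma>, cp))"],
            rule exI[of _ k]) (use m cyc False ne in simp)
    qed
  qed
qed

lemma sem_rounds:
  fixes c :: "nat \<Rightarrow> nat \<Rightarrow> real"
  assumes c: "asym_metric {..<n} c"
    and f: "f permutes {..<n}" "\<And>u v. u < n \<Longrightarrow> v < n \<Longrightarrow> tm u = tm v \<Longrightarrow> v \<in> orbit f u"
    and size: "s0 ''size'' 0 = int n"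
    and tm: "\<And>v. v < n \<Longrightarrow> s0 ''term'' (int v) = int (tm v)"
    and W: "\<And>u v. u < n \<Longrightarrow> v < n \<Longrightarrow> real_of_int (s0 ''W'' (ix n 0 u v)) = c u v"
    and succ: "\<And>v. v < n \<Longrightarrow> s0 ''succ'' (int v) = int v"
    and cp: "\<And>v. v < n \<Longrightarrow> s0 ''cp'' (int v) = int v"
  obtains \<sigma> where "\<sigma> permutes {..<n}"
    "\<forall>v<n. sem (LFor ''r'' round_prog) s0 ''succ'' (int v) = int (\<sigma> v)"
    "\<forall>u<n. \<forall>v<n. tm u = tm v \<longrightarrow> v \<in> orbit \<sigma> u"
    "(\<Sum>v<n. c v (\<sigma> v)) \<le> 2 * harm n * (\<Sum>v<n. c v (f v))"
proof -
  interpret asym_metric "{..<n}" c by (rule c)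
  define opt where "opt = (\<Sum>v<n. c v (f v))"
  have opt: "0 \<le> opt" unfolding opt_def
    using f(1) by (intro sum_nonneg nonneg) (auto simp: permutes_lessThan)
  \<comment> \<open>The weight spent is paid by the harmonic numbers used up: it is 0 for the
    identity, and the bound reaches \<open>2 * opt * harm n\<close> when no label is active, as
    \<open>harm 0 = 0\<close>. The bound \<open>n - r\<close> on the active labels forces this after
    \<open>n\<close> rounds.\<close>
  define good where "good r s \<sigma> cp \<longleftrightarrow> consistent n \<sigma> cp \<and> (\<forall>v<n. s ''succ'' (int v) = int (\<sigma> v)) \<and>
    (\<forall>v<n. s ''cp'' (int v) = int (cp v)) \<and> card (active n tm cp) \<le> n - r \<and>
    (\<Sum>v<n. c v (\<sigma> v)) \<le> 2 * opt * (harm n - harm (card (active n tm cp)))"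
    for r and s :: store and \<sigma> cp
  have writes: "''r'' \<notin> writes round_prog" "''size'' \<notin> writes round_prog"
    "''term'' \<notin> writes round_prog" "''W'' \<notin> writes round_prog"
    by (simp_all add: round_prog_def writes_progs)
  let ?I = "\<lambda>r s. \<exists>\<sigma> cp. good r s \<sigma> cp"
  have "?I n (sem (LFor ''r'' round_prog) s0)"
  proof (rule sem_LFor1[where I = ?I and st = s0, OF size])
    fix r s assume r: "r < n" "?I r s" "s ''r'' 0 = int r"
      and frame: "\<And>x. x \<noteq> ''r'' \<Longrightarrow> x \<notin> writes round_prog \<Longrightarrow> s x = s0 x"
    obtain \<sigma> cp where g: "consistent n \<sigma> cp" "\<And>v. v < n \<Longrightarrow> s ''succ'' (int v) = int (\<sigma> v)"
      "\<And>v. v < n \<Longrightarrow> s ''cp'' (int v) = int (cp v)" "card (active n tm cp) \<le> n - r"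
      "(\<Sum>v<n. c v (\<sigma> v)) \<le> 2 * opt * (harm n - harm (card (active n tm cp)))"
      using r(2) unfolding good_def by blast
    have fr: "s ''size'' = s0 ''size''" "s ''term'' = s0 ''term''" "s ''W'' = s0 ''W''"
      by (simp_all add: frame writes)
    have "s ''size'' 0 = int n" "\<And>v. v < n \<Longrightarrow> s ''term'' (int v) = int (tm v)"
      "\<And>u v. u < n \<Longrightarrow> v < n \<Longrightarrow> real_of_int (s ''W'' (ix n 0 u v)) = c u v"
      unfolding fr using size tm W by blast+
    from sem_round[where ?s0.0 = s, OF c f this g(1-3)]
    obtain \<sigma>' cp' p where h: "consistent n \<sigma>' cp'"
      "\<forall>v<n. sem round_prog s ''succ'' (int v) = int (\<sigma>' v)"
      "\<forall>v<n. sem round_prog s ''cp'' (int v) = int (cp' v)"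
      "card (active n tm cp') + p \<le> card (active n tm cp)"
      "if active n tm cp = {} then \<sigma>' = \<sigma> else 0 < p"
      "((\<Sum>v<n. c v (\<sigma>' v)) - (\<Sum>v<n. c v (\<sigma> v))) * real (card (active n tm cp)) \<le> 2 * real p * opt"
      unfolding opt_def by blast
    let ?m = "card (active n tm cp)" and ?m' = "card (active n tm cp')"
    have finA: "finite (active n tm cp)"
      using active_subset[of n cp tm] g(1) finite_subset by (auto simp: consistent_def)
    have card: "?m' \<le> n - Suc r"
    proof (cases "active n tm cp = {}")
      case True
      then show ?thesis using h(4) by simp
    next
      case False
      then show ?thesis using h(4,5) g(4) by simp
    qed
    have "(\<Sum>v<n. c v (\<sigma>' v)) - (\<Sum>v<n. c v (\<sigma> v)) \<le> 2 * opt * (harm ?m - harm ?m')"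
    proof (cases "?m = 0")
      case True
      then have A: "active n tm cp = {}" using finA by simp
      then have "\<sigma>' = \<sigma>" "?m' = 0" using h(4,5) True by auto
      then show ?thesis using True by simp
    next
      case False
      have "((\<Sum>v<n. c v (\<sigma>' v)) - (\<Sum>v<n. c v (\<sigma> v))) * real ?m \<le> 2 * opt * real p"
        using h(6) by (simp add: mult_ac)
      also have "\<dots> \<le> 2 * opt * (real ?m * (harm ?m - harm ?m'))"
        using opt harm_diff_ge[OF h(4)] by (intro mult_left_mono) auto
      also have "\<dots> = (2 * opt * (harm ?m - harm ?m')) * real ?m" by (simp only: mult_ac)
      finally have "((\<Sum>v<n. c v (\<sigma>' v)) - (\<Sum>v<n. c v (\<sigma> v))) * real ?m
        \<le> (2 * opt * (harm ?m - harm ?m')) * real ?m" .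
      then show ?thesis using False by (simp add: mult_le_cancel_right)
    qed
    then have "(\<Sum>v<n. c v (\<sigma>' v)) \<le> 2 * opt * (harm n - harm ?m')"
      using g(5) by (simp add: right_diff_distrib)
    then have "good (Suc r) (sem round_prog s) \<sigma>' cp'"
      unfolding good_def using h(1-3) card by blast
    then show "?I (Suc r) (sem round_prog s)" by blast
  next
    have "consistent n id id"
      unfolding consistent_def using orbit_eq_singleton_iff[of "id :: nat \<Rightarrow> nat"] by (auto simp: permutes_id)
    moreover have "card (active n tm id) \<le> n"
      using active_subset[of n id tm] subset_eq_atLeast0_lessThan_card[of _ n]
      by (metis card_lessThan card_mono finite_lessThan id_apply)
    moreover then have "harm (card (active n tm id)) \<le> (harm n :: real)" by (rule harm_mono)
    ultimately have "good 0 s0 id id"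
      unfolding good_def using succ cp opt by (simp add: self_zero)
    then show "?I 0 s0" by blast
  qed (simp_all add: writes good_def)
  then obtain \<sigma> cp where g: "good n (sem (LFor ''r'' round_prog) s0) \<sigma> cp" by blast
  then have cons: "consistent n \<sigma> cp" and "card (active n tm cp) = 0" by (auto simp: good_def)
  moreover have "finite (active n tm cp)"
    using active_subset[of n cp tm] cons finite_subset by (auto simp: consistent_def)
  ultimately have empty: "active n tm cp = {}" by simp
  have same: "v \<in> orbit \<sigma> u" if uv: "u < n" "v < n" "tm u = tm v" for u v
  proof -
    have "cp u = cp v"
    proof (rule ccontr)
      assume "cp u \<noteq> cp v"
      then have "cp u \<in> active n tm cp"
        unfolding active_def using uv by (intro CollectI exI[of _ u] exI[of _ v]) auto
      then show False using empty by simp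
    qed
    then show ?thesis using cons uv by (simp add: consistent_def)
  qed
  show ?thesis
  proof (rule that[of \<sigma>])
    show "\<sigma> permutes {..<n}" using cons by (simp add: consistent_def)
    show "\<forall>v<n. sem (LFor ''r'' round_prog) s0 ''succ'' (int v) = int (\<sigma> v)"
      using g by (simp add: good_def)
    show "\<forall>u<n. \<forall>v<n. tm u = tm v \<longrightarrow> v \<in> orbit \<sigma> u" using same by blast
    show "(\<Sum>v<n. c v (\<sigma> v)) \<le> 2 * harm n * (\<Sum>v<n. c v (f v))"
      using g empty opt_def by (simp add: good_def harm_def mult_ac)
  qed
qed

section \<open>The approximation algorithm\<close>

text \<open>A single cycle through all vertices respects every collection of terminal sets. It shows
  that solutions exist, so that the minimum in \<open>opt\<close> is attained.\<close>

lemma all_in_orbit_cycle_of_list: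
  assumes "u < n" "v < n"
  shows "v \<in> orbit (cycle_of_list [0..<n]) u"
proof -
  let ?g = "cycle_of_list [0..<n]"
  have g: "permutation ?g" by (rule permutation_of_cycle)
  have "x \<in> orbit ?g 0" if "x < n" for x
  proof -
    have "map (?g ^^ x) [0..<n] = rotate x [0..<n]" by (rule cyclic_rotation) simp
    then have "(?g ^^ x) 0 = rotate x [0..<n] ! 0"
      using that by (metis (no_types, lifting) add.left_neutral gr_implies_not0 length_upt neq0_conv
        nth_map nth_upt minus_nat.diff_0)
    also have "\<dots> = x" using that by (simp add: nth_rotate)
    finally have eq: "(?g ^^ x) 0 = x" .
    show ?thesis
      unfolding orbit_altdef_permutation[OF g] by (intro CollectI exI[of _ x]) (simp add: eq)
  qed
  then have "u \<in> orbit ?g 0" "v \<in> orbit ?g 0" using assms by auto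
  then show ?thesis using g by (metis orbit_eq_iff_mem)
qed

context asymmetric_steiner_multicycle
begin

lemma finite_verts: "finite (pverts D)"
  and arcs: "parcs D = {(u, v). (u, v) \<in> pverts D \<times> pverts D \<and> u \<noteq> v}"
  using complete by (auto simp: complete_digraph_pair_def)

text \<open>A fixed point would be an orbit with one element, but it has to contain a terminal set,
  which has at least two.\<close>

lemma two_factor_of_respecting_permutation:
  assumes s: "s permutes pverts D"
    and same: "\<forall>T\<in>\<T>. \<forall>u\<in>T. \<forall>v\<in>T. v \<in> orbit s u"
  obtains F where "directed_two_factor D F" "two_factor_respects \<T> F"
    "two_factor_arcs F = {(v, s v) |v. v \<in> pverts D}"
    "two_factor_weight w F = (\<Sum>v\<in>pverts D. w (v, s v))"
    "\<forall>v\<in>pverts D. s v \<noteq> v"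
proof -
  have ps: "permutation s" using s finite_verts permutation_permutes by blast
  have no_fix: "\<forall>v\<in>pverts D. s v \<noteq> v"
  proof (intro ballI notI)
    fix v assume v: "v \<in> pverts D"
    assume "s v = v"
    then have orb: "orbit s v = {v}" by (simp add: orbit_eq_singleton_iff)
    obtain T where T: "T \<in> \<T>" "v \<in> T"
      using terminals_partition v by (auto simp: partition_on_def)
    then have "T \<subseteq> {v}" using same orb by blast
    then have "card T \<le> 1" using card_mono[of "{v}" T] by simp
    then show False using terminals_card[OF T(1)] by simp
  qed
  obtain F where F: "directed_two_factor D F" "two_factor_arcs F = {(v, s v) |v. v \<in> pverts D}"
    "\<forall>C\<in>F. \<exists>v\<in>pverts D. cycle_verts C = orbit s v"
    by (rule two_factor_of_permutation[OF finite_verts arcs s no_fix])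
  have resp: "two_factor_respects \<T> F"
    unfolding two_factor_respects_def cycle_respects_def
  proof (intro ballI)
    fix C T assume CT: "C \<in> F" "T \<in> \<T>"
    obtain v where C: "cycle_verts C = orbit s v" using F(3) CT by blast
    show "T \<subseteq> cycle_verts C \<or> T \<inter> cycle_verts C = {}"
    proof (cases "T \<inter> cycle_verts C = {}")
      case False
      then obtain x where x: "x \<in> T" "x \<in> orbit s v" using C by auto
      then have "orbit s v = orbit s x" using orbit_eq_iff_mem[OF ps] by blast
      then show ?thesis using same CT(2) x(1) C by auto
    qed simp
  qed
  have weight: "two_factor_weight w F = (\<Sum>v\<in>pverts D. w (v, s v))"
  proof -
    have "two_factor_arcs F = (\<lambda>v. (v, s v)) ` pverts D" unfolding F(2) by auto
    then show ?thesis unfolding two_factor_weight_def by (simp add: sum.reindex inj_on_def)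
  qed
  show ?thesis by (rule that[OF F(1) resp F(2) weight no_fix])
qed

text \<open>\<open>g\<close> only witnesses that there is a solution; \<open>f\<close> comes from
  one that attains the minimum.\<close>

lemma opt_permutation:
  assumes g: "g permutes pverts D" "\<forall>T\<in>\<T>. \<forall>u\<in>T. \<forall>v\<in>T. v \<in> orbit g u"
  obtains f where "f permutes pverts D" "opt D w \<T> = (\<Sum>v\<in>pverts D. w (v, f v))"
    "\<forall>T\<in>\<T>. \<forall>u\<in>T. \<forall>v\<in>T. v \<in> orbit f u"
    "\<forall>v\<in>pverts D. (v, f v) \<in> parcs D"
proof -
  let ?S = "{two_factor_weight w F |F. directed_two_factor D F \<and> two_factor_respects \<T> F}"
  obtain F0 where "directed_two_factor D F0" "two_factor_respects \<T> F0"
    by (rule two_factor_of_respecting_permutation[OF g])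
  then have "?S \<noteq> {}" by blast
  then have "opt D w \<T> \<in> ?S" unfolding opt_def using finite_two_factor_weights by (intro Min_in)
  then obtain F where F: "directed_two_factor D F" "two_factor_respects \<T> F"
    "opt D w \<T> = two_factor_weight w F" by blast
  obtain f where f: "f permutes pverts D" "two_factor_weight w F = (\<Sum>v\<in>pverts D. w (v, f v))"
    "\<forall>C\<in>F. \<forall>u\<in>cycle_verts C. \<forall>v\<in>cycle_verts C. v \<in> orbit f u"
    "\<forall>v\<in>pverts D. (v, f v) \<in> parcs D"
    by (rule permutation_of_two_factor[OF finite_verts F(1), of w])
  have same: "\<forall>T\<in>\<T>. \<forall>u\<in>T. \<forall>v\<in>T. v \<in> orbit f u"
  proof (intro ballI)
    fix T u v assume uv: "T \<in> \<T>" "u \<in> T" "v \<in> T"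
    have "u \<in> pverts D" using uv terminals_partition by (auto simp: partition_on_def)
    then obtain C where C: "C \<in> F" "u \<in> cycle_verts C"
      using F(1) by (auto simp: directed_two_factor_def)
    then have "T \<subseteq> cycle_verts C"
      using F(2) uv by (auto simp: two_factor_respects_def cycle_respects_def)
    then show "v \<in> orbit f u" using f(3) C uv by blast
  qed
  have "opt D w \<T> = (\<Sum>v\<in>pverts D. w (v, f v))" using f(2) F(3) by simp
  from that[OF f(1) this same f(4)] show ?thesis .
qed

end

section \<open>The encoded instance\<close>

lemma terminal_label_eq_iff:
  assumes part: "partition_on V \<T>" and fin: "finite V" and uv: "u \<in> V" "v \<in> V"
  shows "terminal_label \<T> u = terminal_label \<T> v \<longleftrightarrow> (\<exists>T\<in>\<T>. u \<in> T \<and> v \<in> T)"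
proof -
  have uniq: "T = T'" if "T \<in> \<T>" "T' \<in> \<T>" "x \<in> T" "x \<in> T'" for T T' x
    using part that by (auto simp: partition_on_def disjoint_def)
  have lab: "terminal_label \<T> x = Min T" if "T \<in> \<T>" "x \<in> T" for T x
  proof -
    have "(THE T. T \<in> \<T> \<and> x \<in> T) = T" using that uniq by (intro the_equality) blast+
    then show ?thesis by (simp add: terminal_label_def)
  qed
  have mem: "Min T \<in> T" if "T \<in> \<T>" "x \<in> T" for T x
    using that part fin by (intro Min_in) (auto simp: partition_on_def intro: finite_subset)
  obtain T T' where T: "T \<in> \<T>" "u \<in> T" "T' \<in> \<T>" "v \<in> T'"
    using part uv by (auto simp: partition_on_def)
  show ?thesis
  proof
    assume "terminal_label \<T> u = terminal_label \<T> v"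
    then have "Min T = Min T'" using lab T by simp
    then have "T = T'" using uniq[of T T' "Min T"] mem T by metis
    then show "\<exists>T\<in>\<T>. u \<in> T \<and> v \<in> T" using T by blast
  next
    assume "\<exists>T\<in>\<T>. u \<in> T \<and> v \<in> T"
    then show "terminal_label \<T> u = terminal_label \<T> v" using lab by metis
  qed
qed

lemma input_store_simps:
  assumes "asymmetric_steiner_multicycle D w \<T>" and V: "pverts D = {..<n}"
  shows "input_store D w \<T> ''size'' 0 = int n"
    "\<And>u v. u < n \<Longrightarrow> v < n \<Longrightarrow> input_store D w \<T> ''num'' (ix n 0 u v) =
      (if u = v then 0 else fst (quotient_of (w (u, v))))"
    "\<And>u v. u < n \<Longrightarrow> v < n \<Longrightarrow> input_store D w \<T> ''den'' (ix n 0 u v) =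
      (if u = v then 0 else snd (quotient_of (w (u, v))))"
    "\<And>v. v < n \<Longrightarrow> input_store D w \<T> ''term'' (int v) = int (terminal_label \<T> v)"
proof -
  interpret asymmetric_steiner_multicycle D w \<T> by (rule assms)
  have arcs_n: "(u, v) \<in> parcs D \<longleftrightarrow> u < n \<and> v < n \<and> u \<noteq> v" for u v by (simp add: arcs V)
  have card: "card (pverts D) = n" by (simp add: V)
  show "input_store D w \<T> ''size'' 0 = int n" by (simp add: input_store_def card Let_def)
  have ix: "0 \<le> ix n 0 u v \<and> nat (ix n 0 u v) div n = u \<and> nat (ix n 0 u v) mod n = v"
    if "u < n" "v < n" for u v
  proof -
    have "ix n 0 u v = int (u * n + v)" by (simp add: ix_def)
    then have "0 \<le> ix n 0 u v" "nat (ix n 0 u v) = u * n + v" by (simp_all del: of_nat_add of_nat_mult)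
    moreover have "(u * n + v) div n = u" "(u * n + v) mod n = v" using that by simp_all
    ultimately show ?thesis by simp
  qed
  show "input_store D w \<T> ''num'' (ix n 0 u v) = (if u = v then 0 else fst (quotient_of (w (u, v))))"
    if "u < n" "v < n" for u v
    using ix[OF that] arcs_n[of u v] that by (simp add: input_store_def card Let_def)
  show "input_store D w \<T> ''den'' (ix n 0 u v) = (if u = v then 0 else snd (quotient_of (w (u, v))))"
    if "u < n" "v < n" for u v
    using ix[OF that] arcs_n[of u v] that by (simp add: input_store_def card Let_def)
  show "input_store D w \<T> ''term'' (int v) = int (terminal_label \<T> v)" if "v < n" for v
    using that by (simp add: input_store_def card Let_def V)
qed

lemma input_store_size:
  assumes "asymmetric_steiner_multicycle D w \<T>"
  shows "int_size (input_store D w \<T> x i) \<le> input_size D w \<T>" "card (pverts D) \<le> input_size D w \<T>"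
proof -
  interpret asymmetric_steiner_multicycle D w \<T> by (rule assms)
  let ?E = "\<lambda>e. int_size (fst (quotient_of (w e))) + int_size (snd (quotient_of (w e)))"
  let ?L = "\<lambda>v. int_size (int (terminal_label \<T> v))"
  have finE: "finite (parcs D)"
    unfolding arcs by (rule finite_subset[of _ "pverts D \<times> pverts D"]) (auto simp: finite_verts)
  have "?E e \<le> sum ?E (parcs D)" if "e \<in> parcs D" for e
    using that finE by (intro member_le_sum) auto
  then have e: "?E e \<le> input_size D w \<T>" if "e \<in> parcs D" for e
    using that unfolding input_size_def by (meson le_add1 le_add2 le_trans)
  have "?L v \<le> sum ?L (pverts D)" if "v \<in> pverts D" for v
    using that finite_verts by (intro member_le_sum) auto
  then have l: "?L v \<le> input_size D w \<T>" if "v \<in> pverts D" for v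
    using that unfolding input_size_def by (meson le_add2 le_trans)
  have z: "int_size 0 \<le> input_size D w \<T>"
  proof -
    have "int_size 0 \<le> int_size (int (card (pverts D)))" by (rule int_size_mono) simp
    then show ?thesis unfolding input_size_def by linarith
  qed
  have c: "int_size (int (card (pverts D))) \<le> input_size D w \<T>" unfolding input_size_def by linarith
  show "int_size (input_store D w \<T> x i) \<le> input_size D w \<T>"
  proof -
    let ?e = "(nat i div card (pverts D), nat i mod card (pverts D))"
    have "input_store D w \<T> x i \<in> {0, int (card (pverts D))} \<or>
      ?e \<in> parcs D \<and> input_store D w \<T> x i \<in> {fst (quotient_of (w ?e)), snd (quotient_of (w ?e))} \<or>
      nat i \<in> pverts D \<and> input_store D w \<T> x i = int (terminal_label \<T> (nat i))"
      by (simp add: input_store_def Let_def)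
    then show ?thesis using z c e[of ?e] l[of "nat i"] by auto
  qed
  \<comment> \<open>Every vertex contributes its label, of at least one bit, to the input.\<close>
  have "card (pverts D) = (\<Sum>v\<in>pverts D. 1)" by simp
  also have "\<dots> \<le> sum ?L (pverts D)" by (intro sum_mono int_size_pos)
  finally show "card (pverts D) \<le> input_size D w \<T>" unfolding input_size_def by linarith
qed

lemma sem_main:
  assumes inst: "asymmetric_steiner_multicycle D w \<T>" and V: "pverts D = {..<n}"
  defines "s \<equiv> sem main_prog (input_store D w \<T>)"
  shows "\<exists>F. outputs_two_factor s D F \<and> directed_two_factor D F \<and> two_factor_respects \<T> F \<and>
    of_rat (two_factor_weight w F) \<le> (2 * harm n :: real) * of_rat (opt D w \<T>)"
proof -
  interpret asymmetric_steiner_multicycle D w \<T> by (rule inst)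
  let ?in = "input_store D w \<T>"
  note inp = input_store_simps[OF inst V]
  define tm where "tm = terminal_label \<T>"
  have tm_iff: "tm u = tm v \<longleftrightarrow> (\<exists>T\<in>\<T>. u \<in> T \<and> v \<in> T)" if "u < n" "v < n" for u v
    unfolding tm_def using terminal_label_eq_iff[OF terminals_partition finite_verts] that V by simp
  have T_sub: "x < n" if "T \<in> \<T>" "x \<in> T" for T x
    using that terminals_partition V by (auto simp: partition_on_def)
  have cyc: "cycle_of_list [0..<n] permutes pverts D"
    using cycle_permutes[of "[0..<n]"] by (simp add: V atLeast0LessThan)
  have cyc_orbit: "\<forall>T\<in>\<T>. \<forall>u\<in>T. \<forall>v\<in>T. v \<in> orbit (cycle_of_list [0..<n]) u"
    by (intro ballI all_in_orbit_cycle_of_list T_sub)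
  obtain f where f: "f permutes pverts D" "opt D w \<T> = (\<Sum>v\<in>pverts D. w (v, f v))"
    "\<forall>T\<in>\<T>. \<forall>u\<in>T. \<forall>v\<in>T. v \<in> orbit f u"
    "\<forall>v\<in>pverts D. (v, f v) \<in> parcs D"
    by (rule opt_permutation[OF cyc cyc_orbit])
  have f_tm: "v \<in> orbit f u" if "u < n" "v < n" "tm u = tm v" for u v
    using f(3) tm_iff that by blast
  define s1 where "s1 = set_cell ''P'' 0 1 ?in"
  define s2 where "s2 = sem denominators_prog s1"
  define s3 where "s3 = sem weights_prog s2"
  define s4 where "s4 = sem init_prog s3"
  have s: "s = sem (LFor ''r'' round_prog) s4"
    unfolding s_def main_prog_def s1_def s2_def s3_def s4_def by simp
  have f1: "s1 x = ?in x" if "x \<noteq> ''P''" for x using that by (simp add: s1_def)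
  have f2: "s2 x = s1 x" if "x \<notin> {''u'', ''v'', ''P''}" for x
    unfolding s2_def using that by (intro sem_not_written) (simp add: writes_progs)
  have f3: "s3 x = s2 x" if "x \<notin> {''u'', ''v'', ''W''}" for x
    unfolding s3_def using that by (intro sem_not_written) (simp add: writes_progs)
  have f4: "s4 x = s3 x" if "x \<notin> {''v'', ''succ'', ''cp''}" for x
    unfolding s4_def using that by (intro sem_not_written) (simp add: writes_progs)
  have sz: "s1 ''size'' 0 = int n" "s2 ''size'' 0 = int n" "s3 ''size'' 0 = int n" "s4 ''size'' 0 = int n"
    using inp(1) by (simp_all add: f1 f2 f3 f4)
  define P where "P = s2 ''P'' 0"
  have P1: "0 < s1 ''P'' 0" by (simp add: s1_def)
  have P: "0 < P" unfolding P_def s2_def by (rule sem_denominators(1)[where ?s0.0 = s1, OF sz(1) P1])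
  have den_frame: "s1 ''den'' = ?in ''den''" by (simp add: f1)
  have dvd: "snd (quotient_of (w (u, v))) dvd P" if "u < n" "v < n" "u \<noteq> v" for u v
  proof -
    have "0 < s1 ''den'' (ix n 0 u v)"
      using inp(3)[of u v] that quotient_of_denom_pos' by (simp add: den_frame)
    then have "s1 ''den'' (ix n 0 u v) dvd P"
      unfolding P_def s2_def by (rule sem_denominators(2)[where ?s0.0 = s1, OF sz(1) P1 that(1,2)])
    then show ?thesis using inp(3)[of u v] that by (simp add: den_frame)
  qed
  \<comment> \<open>Scaling by \<open>P\<close> makes the weights integers; the positive factor
    cancels at the end. The diagonal is set to 0 because nothing is known about \<open>w\<close>
    there.\<close>
  define c :: "nat \<Rightarrow> nat \<Rightarrow> real" where
    "c u v = (if u = v then 0 else real_of_int P * of_rat (w (u, v)))" for u v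
  have W: "real_of_int (s4 ''W'' (ix n 0 u v)) = c u v" if uv: "u < n" "v < n" for u v
  proof -
    have fr: "s2 ''num'' = ?in ''num''" "s2 ''den'' = ?in ''den''" "s4 ''W'' = s3 ''W''"
      by (simp_all add: f1 f2 f4)
    have W3: "s3 ''W'' (ix n 0 u v) = (P div ?in ''den'' (ix n 0 u v)) * ?in ''num'' (ix n 0 u v)"
      unfolding s3_def P_def using sem_weights[where ?s0.0 = s2, OF sz(2) uv] fr by simp
    show ?thesis
    proof (cases "u = v")
      case True
      then show ?thesis using W3 inp(2)[OF uv] by (simp add: fr c_def)
    next
      case False
      obtain a b where q: "quotient_of (w (u, v)) = (a, b)" by (cases "quotient_of (w (u, v))")
      have b: "b > 0" "b dvd P" using quotient_of_denom_pos[OF q] dvd[OF uv False] q by auto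
      have "w (u, v) = of_int a / of_int b" by (rule quotient_of_div[OF q])
      then have w: "(of_rat (w (u, v)) :: real) = of_int a / of_int b" by (simp add: of_rat_divide)
      have "s4 ''W'' (ix n 0 u v) = (P div b) * a"
        using W3 inp(2,3)[OF uv] False q by (simp add: fr)
      moreover obtain m where "P = b * m" using b(2) by blast
      ultimately show ?thesis using False b(1) w by (simp add: c_def)
    qed
  qed
  have in_arcs: "(u, v) \<in> parcs D" if "u < n" "v < n" "u \<noteq> v" for u v
    using that by (simp add: arcs V)
  have metric: "asym_metric {..<n} c"
  proof
    show "0 \<le> c x y" if "x \<in> {..<n}" "y \<in> {..<n}" for x y
      using that P weight_nonneg[OF in_arcs[of x y]] by (auto simp: c_def zero_le_of_rat_iff)
    then have nn: "0 \<le> c x y" if "x < n" "y < n" for x y using that by simp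
    show "c x z \<le> c x y + c y z" if "x \<in> {..<n}" "y \<in> {..<n}" "z \<in> {..<n}" for x y z
    proof (cases "x = y \<or> y = z \<or> x = z")
      case True
      then show ?thesis using nn[of x y] nn[of y z] that by (auto simp: c_def)
    next
      case False
      then have "w (x, z) \<le> w (x, y) + w (y, z)" using that V by (intro triangle) auto
      then have "(of_rat (w (x, z)) :: real) \<le> of_rat (w (x, y)) + of_rat (w (y, z))"
        by (simp only: of_rat_add[symmetric] of_rat_less_eq)
      then have "real_of_int P * of_rat (w (x, z)) \<le> real_of_int P * (of_rat (w (x, y)) + of_rat (w (y, z)))"
        using P by (intro mult_left_mono) auto
      then show ?thesis using False by (simp add: c_def distrib_left)
    qed
  qed (auto simp: c_def)
  have tm4: "s4 ''term'' (int v) = int (tm v)" if "v < n" for v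
    using inp(4)[OF that] by (simp add: f1 f2 f3 f4 tm_def)
  have init: "s4 ''succ'' (int v) = int v" "s4 ''cp'' (int v) = int v" if "v < n" for v
    unfolding s4_def using sem_init[where ?s0.0 = s3, OF sz(3) that] by auto
  have f_perm: "f permutes {..<n}" using f(1) V by simp
  obtain \<sigma> where \<sigma>: "\<sigma> permutes {..<n}" "\<forall>v<n. s ''succ'' (int v) = int (\<sigma> v)"
    "\<forall>u<n. \<forall>v<n. tm u = tm v \<longrightarrow> v \<in> orbit \<sigma> u"
    "(\<Sum>v<n. c v (\<sigma> v)) \<le> 2 * harm n * (\<Sum>v<n. c v (f v))"
    unfolding s by (rule sem_rounds[where ?s0.0 = s4, OF metric f_perm _ sz(4)], erule (2) f_tm, erule tm4,
        erule (1) W, erule init(1), erule init(2))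
  have \<sigma>_V: "\<sigma> permutes pverts D" using \<sigma>(1) V by simp
  have \<sigma>_same: "\<forall>T\<in>\<T>. \<forall>u\<in>T. \<forall>v\<in>T. v \<in> orbit \<sigma> u"
  proof (intro ballI)
    fix T u v assume T: "T \<in> \<T>" "u \<in> T" "v \<in> T"
    then have uv: "u < n" "v < n" using T_sub by auto
    then have "tm u = tm v" unfolding tm_iff[OF uv] using T by blast
    then show "v \<in> orbit \<sigma> u" using \<sigma>(3) uv by blast
  qed
  obtain F where F: "directed_two_factor D F" "two_factor_respects \<T> F"
    "two_factor_arcs F = {(v, \<sigma> v) |v. v \<in> pverts D}"
    "two_factor_weight w F = (\<Sum>v\<in>pverts D. w (v, \<sigma> v))"
    "\<forall>v\<in>pverts D. \<sigma> v \<noteq> v"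
    by (rule two_factor_of_respecting_permutation[OF \<sigma>_V \<sigma>_same])
  \<comment> \<open>At fixed points \<open>c\<close> is 0 and may differ from the scaled
    \<open>w\<close>. They are excluded for \<sigma> by the size of the terminal sets and for
    \<open>f\<close> because loops are not arcs.\<close>
  have weight: "(\<Sum>v<n. c v (g v)) = real_of_int P * of_rat (\<Sum>v\<in>pverts D. w (v, g v))"
    if "\<forall>v\<in>pverts D. g v \<noteq> v" for g
  proof -
    have "(\<Sum>v<n. c v (g v)) = (\<Sum>v<n. real_of_int P * of_rat (w (v, g v)))"
    proof (rule sum.cong)
      fix v assume "v \<in> {..<n}"
      then have "g v \<noteq> v" using that V by blast
      then show "c v (g v) = real_of_int P * of_rat (w (v, g v))" by (simp add: c_def)
    qed simp
    then show ?thesis by (simp add: V of_rat_sum sum_distrib_left)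
  qed
  have "\<forall>v\<in>pverts D. f v \<noteq> v" using f(4) by (auto simp: arcs)
  then have "real_of_int P * of_rat (two_factor_weight w F) \<le> real_of_int P * (2 * harm n * of_rat (opt D w \<T>))"
    using \<sigma>(4) weight[of f] weight[of \<sigma>] F(4,5) f(2) by (simp add: mult_ac)
  then have "of_rat (two_factor_weight w F) \<le> (2 * harm n :: real) * of_rat (opt D w \<T>)"
    using P by (simp add: mult_le_cancel_left_pos)
  moreover have "outputs_two_factor s D F"
    unfolding outputs_two_factor_def F(3) using \<sigma>(2) V by auto
  ultimately show ?thesis using F(1,2) by blast
qed

text \<open>Sizes of the initial values are shifted by \<open>2\<close> because the size analysis of programs
  needs room for the constant \<open>1\<close>.\<close>

definition time_poly :: "nat poly" where
  "time_poly = pcompose (time_coeff main_prog * ([:0, 1:] + growth main_prog * [:0, 1:])) [:2, 1:]"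

lemma exec_main:
  assumes inst: "asymmetric_steiner_multicycle D w \<T>" and V: "pverts D = {..<n}"
  shows "\<exists>t. exec (compile main_prog) (input_store D w \<T>) t (sem main_prog (input_store D w \<T>)) \<and>
    t \<le> poly time_poly (input_size D w \<T>)"
proof -
  let ?B = "input_size D w \<T> + 2"
  have le: "int_size (input_store D w \<T> x i) \<le> ?B" for x i
    using input_store_size(1)[OF inst, of x i] by simp
  have n: "n \<le> ?B" using input_store_size(2)[OF inst] V by simp
  obtain t where t: "exec (compile main_prog) (input_store D w \<T>) t (sem main_prog (input_store D w \<T>))"
    "t \<le> poly (time_coeff main_prog) n * (?B + poly (growth main_prog) n * ?B)"
    using exec_compile[OF wf_main_prog, of ?B "input_store D w \<T>" ?B n] le
      input_store_simps(1)[OF inst V] by (auto simp: bounded_store_def)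
  note t(2)
  also have "poly (time_coeff main_prog) n * (?B + poly (growth main_prog) n * ?B)
      \<le> poly (time_coeff main_prog) ?B * (?B + poly (growth main_prog) ?B * ?B)"
    using poly_nat_mono[OF n] by (intro mult_le_mono add_le_mono) auto
  also have "\<dots> = poly time_poly (input_size D w \<T>)"
  proof -
    have "poly [:2, 1:] x = x + 2" "poly [:0, 1:] x = x" for x :: nat by simp_all
    then show ?thesis by (simp only: time_poly_def poly_pcompose poly_mult poly_add)
  qed
  finally show ?thesis using t(1) by blast
qed

theorem theorem3:
  shows "\<exists>(alg :: com) (p :: nat poly) (f :: nat \<Rightarrow> real).
    f \<in> O(\<lambda>n. log 2 (real n)) \<and>
    (\<forall>(n :: nat) (D :: nat pair_pre_digraph) (w :: nat \<times> nat \<Rightarrow> rat) (\<T> :: nat set set).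
       asymmetric_steiner_multicycle D w \<T> \<and> pverts D = {..<n} \<longrightarrow>
       (\<exists>t s F.
          exec alg (input_store D w \<T>) t s \<and>
          t \<le> poly p (input_size D w \<T>) \<and>
          outputs_two_factor s D F \<and>
          directed_two_factor D F \<and>
          two_factor_respects \<T> F \<and>
          of_rat (two_factor_weight w F) \<le> f n * of_rat (opt D w \<T>)))"
proof (rule exI[of _ "compile main_prog"], rule exI[of _ time_poly], rule exI[of _ "\<lambda>n. 2 * harm n"],
    intro conjI allI impI)
  show "(\<lambda>n. 2 * harm n) \<in> O(\<lambda>n. log 2 (real n))" by (rule harm_bigo_log)
  fix n :: nat and D :: "nat pair_pre_digraph" and w :: "nat \<times> nat \<Rightarrow> rat" and \<T> :: "nat set set"
  assume "asymmetric_steiner_multicycle D w \<T> \<and> pverts D = {..<n}"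
  then have inst: "asymmetric_steiner_multicycle D w \<T>" "pverts D = {..<n}" by auto
  from exec_main[OF inst] sem_main[OF inst]
  show "\<exists>t s F. exec (compile main_prog) (input_store D w \<T>) t s \<and>
      t \<le> poly time_poly (input_size D w \<T>) \<and> outputs_two_factor s D F \<and>
      directed_two_factor D F \<and> two_factor_respects \<T> F \<and>
      of_rat (two_factor_weight w F) \<le> (2 * harm n :: real) * of_rat (opt D w \<T>)"
    by blast
qed

end
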